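(* Suppose that $\Omega^2A$ is finitely generated projective as a right $A$-module. Then the left covariant derivative $\nabla_{\mathcal DA}:\mathcal DA\to\Omega^1A\otimes_A\mathcal DA$, $\nabla_{\mathcal DA}([\underline v])=\sum_i\xi_i\otimes[u_i\bullet\underline v]$, has zero curvature, i.e. $R_{\mathcal DA}=(\mathrm d\otimes\mathrm{id}-\mathrm{id}\wedge\nabla_{\mathcal DA})\nabla_{\mathcal DA}=0:\mathcal DA\to\Omega^2A\otimes_A\mathcal DA$.
   Context: Setting. $A$ is a unital algebra over $\mathbb C$ and $(\Omega A=\oplus_{n\ge0}\Omega^nA,\mathrm d,\wedge)$ is a differential graded algebra with $\Omega^0A=A$, $\mathrm d^2=0$, graded Leibniz rule, generated over $A$ by $\Omega^1A$, with $\Omega^1A=A.\mathrm dA$ (no graded commutativity). $\Omega^1A$ is finitely generated projective as a right $A$-module; $\mathrm{Vec}A=\mathrm{Hom}_A(\Omega^1A,A)$ (right module maps), a bimodule by $(a.v)(\xi)=a\,v(\xi)$, $(v.a)(\xi)=v(a\xi)$; $\mathrm{ev}:\mathrm{Vec}A\otimes_A\Omega^1A\to A$ is evaluation and $\sum_i\xi_i\otimes u_i\in\Omega^1A\otimes_A\mathrm{Vec}A$ is the dual basis ($\xi=\sum_i\xi_i.u_i(\xi)$). $\Omega^{\otimes n}A$, $\mathrm{Vec}^{\otimes n}A$ are $n$-fold tensor powers over $A$ (equal to $A$ for $n=0$). Covariant derivatives. A left covariant derivative satisfies $\nabla_E(ae)=\mathrm da\otimes e+a\nabla_E(e)$. A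 right bimodule covariant derivative $(\square,\sigma^{-1})$ on $\Omega^1A$ is fixed: $\square:\Omega^1A\to\Omega^1A\otimes_A\Omega^1A$ with $\square(\xi a)=\square(\xi)a+\xi\otimes\mathrm da$ and $\square(a\xi)=a\square(\xi)+\sigma^{-1}(\mathrm da\otimes\xi)$, where $\sigma^{-1}:\Omega^{\otimes2}A\to\Omega^{\otimes2}A$ is a bimodule map (not assumed invertible). The dual left bimodule covariant derivative $\square:\mathrm{Vec}A\to\Omega^1A\otimes_A\mathrm{Vec}A$ is determined by $\mathrm d\circ\mathrm{ev}=(\mathrm{id}\otimes\mathrm{ev})(\square\otimes\mathrm{id})+(\mathrm{ev}\otimes\mathrm{id})(\mathrm{id}\otimes\square)$, with $\sigma=(\mathrm{ev}\otimes\mathrm{id}\otimes\mathrm{id})(\mathrm{id}\otimes\sigma^{-1}\otimes\mathrm{id})(\mathrm{id}\otimes\mathrm{id}\otimes\mathrm{coev}(1)):\mathrm{Vec}A\otimes_A\Omega^1A\to\Omega^1A\otimes_A\mathrm{Vec}A$, $\mathrm{coev}(1)=\sum_i\xi_i\otimes u_i$. It extends to $\square^{\langle n\rangle}:\mathrm{Vec}^{\otimes n}A\to\Omega^1A\otimes_A\mathrm{Vec}^{\otimes n}A$ by $\square^{\langle0\rangle}=\mathrm d$, $\square^{\langle1\rangle}=\square$, $\square^{\langle n+1\rangle}=\square\otimes\mathrm{id}^{\otimes n}+(\sigma\otimes\mathrm{id}^{\otimes n})(\mathrm{id}\otimes\square^{\langle n\rangle})$. Product. $\mathcal T\mathrm{Vec}A=\bigoplus_{n\ge0}\mathrm{Vec}^{\otimes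 n}A$ carries an associative unital product $\bullet$ determined by $a\bullet\underline w=a.\underline w$, $u\bullet\underline w=u\otimes\underline w+(\mathrm{ev}\otimes\mathrm{id}^{\otimes m})(u\otimes\square^{\langle m\rangle}\underline w)$ and $(u\otimes\underline v)\bullet\underline w=u\bullet(\underline v\bullet\underline w)-\big((\mathrm{ev}\otimes\mathrm{id}^{\otimes n})(u\otimes\square^{\langle n\rangle}\underline v)\big)\bullet\underline w$, for $a\in A$, $u\in\mathrm{Vec}A$, $\underline v\in\mathrm{Vec}^{\otimes n}A$, $\underline w\in\mathrm{Vec}^{\otimes m}A$. $\mathcal T\mathrm{Vec}A_\bullet$ denotes this algebra, with left $A$-action the usual one and right $A$-action $\bullet$. The algebra $\mathcal DA$. $\mathcal R=\sum_i\mathrm d\xi_i\otimes u_i-\sum_{i,j}\xi_i\wedge\xi_j\otimes(u_j\bullet u_i)\in\Omega^2A\otimes_A\mathcal T\mathrm{Vec}A_\bullet$. $(\Omega^2A)'=\mathrm{Hom}_A(\Omega^2A,A)$ (right module maps), and $\widehat{\mathcal R}:(\Omega^2A)'\to\mathcal T\mathrm{Vec}A_\bullet$ is $\widehat{\mathcal R}(\alpha)=(\alpha\otimes\mathrm{id})\mathcal R$. $\mathcal W$ is the two-sided ideal of $\mathcal T\mathrm{Vec}A_\bullet$ (for $\bullet$) generated by the image of $\widehat{\mathcal R}$; $\mathcal DA=\mathcal T\mathrm{Vec}A_\bullet/\mathcal W$ and $[\underline v]$ is the class of $\underline v$. *)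

theory Defs
  imports "HOL-Algebra.Free_Abelian_Groups" "HOL-Algebra.QuotRing" "HOL-Algebra.Generated_Rings"
begin

section \<open>Bimodules over a noncommutative ring\<close>

text \<open>
  Left modules are represented by the record \<open>module\<close> of HOL-Algebra and bimodules by its
  extension below with a right action. The locale \<open>module\<close> of HOL-Algebra assumes a
  commutative base ring, so only the record is used over the noncommutative base. The
  fields \<open>mult\<close> and \<open>one\<close> of a record used merely as a module are irrelevant.
\<close>

record ('a, 'm) bimodule = "('a, 'm) module" +
  rsmult :: "'m \<Rightarrow> 'a \<Rightarrow> 'm" (infixl \<open>\<lhd>\<index>\<close> 70)

definition regular :: "('a, 'z) ring_scheme \<Rightarrow> ('a, 'a) bimodule" where
  "regular A = \<lparr>carrier = carrier A, mult = mult A, one = one A, zero = zero A, add = add A,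
     smult = mult A, rsmult = mult A\<rparr>"

definition free_bimodule :: "('a, 'z) ring_scheme \<Rightarrow> nat \<Rightarrow> ('a, nat \<Rightarrow> 'a) bimodule" where
  "free_bimodule A n =
    \<lparr>carrier = {..<n} \<rightarrow>\<^sub>E carrier A, mult = undefined, one = undefined,
     zero = (\<lambda>i\<in>{..<n}. \<zero>\<^bsub>A\<^esub>),
     add = (\<lambda>x y. \<lambda>i\<in>{..<n}. x i \<oplus>\<^bsub>A\<^esub> y i),
     smult = (\<lambda>a x. \<lambda>i\<in>{..<n}. a \<otimes>\<^bsub>A\<^esub> x i),
     rsmult = (\<lambda>x a. \<lambda>i\<in>{..<n}. x i \<otimes>\<^bsub>A\<^esub> a)\<rparr>"

definition right_hom ::
  "('a, 'z) ring_scheme \<Rightarrow> ('a, 'm, 'y) bimodule_scheme \<Rightarrow> ('a, 'n, 'x) bimodule_scheme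
    \<Rightarrow> ('m \<Rightarrow> 'n) set" where
  "right_hom A M N = {f \<in> carrier M \<rightarrow>\<^sub>E carrier N.
     (\<forall>x\<in>carrier M. \<forall>y\<in>carrier M. f (x \<oplus>\<^bsub>M\<^esub> y) = f x \<oplus>\<^bsub>N\<^esub> f y) \<and>
     (\<forall>x\<in>carrier M. \<forall>a\<in>carrier A. f (x \<lhd>\<^bsub>M\<^esub> a) = f x \<lhd>\<^bsub>N\<^esub> a)}"

text \<open>\<open>Hom\<^sub>A(M, A)\<close> (right module maps), with \<open>(a.f)(x) = a f(x)\<close> and \<open>(f.a)(x) = f(a x)\<close>.\<close>

definition dual ::
  "('a, 'z) ring_scheme \<Rightarrow> ('a, 'm, 'y) bimodule_scheme \<Rightarrow> ('a, 'm \<Rightarrow> 'a) bimodule" where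
  "dual A M =
    \<lparr>carrier = right_hom A M (regular A), mult = undefined, one = undefined,
     zero = (\<lambda>x\<in>carrier M. \<zero>\<^bsub>A\<^esub>),
     add = (\<lambda>f g. \<lambda>x\<in>carrier M. f x \<oplus>\<^bsub>A\<^esub> g x),
     smult = (\<lambda>a f. \<lambda>x\<in>carrier M. a \<otimes>\<^bsub>A\<^esub> f x),
     rsmult = (\<lambda>f a. \<lambda>x\<in>carrier M. f (a \<odot>\<^bsub>M\<^esub> x))\<rparr>"

text \<open>A right module is finitely generated projective if it is (isomorphic to) a direct
  summand of some \<open>A\<^sup>n\<close>.\<close>

definition fg_projective_right ::
  "('a, 'z) ring_scheme \<Rightarrow> ('a, 'm, 'y) bimodule_scheme \<Rightarrow> bool" where
  "fg_projective_right A M \<longleftrightarrow>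
    (\<exists>n. \<exists>i \<in> right_hom A M (free_bimodule A n). \<exists>p \<in> right_hom A (free_bimodule A n) M.
       \<forall>x\<in>carrier M. p (i x) = x)"


section \<open>Abelian groups given by generators and relations\<close>

definition pres_class ::
  "'g set \<Rightarrow> ('g \<Rightarrow>\<^sub>0 int) set \<Rightarrow> ('g \<Rightarrow>\<^sub>0 int) \<Rightarrow> ('g \<Rightarrow>\<^sub>0 int) set" where
  "pres_class S R c =
     generate (free_Abelian_group S) R #>\<^bsub>free_Abelian_group S\<^esub> c"

definition presented :: "'g set \<Rightarrow> ('g \<Rightarrow>\<^sub>0 int) set \<Rightarrow> ('g \<Rightarrow>\<^sub>0 int) set ring" where
  "presented S R =
    (let F = free_Abelian_group S; Q = F Mod generate F R in
     \<lparr>carrier = carrier Q, mult = undefined, one = undefined, zero = one Q, add = mult Q\<rparr>)"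

text \<open>\<open>induced G f\<close> is the additive map from a group of the form \<open>presented S R\<close> to \<open>G\<close> with
  value \<open>f s\<close> on the class of the generator \<open>s\<close>. It is meaningful when the additive
  extension of \<open>f\<close> to the free group respects the relations \<open>R\<close>.\<close>

definition induced ::
  "('b, 'z) ring_scheme \<Rightarrow> ('g \<Rightarrow> 'b) \<Rightarrow> ('g \<Rightarrow>\<^sub>0 int) set \<Rightarrow> 'b" where
  "induced G f X = the_elem
     ((\<lambda>c. \<Oplus>\<^bsub>G\<^esub>s\<in>Poly_Mapping.keys c. [Poly_Mapping.lookup c s] \<cdot>\<^bsub>G\<^esub> f s) ` X)"


section \<open>Tensor products over a noncommutative ring\<close>

definition tensor_rels ::
  "('a, 'z) ring_scheme \<Rightarrow> ('a, 'm, 'y) bimodule_scheme \<Rightarrow> ('a, 'n, 'x) module_scheme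
    \<Rightarrow> ('m \<times> 'n \<Rightarrow>\<^sub>0 int) set" where
  "tensor_rels A M N =
     {frag_of (x \<oplus>\<^bsub>M\<^esub> x', y) - frag_of (x, y) - frag_of (x', y) | x x' y.
        x \<in> carrier M \<and> x' \<in> carrier M \<and> y \<in> carrier N} \<union>
     {frag_of (x, y \<oplus>\<^bsub>N\<^esub> y') - frag_of (x, y) - frag_of (x, y') | x y y'.
        x \<in> carrier M \<and> y \<in> carrier N \<and> y' \<in> carrier N} \<union>
     {frag_of (x \<lhd>\<^bsub>M\<^esub> a, y) - frag_of (x, a \<odot>\<^bsub>N\<^esub> y) | x a y.
        x \<in> carrier M \<and> a \<in> carrier A \<and> y \<in> carrier N}"

definition pure_tensor ::
  "('a, 'z) ring_scheme \<Rightarrow> ('a, 'm, 'y) bimodule_scheme \<Rightarrow> ('a, 'n, 'x) module_scheme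
    \<Rightarrow> 'm \<Rightarrow> 'n \<Rightarrow> ('m \<times> 'n \<Rightarrow>\<^sub>0 int) set" where
  "pure_tensor A M N x y =
     pres_class (carrier M \<times> carrier N) (tensor_rels A M N) (frag_of (x, y))"

text \<open>\<open>M \<otimes>\<^sub>A N\<close> as a left module; the right action on it, when \<open>N\<close> has one, is
  given separately.\<close>

definition tensor ::
  "('a, 'z) ring_scheme \<Rightarrow> ('a, 'm, 'y) bimodule_scheme \<Rightarrow> ('a, 'n, 'x) module_scheme
    \<Rightarrow> ('a, ('m \<times> 'n \<Rightarrow>\<^sub>0 int) set) module" where
  "tensor A M N =
    (let P = presented (carrier M \<times> carrier N) (tensor_rels A M N) in
     ring.extend P (module.fields
       (\<lambda>a. induced P (\<lambda>(x, y). pure_tensor A M N (a \<odot>\<^bsub>M\<^esub> x) y))))"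

definition tensor_rsmult ::
  "('a, 'z) ring_scheme \<Rightarrow> ('a, 'm, 'y) bimodule_scheme \<Rightarrow> ('a, 'n, 'x) bimodule_scheme
    \<Rightarrow> ('m \<times> 'n \<Rightarrow>\<^sub>0 int) set \<Rightarrow> 'a \<Rightarrow> ('m \<times> 'n \<Rightarrow>\<^sub>0 int) set" where
  "tensor_rsmult A M N X a =
     induced (tensor A M N) (\<lambda>(x, y). pure_tensor A M N x (y \<lhd>\<^bsub>N\<^esub> a)) X"

text \<open>\<open>(\<alpha> \<otimes> id)X\<close> for \<open>\<alpha> \<in> Hom\<^sub>A(M, A)\<close> and \<open>X \<in> M \<otimes>\<^sub>A N\<close>, in \<open>A \<otimes>\<^sub>A N = N\<close>. In particular
  \<open>contract N v X\<close> is \<open>(ev \<otimes> id)(v \<otimes> X)\<close>.\<close>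

definition contract ::
  "('a, 'n, 'x) module_scheme \<Rightarrow> ('m \<Rightarrow> 'a) \<Rightarrow> ('m \<times> 'n \<Rightarrow>\<^sub>0 int) set \<Rightarrow> 'n" where
  "contract N \<alpha> X = induced N (\<lambda>(x, y). \<alpha> x \<odot>\<^bsub>N\<^esub> y) X"

text \<open>
  The tensor algebra \<open>\<Oplus>\<^sub>n V\<^sup>\<otimes>\<^sup>n\<close> of a bimodule \<open>V\<close>. The generator \<open>(a, [v\<^sub>1, \<dots>, v\<^sub>n])\<close> stands
  for \<open>a.v\<^sub>1 \<otimes> \<dots> \<otimes> v\<^sub>n\<close>. The relations preserve the length \<open>n\<close>, so the
  presented group is the direct sum over \<open>n\<close> of the groups presented by the generators of
  length \<open>n\<close>; these are \<open>A \<otimes>\<^sub>A V \<otimes>\<^sub>A \<dots> \<otimes>\<^sub>A V = V\<^sup>\<otimes>\<^sup>n\<close>, which is \<open>A\<close> for \<open>n = 0\<close>.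
\<close>

definition word_rels ::
  "('a, 'z) ring_scheme \<Rightarrow> ('a, 'v, 'y) bimodule_scheme \<Rightarrow> ('a \<times> 'v list \<Rightarrow>\<^sub>0 int) set" where
  "word_rels A V =
     {frag_of (a \<oplus>\<^bsub>A\<^esub> b, vs) - frag_of (a, vs) - frag_of (b, vs) | a b vs.
        a \<in> carrier A \<and> b \<in> carrier A \<and> vs \<in> lists (carrier V)} \<union>
     {frag_of (a, xs @ (v \<oplus>\<^bsub>V\<^esub> w) # ys) - frag_of (a, xs @ v # ys) - frag_of (a, xs @ w # ys)
        | a xs v w ys. a \<in> carrier A \<and> v \<in> carrier V \<and> w \<in> carrier V \<and>
        xs \<in> lists (carrier V) \<and> ys \<in> lists (carrier V)} \<union>
     {frag_of (a \<otimes>\<^bsub>A\<^esub> b, v # ys) - frag_of (a, (b \<odot>\<^bsub>V\<^esub> v) # ys) | a b v ys.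
        a \<in> carrier A \<and> b \<in> carrier A \<and> v \<in> carrier V \<and> ys \<in> lists (carrier V)} \<union>
     {frag_of (a, xs @ (v \<lhd>\<^bsub>V\<^esub> b) # w # ys) - frag_of (a, xs @ v # (b \<odot>\<^bsub>V\<^esub> w) # ys)
        | a b xs v w ys. a \<in> carrier A \<and> b \<in> carrier A \<and> v \<in> carrier V \<and> w \<in> carrier V \<and>
        xs \<in> lists (carrier V) \<and> ys \<in> lists (carrier V)}"

definition word ::
  "('a, 'z) ring_scheme \<Rightarrow> ('a, 'v, 'y) bimodule_scheme \<Rightarrow> 'a \<Rightarrow> 'v list
    \<Rightarrow> ('a \<times> 'v list \<Rightarrow>\<^sub>0 int) set" where
  "word A V a vs =
     pres_class (carrier A \<times> lists (carrier V)) (word_rels A V) (frag_of (a, vs))"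

definition tensor_module ::
  "('a, 'z) ring_scheme \<Rightarrow> ('a, 'v, 'y) bimodule_scheme
    \<Rightarrow> ('a, ('a \<times> 'v list \<Rightarrow>\<^sub>0 int) set) module" where
  "tensor_module A V =
    (let P = presented (carrier A \<times> lists (carrier V)) (word_rels A V) in
     ring.extend P (module.fields
       (\<lambda>b. induced P (\<lambda>(a, vs). word A V (b \<otimes>\<^bsub>A\<^esub> a) vs))))"

text \<open>\<open>v \<otimes> w\<close> for \<open>v \<in> V\<close> and \<open>w\<close> in the tensor algebra.\<close>

definition tensor_cons ::
  "('a, 'z) ring_scheme \<Rightarrow> ('a, 'v, 'y) bimodule_scheme \<Rightarrow> 'v
    \<Rightarrow> ('a \<times> 'v list \<Rightarrow>\<^sub>0 int) set \<Rightarrow> ('a \<times> 'v list \<Rightarrow>\<^sub>0 int) set" where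
  "tensor_cons A V v w =
     induced (tensor_module A V) (\<lambda>(a, vs). word A V \<one>\<^bsub>A\<^esub> ((v \<lhd>\<^bsub>V\<^esub> a) # vs)) w"


section \<open>Differential graded algebras\<close>

definition complex_ring :: "complex ring" where
  "complex_ring = \<lparr>carrier = UNIV, mult = (*), one = 1, zero = 0, add = (+)\<rparr>"

text \<open>All of \<open>\<Omega>A\<close> is one ring, with complex scalar multiplication \<open>\<odot>\<close>, wedge product \<open>\<otimes>\<close>,
  homogeneous parts \<open>grade \<Omega> k\<close> and differential \<open>der \<Omega>\<close>; the algebra \<open>A\<close> is
  \<open>grade \<Omega> 0\<close>.\<close>

record 'w dga = "(complex, 'w) module" +
  grade :: "nat \<Rightarrow> 'w set"
  der :: "'w \<Rightarrow> 'w"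

definition base_ring :: "('w, 'z) dga_scheme \<Rightarrow> 'w ring" where
  "base_ring \<Omega> = \<lparr>carrier = grade \<Omega> 0, mult = mult \<Omega>, one = one \<Omega>, zero = zero \<Omega>, add = add \<Omega>\<rparr>"

definition forms :: "('w, 'z) dga_scheme \<Rightarrow> nat \<Rightarrow> ('w, 'w) bimodule" where
  "forms \<Omega> k = \<lparr>carrier = grade \<Omega> k, mult = mult \<Omega>, one = one \<Omega>, zero = zero \<Omega>, add = add \<Omega>,
     smult = mult \<Omega>, rsmult = mult \<Omega>\<rparr>"

locale dg_algebra = ring \<Omega> for \<Omega> :: "'w dga" (structure) +
  assumes complex_module: "module complex_ring \<Omega>"
    and scale_mult_left: "\<And>c x y. \<lbrakk>x \<in> carrier \<Omega>; y \<in> carrier \<Omega>\<rbrakk> \<Longrightarrow> (c \<odot> x) \<otimes> y = c \<odot> (x \<otimes> y)"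
    and scale_mult_right: "\<And>c x y. \<lbrakk>x \<in> carrier \<Omega>; y \<in> carrier \<Omega>\<rbrakk> \<Longrightarrow> x \<otimes> (c \<odot> y) = c \<odot> (x \<otimes> y)"
    and grade_submodule: "\<And>k. submodule (grade \<Omega> k) complex_ring \<Omega>"
    and grade_direct_sum: "\<And>x. x \<in> carrier \<Omega> \<Longrightarrow>
      \<exists>!f. (\<forall>k. f k \<in> grade \<Omega> k) \<and> finite {k. f k \<noteq> \<zero>} \<and> x = (\<Oplus>k\<in>{k. f k \<noteq> \<zero>}. f k)"
    and one_grade: "\<one> \<in> grade \<Omega> 0"
    and mult_grade: "\<And>k l x y. \<lbrakk>x \<in> grade \<Omega> k; y \<in> grade \<Omega> l\<rbrakk> \<Longrightarrow> x \<otimes> y \<in> grade \<Omega> (k + l)"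
    and der_grade: "\<And>k x. x \<in> grade \<Omega> k \<Longrightarrow> der \<Omega> x \<in> grade \<Omega> (Suc k)"
    and der_add: "\<And>x y. \<lbrakk>x \<in> carrier \<Omega>; y \<in> carrier \<Omega>\<rbrakk> \<Longrightarrow> der \<Omega> (x \<oplus> y) = der \<Omega> x \<oplus> der \<Omega> y"
    and der_scale: "\<And>c x. x \<in> carrier \<Omega> \<Longrightarrow> der \<Omega> (c \<odot> x) = c \<odot> der \<Omega> x"
    and der_der: "\<And>x. x \<in> carrier \<Omega> \<Longrightarrow> der \<Omega> (der \<Omega> x) = \<zero>"
    and der_mult: "\<And>k x y. \<lbrakk>x \<in> grade \<Omega> k; y \<in> carrier \<Omega>\<rbrakk> \<Longrightarrow>
      der \<Omega> (x \<otimes> y) = der \<Omega> x \<otimes> y \<oplus> ((- 1) ^ k) \<odot> (x \<otimes> der \<Omega> y)"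
    and generated: "generate_ring \<Omega> (grade \<Omega> 0 \<union> grade \<Omega> 1) = carrier \<Omega>"
    and one_forms: "grade \<Omega> 1 =
      generate (add_monoid \<Omega>) {a \<otimes> der \<Omega> b | a b. a \<in> grade \<Omega> 0 \<and> b \<in> grade \<Omega> 0}"
begin

abbreviation A where "A \<equiv> base_ring \<Omega>"
abbreviation Omega1 where "Omega1 \<equiv> forms \<Omega> 1"
abbreviation Omega2 where "Omega2 \<equiv> forms \<Omega> 2"
abbreviation Vec where "Vec \<equiv> dual A Omega1"

definition left_covariant_derivative ::
  "('w, 'e, 'y) module_scheme \<Rightarrow> ('e \<Rightarrow> ('w \<times> 'e \<Rightarrow>\<^sub>0 int) set) \<Rightarrow> bool" where
  "left_covariant_derivative E nab \<longleftrightarrow>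
     nab \<in> carrier E \<rightarrow> carrier (tensor A Omega1 E) \<and>
     (\<forall>e\<in>carrier E. \<forall>f\<in>carrier E. nab (e \<oplus>\<^bsub>E\<^esub> f) = nab e \<oplus>\<^bsub>tensor A Omega1 E\<^esub> nab f) \<and>
     (\<forall>a\<in>carrier A. \<forall>e\<in>carrier E. nab (a \<odot>\<^bsub>E\<^esub> e) =
        pure_tensor A Omega1 E (der \<Omega> a) e \<oplus>\<^bsub>tensor A Omega1 E\<^esub> a \<odot>\<^bsub>tensor A Omega1 E\<^esub> nab e)"

text \<open>\<open>\<xi> \<and> X \<in> \<Omega>\<^sup>2 \<otimes>\<^sub>A E\<close> for a one-form \<open>\<xi>\<close> and \<open>X \<in> \<Omega>\<^sup>1 \<otimes>\<^sub>A E\<close>.\<close>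

definition wedge_tensor ::
  "('w, 'e, 'y) module_scheme \<Rightarrow> 'w \<Rightarrow> ('w \<times> 'e \<Rightarrow>\<^sub>0 int) set \<Rightarrow> ('w \<times> 'e \<Rightarrow>\<^sub>0 int) set" where
  "wedge_tensor E x X =
     induced (tensor A Omega2 E) (\<lambda>(y, e). pure_tensor A Omega2 E (x \<otimes> y) e) X"

text \<open>\<open>(d \<otimes> id - id \<and> \<nabla>) \<nabla>\<close>. Only the difference of the two terms, not each one by itself, is
  well defined on \<open>\<Omega>\<^sup>1 \<otimes>\<^sub>A E\<close>.\<close>

definition curvature ::
  "('w, 'e, 'y) module_scheme \<Rightarrow> ('e \<Rightarrow> ('w \<times> 'e \<Rightarrow>\<^sub>0 int) set) \<Rightarrow> 'e
    \<Rightarrow> ('w \<times> 'e \<Rightarrow>\<^sub>0 int) set" where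
  "curvature E nab e =
     induced (tensor A Omega2 E)
       (\<lambda>(x, f). pure_tensor A Omega2 E (der \<Omega> x) f
                   \<ominus>\<^bsub>tensor A Omega2 E\<^esub> wedge_tensor E x (nab f))
       (nab e)"

end


section \<open>The algebra of differential operators\<close>

text \<open>\<open>n\<close>, \<open>\<xi>\<close>, \<open>u\<close> give the dual basis of the right module \<open>\<Omega>\<^sup>1A\<close>, so that it is finitely
  generated projective. \<open>sq\<close> is the right bimodule covariant derivative on \<open>\<Omega>\<^sup>1A\<close> and
  \<open>sinv\<close> is its \<open>\<sigma>\<^sup>-\<^sup>1\<close>.\<close>

locale right_bimodule_connection = dg_algebra \<Omega> for \<Omega> :: "'w dga" (structure) +
  fixes n :: nat
    and \<xi> :: "nat \<Rightarrow> 'w"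
    and u :: "nat \<Rightarrow> 'w \<Rightarrow> 'w"
    and sq :: "'w \<Rightarrow> ('w \<times> 'w \<Rightarrow>\<^sub>0 int) set"
    and sinv :: "('w \<times> 'w \<Rightarrow>\<^sub>0 int) set \<Rightarrow> ('w \<times> 'w \<Rightarrow>\<^sub>0 int) set"
  assumes xi_form: "\<And>i. i < n \<Longrightarrow> \<xi> i \<in> carrier Omega1"
    and u_Vec: "\<And>i. i < n \<Longrightarrow> u i \<in> carrier Vec"
    and dual_basis: "\<And>x. x \<in> carrier Omega1 \<Longrightarrow> x = (\<Oplus>i\<in>{..<n}. \<xi> i \<otimes> u i x)"
    and sinv_closed: "sinv \<in> carrier (tensor A Omega1 Omega1) \<rightarrow> carrier (tensor A Omega1 Omega1)"
    and sinv_add: "\<And>X Y. \<lbrakk>X \<in> carrier (tensor A Omega1 Omega1); Y \<in> carrier (tensor A Omega1 Omega1)\<rbrakk>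
      \<Longrightarrow> sinv (X \<oplus>\<^bsub>tensor A Omega1 Omega1\<^esub> Y) = sinv X \<oplus>\<^bsub>tensor A Omega1 Omega1\<^esub> sinv Y"
    and sinv_left: "\<And>a X. \<lbrakk>a \<in> carrier A; X \<in> carrier (tensor A Omega1 Omega1)\<rbrakk>
      \<Longrightarrow> sinv (a \<odot>\<^bsub>tensor A Omega1 Omega1\<^esub> X) = a \<odot>\<^bsub>tensor A Omega1 Omega1\<^esub> sinv X"
    and sinv_right: "\<And>a X. \<lbrakk>a \<in> carrier A; X \<in> carrier (tensor A Omega1 Omega1)\<rbrakk>
      \<Longrightarrow> sinv (tensor_rsmult A Omega1 Omega1 X a) = tensor_rsmult A Omega1 Omega1 (sinv X) a"
    and sq_closed: "sq \<in> carrier Omega1 \<rightarrow> carrier (tensor A Omega1 Omega1)"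
    and sq_add: "\<And>x y. \<lbrakk>x \<in> carrier Omega1; y \<in> carrier Omega1\<rbrakk>
      \<Longrightarrow> sq (x \<oplus> y) = sq x \<oplus>\<^bsub>tensor A Omega1 Omega1\<^esub> sq y"
    and sq_right: "\<And>x a. \<lbrakk>x \<in> carrier Omega1; a \<in> carrier A\<rbrakk> \<Longrightarrow> sq (x \<otimes> a) =
      tensor_rsmult A Omega1 Omega1 (sq x) a
        \<oplus>\<^bsub>tensor A Omega1 Omega1\<^esub> pure_tensor A Omega1 Omega1 x (der \<Omega> a)"
    and sq_left: "\<And>x a. \<lbrakk>x \<in> carrier Omega1; a \<in> carrier A\<rbrakk> \<Longrightarrow> sq (a \<otimes> x) =
      a \<odot>\<^bsub>tensor A Omega1 Omega1\<^esub> sq x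
        \<oplus>\<^bsub>tensor A Omega1 Omega1\<^esub> sinv (pure_tensor A Omega1 Omega1 (der \<Omega> a) x)"
begin

text \<open>\<open>\<sigma>(v \<otimes> \<eta>) = (ev \<otimes> id \<otimes> id)(v \<otimes> \<sigma>\<^sup>-\<^sup>1(\<eta> \<otimes> \<xi>\<^sub>i) \<otimes> u\<^sub>i)\<close>, summed over \<open>i\<close>.\<close>

definition sigma :: "('w \<Rightarrow> 'w) \<Rightarrow> 'w \<Rightarrow> ('w \<times> ('w \<Rightarrow> 'w) \<Rightarrow>\<^sub>0 int) set" where
  "sigma v x = (\<Oplus>\<^bsub>tensor A Omega1 Vec\<^esub>i\<in>{..<n}.
     pure_tensor A Omega1 Vec
       (contract Omega1 v (sinv (pure_tensor A Omega1 Omega1 x (\<xi> i)))) (u i))"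

text \<open>The dual left covariant derivative on \<open>Vec A\<close>, as the unique solution of
  \<open>d(v(x)) = (id \<otimes> ev)(\<box>v \<otimes> x) + (ev \<otimes> id)(v \<otimes> \<box>x)\<close> for all \<open>x\<close>.\<close>

definition sq_Vec :: "('w \<Rightarrow> 'w) \<Rightarrow> ('w \<times> ('w \<Rightarrow> 'w) \<Rightarrow>\<^sub>0 int) set" where
  "sq_Vec v = (THE X. X \<in> carrier (tensor A Omega1 Vec) \<and>
     (\<forall>x\<in>carrier Omega1.
        der \<Omega> (v x) = induced Omega1 (\<lambda>(y, w). y \<otimes> w x) X \<oplus> contract Omega1 v (sq x)))"

definition TVec where "TVec = tensor_module A Vec"

abbreviation vec where "vec v \<equiv> word A Vec \<one> [v]"

text \<open>\<open>X \<otimes> w \<in> \<Omega>\<^sup>1 \<otimes>\<^sub>A T\<close> for \<open>X \<in> \<Omega>\<^sup>1 \<otimes>\<^sub>A Vec\<close> and \<open>w \<in> T\<close>, where \<open>T\<close> is the tensor algebra.\<close>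

definition tensor_append where
  "tensor_append X w = induced (tensor A Omega1 TVec)
     (\<lambda>(x, v). pure_tensor A Omega1 TVec x (tensor_cons A Vec v w)) X"

text \<open>\<open>(\<sigma> \<otimes> id)(v \<otimes> X)\<close> for \<open>X \<in> \<Omega>\<^sup>1 \<otimes>\<^sub>A T\<close>.\<close>

definition sigma_id where
  "sigma_id v X = induced (tensor A Omega1 TVec) (\<lambda>(x, w). tensor_append (sigma v x) w) X"

text \<open>\<open>sq_T\<close> is the sum over all \<open>n\<close> of the maps \<open>\<box>\<^sup>\<langle>\<^sup>n\<^sup>\<rangle>\<close>, and \<open>sq_word a vs\<close> is its value on
  the element \<open>word A Vec a vs\<close>. In degree 0 the codomain \<open>\<Omega>\<^sup>1\<close> is \<open>\<Omega>\<^sup>1 \<otimes>\<^sub>A A\<close>.\<close>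

primrec sq_word ::
  "('w \<Rightarrow> 'w) list \<Rightarrow> 'w \<Rightarrow> ('w \<times> ('w \<times> ('w \<Rightarrow> 'w) list \<Rightarrow>\<^sub>0 int) set \<Rightarrow>\<^sub>0 int) set" where
  "sq_word [] a = pure_tensor A Omega1 TVec (der \<Omega> a) (word A Vec \<one> [])"
| "sq_word (v # vs) a =
     tensor_append (sq_Vec (a \<odot>\<^bsub>Vec\<^esub> v)) (word A Vec \<one> vs)
       \<oplus>\<^bsub>tensor A Omega1 TVec\<^esub> sigma_id (a \<odot>\<^bsub>Vec\<^esub> v) (sq_word vs \<one>)"

definition sq_T where
  "sq_T w = induced (tensor A Omega1 TVec) (\<lambda>(a, vs). sq_word vs a) w"

text \<open>\<open>v \<bullet> w = v \<otimes> w + (ev \<otimes> id)(v \<otimes> \<box>w)\<close> for \<open>v \<in> Vec\<close>.\<close>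

definition bullet_Vec where
  "bullet_Vec v w = tensor_cons A Vec v w \<oplus>\<^bsub>TVec\<^esub> contract TVec v (sq_T w)"

text \<open>\<open>bullet_deg k x w\<close> is \<open>x\<^sub>k \<bullet> w\<close>, where \<open>x\<^sub>k\<close> is the component of \<open>x\<close> in \<open>Vec\<^sup>\<otimes>\<^sup>k\<close>. The
  recursion is \<open>(v \<otimes> y) \<bullet> w = v \<bullet> (y \<bullet> w) - ((ev \<otimes> id)(v \<otimes> \<box>y)) \<bullet> w\<close>.\<close>

primrec bullet_deg where
  "bullet_deg 0 x w = induced TVec
     (\<lambda>(a, vs). if vs = [] then a \<odot>\<^bsub>TVec\<^esub> w else \<zero>\<^bsub>TVec\<^esub>) x"
| "bullet_deg (Suc k) x w = induced TVec
     (\<lambda>(a, vs). if length vs = Suc k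
        then (let v = a \<odot>\<^bsub>Vec\<^esub> hd vs; y = word A Vec \<one> (tl vs) in
              bullet_Vec v (bullet_deg k y w)
                \<ominus>\<^bsub>TVec\<^esub> bullet_deg k (contract TVec v (sq_T y)) w)
        else \<zero>\<^bsub>TVec\<^esub>) x"

definition bullet where
  "bullet x w = induced TVec (\<lambda>(a, vs). bullet_deg (length vs) (word A Vec a vs) w) x"

text \<open>The algebra \<open>T Vec A\<^sub>\<bullet>\<close>, with its left \<open>A\<close>-action; the right \<open>A\<close>-action is
  \<open>x \<bullet> word A Vec a []\<close>.\<close>

definition TVec_bullet where
  "TVec_bullet = TVec\<lparr>mult := bullet, one := word A Vec \<one> []\<rparr>"

definition curv_R where
  "curv_R =
     (\<Oplus>\<^bsub>tensor A Omega2 TVec_bullet\<^esub>i\<in>{..<n}.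
        pure_tensor A Omega2 TVec_bullet (der \<Omega> (\<xi> i)) (vec (u i)))
     \<ominus>\<^bsub>tensor A Omega2 TVec_bullet\<^esub>
     (\<Oplus>\<^bsub>tensor A Omega2 TVec_bullet\<^esub>i\<in>{..<n}. \<Oplus>\<^bsub>tensor A Omega2 TVec_bullet\<^esub>j\<in>{..<n}.
        pure_tensor A Omega2 TVec_bullet (\<xi> i \<otimes> \<xi> j) (bullet (vec (u j)) (vec (u i))))"

definition R_hat where
  "R_hat \<alpha> = contract TVec_bullet \<alpha> curv_R"

definition W where
  "W = Idl\<^bsub>TVec_bullet\<^esub> (R_hat ` carrier (dual A Omega2))"

definition cls where
  "cls v = W +>\<^bsub>TVec_bullet\<^esub> v"

text \<open>\<open>\<D>A\<close> is the quotient ring together with the left action \<open>a.[v] = [a.v]\<close>.\<close>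

definition DA where
  "DA = ring.extend (TVec_bullet Quot W)
     (module.fields (\<lambda>a X. the_elem ((\<lambda>v. cls (a \<odot>\<^bsub>TVec_bullet\<^esub> v)) ` X)))"

definition nabla_DA where
  "nabla_DA X = the_elem
     ((\<lambda>v. \<Oplus>\<^bsub>tensor A Omega1 DA\<^esub>i\<in>{..<n}.
         pure_tensor A Omega1 DA (\<xi> i) (cls (bullet (vec (u i)) v))) ` X)"

end

end

theory Submission
  imports Defs
begin

text \<open>
  The associativity of \<open>\<bullet>\<close> only needs that \<open>v \<bullet> w = v \<otimes> w + (ev \<otimes> id)(v \<otimes> \<box>w)\<close> satisfies
  \<open>(a.v) \<bullet> w = a.(v \<bullet> w)\<close> and \<open>v \<bullet> (a.w) = (v.a) \<bullet> w + v(da).w\<close>, i.e. that \<open>\<box>\<close> is a left covariant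
  derivative on the tensor algebra: these make the recursion for \<open>x \<bullet> w\<close> compatible with the
  relations of the tensor algebra, the recursion says that \<open>(v \<bullet> y) \<bullet> w = v \<bullet> (y \<bullet> w)\<close>, and
  induction on the degree of \<open>x\<close> gives \<open>(x \<bullet> y) \<bullet> w = x \<bullet> (y \<bullet> w)\<close>.
  The Leibniz rule for \<open>\<nabla>\<close> follows from the same identity and \<open>\<xi>\<^sub>i \<otimes> u\<^sub>i.a = a.\<xi>\<^sub>i \<otimes> u\<^sub>i\<close>.
  The curvature at \<open>[v]\<close> is the image of \<open>\<R>\<close> under \<open>x \<otimes> w \<mapsto> x \<otimes> [w \<bullet> v]\<close>. Contracting it with
  \<open>\<alpha> \<in> (\<Omega>\<^sup>2A)'\<close> gives the class of \<open>\<R>\<close> contracted with \<open>\<alpha>\<close>, multiplied by \<open>v\<close>, which lies in \<open>W\<close>. Since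
  \<open>\<Omega>\<^sup>2A\<close> is finitely generated projective, an element all of whose contractions vanish is zero.
\<close>

section \<open>Additive maps and presented abelian groups\<close>

text \<open>The main obstacle is well-definedness: an \<open>induced\<close> map has a meaning only
  after its formula on generators has been checked against the relations. Two mechanisms settle
  this. The dual basis turns elements of \<open>\<Omega>\<^sup>1 \<otimes>\<^sub>A Vec\<close> into
  right linear endomorphisms of the one-forms. This solves the equation behind \<open>THE\<close> in
  \<open>sq_Vec\<close>, and it reduces the Leibniz rules of \<open>sq_Vec\<close> and the linearity
  of \<open>sigma\<close> to identities between one-forms. Moving a coefficient a across a tensor
  sign leaves a derivative da, and each formula is arranged so that da occurs twice. For
  \<open>sq_word\<close> it is produced by the right Leibniz rule of the left letter and by the left
  Leibniz rule of the remaining word; for the product it appears in both terms of the recursion and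
  cancels; for the curvature it comes once from d and once from the covariant derivative. Checking
  the product in degree k + 1 uses left linearity of the product in degree k, so both properties are
  proved in one induction. The subtracted term of the recursion stays in degree k because the
  covariant derivative along a vector field preserves the degree.\<close>

abbreviation ahom where "ahom \<equiv> abelian_group_hom"

lemma ahomI:
  assumes "abelian_group G" "abelian_group H"
    and "\<And>x. x \<in> carrier G \<Longrightarrow> f x \<in> carrier H"
    and "\<And>x y. \<lbrakk>x \<in> carrier G; y \<in> carrier G\<rbrakk> \<Longrightarrow> f (x \<oplus>\<^bsub>G\<^esub> y) = f x \<oplus>\<^bsub>H\<^esub> f y"
  shows "ahom G H f"
proof -
  interpret G: abelian_group G by fact
  interpret H: abelian_group H by fact
  show ?thesis
    by (rule abelian_group_homI) (use assms in \<open>auto simp: hom_def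
      intro!: group_hom.intro group_hom_axioms.intro G.a_group H.a_group\<close>)
qed

lemma ahom_groups:
  assumes "ahom G H f" shows "abelian_group G" "abelian_group H"
  using assms by (auto simp: abelian_group_hom_def)

lemmas ahom_closed = abelian_group_hom.hom_closed
lemmas ahom_add = abelian_group_hom.hom_add
lemmas ahom_zero = abelian_group_hom.hom_zero

lemma ahom_minus:
  assumes "ahom G H f" "x \<in> carrier G" "y \<in> carrier G"
  shows "f (x \<ominus>\<^bsub>G\<^esub> y) = f x \<ominus>\<^bsub>H\<^esub> f y"
proof -
  interpret abelian_group_hom G H f by fact
  show ?thesis using assms by (simp add: a_minus_def)
qed

lemma ahom_finsum:
  assumes "ahom G H f" "g \<in> I \<rightarrow> carrier G"
  shows "f (finsum G g I) = finsum H (\<lambda>i. f (g i)) I"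
proof -
  interpret abelian_group_hom G H f by fact
  show ?thesis
    using assms(2)
  proof (induction I rule: infinite_finite_induct)
    case (insert i I)
    then show ?case
      by (subst G.finsum_insert, simp_all) (subst H.finsum_insert, auto simp: Pi_iff)
  qed auto
qed

lemma ahom_comp:
  assumes "ahom G H f" "ahom H K g"
  shows "ahom G K (\<lambda>x. g (f x))"
proof -
  interpret f: abelian_group_hom G H f by fact
  interpret g: abelian_group_hom H K g by fact
  show ?thesis
    by (rule ahomI) (use ahom_groups assms in auto)
qed

lemma ahom_plus:
  assumes "ahom G H f" "ahom G H g"
  shows "ahom G H (\<lambda>x. f x \<oplus>\<^bsub>H\<^esub> g x)"
proof -
  interpret f: abelian_group_hom G H f by fact
  interpret g: abelian_group_hom G H g by fact
  show ?thesis
    by (rule ahomI)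
      (use ahom_groups assms in \<open>auto simp: f.H.a_ac\<close>)
qed

lemma ahom_uminus:
  assumes "ahom G H f"
  shows "ahom G H (\<lambda>x. \<ominus>\<^bsub>H\<^esub> f x)"
proof -
  interpret f: abelian_group_hom G H f by fact
  show ?thesis
    by (rule ahomI)
      (auto intro: f.G.abelian_group_axioms f.H.abelian_group_axioms simp: f.H.minus_add)
qed

lemma ahom_diff:
  assumes "ahom G H f" "ahom G H g"
  shows "ahom G H (\<lambda>x. f x \<ominus>\<^bsub>H\<^esub> g x)"
  unfolding a_minus_def by (intro ahom_plus ahom_uminus assms)

lemma ahom_const_zero:
  assumes "abelian_group G" "abelian_group H"
  shows "ahom G H (\<lambda>x. \<zero>\<^bsub>H\<^esub>)"
proof -
  interpret H: abelian_group H by fact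
  show ?thesis by (rule ahomI[OF assms]) auto
qed

lemma ahom_sum:
  assumes "abelian_group G" "abelian_group H" "\<And>i. i \<in> I \<Longrightarrow> ahom G H (f i)"
  shows "ahom G H (\<lambda>x. finsum H (\<lambda>i. f i x) I)"
proof -
  interpret H: abelian_group H by fact
  interpret G: abelian_group G by fact
  show ?thesis
  proof (rule ahomI[OF assms(1,2)])
    fix x y assume xy: "x \<in> carrier G" "y \<in> carrier G"
    have "finsum H (\<lambda>i. f i (x \<oplus>\<^bsub>G\<^esub> y)) I = finsum H (\<lambda>i. f i x \<oplus>\<^bsub>H\<^esub> f i y) I"
      using xy assms(3) by (intro H.finsum_cong') (auto simp: ahom_add intro: ahom_closed)
    also have "\<dots> = finsum H (\<lambda>i. f i x) I \<oplus>\<^bsub>H\<^esub> finsum H (\<lambda>i. f i y) I"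
      using xy assms(3) by (intro H.finsum_addf) (auto intro: ahom_closed)
    finally show "finsum H (\<lambda>i. f i (x \<oplus>\<^bsub>G\<^esub> y)) I = finsum H (\<lambda>i. f i x) I \<oplus>\<^bsub>H\<^esub> finsum H (\<lambda>i. f i y) I" .
  qed (use assms(3) in \<open>auto intro!: H.finsum_closed intro: ahom_closed\<close>)
qed

lemma ahom_cong:
  assumes "ahom G H f" "\<And>x. x \<in> carrier G \<Longrightarrow> g x = f x"
  shows "ahom G H g"
proof -
  interpret f: abelian_group_hom G H f by fact
  show ?thesis
    by (rule ahomI)
      (auto intro: f.G.abelian_group_axioms f.H.abelian_group_axioms simp: assms(2))
qed

section \<open>The additive extension of a map to the free abelian group\<close>

definition frag_extend ::
  "('b, 'z) ring_scheme \<Rightarrow> ('g \<Rightarrow> 'b) \<Rightarrow> ('g \<Rightarrow>\<^sub>0 int) \<Rightarrow> 'b" where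
  "frag_extend G f c = (\<Oplus>\<^bsub>G\<^esub>s\<in>Poly_Mapping.keys c. [Poly_Mapping.lookup c s] \<cdot>\<^bsub>G\<^esub> f s)"

lemma induced_eq: "induced G f X = the_elem (frag_extend G f ` X)"
  unfolding induced_def frag_extend_def by simp

context abelian_group begin

text \<open>Keys may cancel in a sum. Summing over a common larger set lets the extension at
  \<open>a + b\<close> be compared termwise with those at \<open>a\<close> and
  \<open>b\<close>.\<close>

lemma frag_extend_superset:
  assumes "f \<in> S \<rightarrow> carrier G" "finite K" "Poly_Mapping.keys c \<subseteq> K" "K \<subseteq> S"
  shows "frag_extend G f c = (\<Oplus>s\<in>K. [Poly_Mapping.lookup c s] \<cdot> f s)"
  unfolding frag_extend_def
proof (rule add.finprod_mono_neutral_cong_left)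
  show "[Poly_Mapping.lookup c i] \<cdot> f i = \<zero>" if "i \<in> K - Poly_Mapping.keys c" for i
    using that by (auto simp: in_keys_iff add_pow_def)
qed (use assms in \<open>auto intro!: add.int_pow_closed\<close>)

lemma frag_extend_hom:
  assumes f: "f \<in> S \<rightarrow> carrier G"
  shows "group_hom (free_Abelian_group S) (add_monoid G) (frag_extend G f)"
proof (intro group_hom.intro group_hom_axioms.intro homI)
  fix a assume "a \<in> carrier (free_Abelian_group S)"
  then show "frag_extend G f a \<in> carrier (add_monoid G)"
    unfolding frag_extend_def using f by (auto intro!: finsum_closed add.int_pow_closed)
next
  fix a b assume ab: "a \<in> carrier (free_Abelian_group S)" "b \<in> carrier (free_Abelian_group S)"
  let ?K = "Poly_Mapping.keys a \<union> Poly_Mapping.keys b"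
  have K: "finite ?K" "?K \<subseteq> S" using ab by auto
  have "frag_extend G f (a + b) = (\<Oplus>s\<in>?K. [Poly_Mapping.lookup (a + b) s] \<cdot> f s)"
    using f K keys_add[of a b] by (intro frag_extend_superset) auto
  also have "\<dots> = (\<Oplus>s\<in>?K. [Poly_Mapping.lookup a s] \<cdot> f s \<oplus> [Poly_Mapping.lookup b s] \<cdot> f s)"
    using f ab by (intro finsum_cong')
      (auto simp: lookup_add Pi_iff intro!: add.int_pow_closed add.int_pow_mult)
  also have "\<dots> = (\<Oplus>s\<in>?K. [Poly_Mapping.lookup a s] \<cdot> f s) \<oplus> (\<Oplus>s\<in>?K. [Poly_Mapping.lookup b s] \<cdot> f s)"
    using f K by (intro finsum_addf) (auto intro!: add.int_pow_closed)
  also have "\<dots> = frag_extend G f a \<oplus> frag_extend G f b"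
    using f K by (simp add: frag_extend_superset[where K = ?K])
  finally show "frag_extend G f (a \<otimes>\<^bsub>free_Abelian_group S\<^esub> b) =
      frag_extend G f a \<otimes>\<^bsub>add_monoid G\<^esub> frag_extend G f b"
    by simp
qed (use a_group in auto)

lemma frag_extend_frag_of:
  "f s \<in> carrier G \<Longrightarrow> frag_extend G f (frag_of s) = f s"
  unfolding frag_extend_def by (simp add: add.int_pow_1)

end

text \<open>Every relation of the tensor products and of the tensor algebra has one of these two
  shapes: a balancing relation with two terms or an additivity relation with three.\<close>

lemma frag_diff_closed:
  assumes "s \<in> S" "t \<in> S"
  shows "frag_of s - frag_of t \<in> carrier (free_Abelian_group S)"
    and "q \<in> S \<Longrightarrow> frag_of s - frag_of t - frag_of q \<in> carrier (free_Abelian_group S)"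
  using assms keys_diff[of "frag_of s - frag_of t" "frag_of q"] keys_diff[of "frag_of s" "frag_of t"] by auto

section \<open>Groups given by generators and relations, and their universal property\<close>

locale presentation =
  fixes S :: "'g set" and R :: "('g \<Rightarrow>\<^sub>0 int) set"
  assumes rels: "R \<subseteq> carrier (free_Abelian_group S)"
begin

abbreviation "F \<equiv> free_Abelian_group S"
abbreviation "K \<equiv> generate F R"
abbreviation "P \<equiv> presented S R"
abbreviation "cl \<equiv> pres_class S R"

sublocale F: comm_group F
  by (rule abelian_free_Abelian_group)

lemma K_subgroup: "subgroup K F"
  using rels by (rule F.generate_is_subgroup)

lemma K_normal: "K \<lhd> F"
  using K_subgroup by (simp add: F.normal_iff_subgroup)

lemma carrier_P: "carrier P = cl ` carrier F"
  by (auto simp: presented_def Let_def FactGroup_def RCOSETS_def pres_class_def)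

lemma abelian_group_P: "abelian_group P"
proof (rule comm_group_abelian_groupI)
  have "comm_group (F Mod K)" using K_subgroup by (rule F.abelian_FactGroup)
  moreover have "add_monoid P = F Mod K" by (simp add: presented_def Let_def)
  ultimately show "comm_group (add_monoid P)" by simp
qed

lemma cl_add: "\<lbrakk>c \<in> carrier F; c' \<in> carrier F\<rbrakk> \<Longrightarrow> cl (c + c') = cl c \<oplus>\<^bsub>P\<^esub> cl c'"
  using normal.rcos_sum[OF K_normal, of c c']
  by (simp add: presented_def Let_def FactGroup_def pres_class_def)

lemma cl_hom: "group_hom F (add_monoid P) cl"
  by (intro group_hom.intro group_hom_axioms.intro homI F.group_axioms
      abelian_group.a_group abelian_group_P) (simp_all del: carrier_free_Abelian_group_iff add: cl_add carrier_P)

lemma cl_diff: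
  assumes "c \<in> carrier F" "c' \<in> carrier F"
  shows "cl (c - c') = cl c \<ominus>\<^bsub>P\<^esub> cl c'"
proof -
  have "cl (c + (- c')) = cl c \<oplus>\<^bsub>P\<^esub> cl (- c')" using assms by (intro cl_add) auto
  also have "cl (- c') = \<ominus>\<^bsub>P\<^esub> cl c'"
    using group_hom.hom_inv[OF cl_hom, of c'] assms by (simp add: a_inv_def)
  finally show ?thesis by (simp add: a_minus_def)
qed

lemma cl_rel:
  assumes "c \<in> R" shows "cl c = \<zero>\<^bsub>P\<^esub>"
proof -
  have "c \<in> K" using assms by (simp add: generate.incl)
  then show ?thesis
    using F.coset_join2[of c K] K_subgroup rels assms
    by (auto simp: presented_def Let_def FactGroup_def pres_class_def)
qed

lemma P_induct [consumes 1, case_names zero gen diff]: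
  assumes x: "x \<in> carrier P" and zero: "Q \<zero>\<^bsub>P\<^esub>"
    and gen: "\<And>s. s \<in> S \<Longrightarrow> Q (cl (frag_of s))"
    and diff: "\<And>x y. \<lbrakk>x \<in> carrier P; y \<in> carrier P; Q x; Q y\<rbrakk> \<Longrightarrow> Q (x \<ominus>\<^bsub>P\<^esub> y)"
  shows "Q x"
proof -
  obtain c where c: "Poly_Mapping.keys c \<subseteq> S" "x = cl c"
    using x by (auto simp: carrier_P)
  have "Q (cl c)" using c(1)
  proof (rule free_Abelian_group_induct[where P = "\<lambda>c. Q (cl c)"])
    show "Q (cl 0)" using zero group_hom.hom_one[OF cl_hom] by simp
  next
    fix a b
    assume "Poly_Mapping.keys a \<subseteq> S" "Poly_Mapping.keys b \<subseteq> S" "Q (cl a)" "Q (cl b)"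
    then show "Q (cl (a - b))" using diff[of "cl a" "cl b"] by (simp add: cl_diff carrier_P)
  qed (rule gen)
  with c show ?thesis by simp
qed

text \<open>Every element is a sum of generators as soon as the negative of a generator is one.\<close>

lemma P_induct_add [consumes 1, case_names nonempty neg gen add]:
  assumes x: "x \<in> carrier P" and S: "S \<noteq> {}"
    and neg: "\<And>s. s \<in> S \<Longrightarrow> \<exists>t\<in>S. cl (frag_of t) \<oplus>\<^bsub>P\<^esub> cl (frag_of s) = \<zero>\<^bsub>P\<^esub>"
    and gen: "\<And>s. s \<in> S \<Longrightarrow> Q (cl (frag_of s))"
    and add: "\<And>x y. \<lbrakk>x \<in> carrier P; y \<in> carrier P; Q x; Q y\<rbrakk> \<Longrightarrow> Q (x \<oplus>\<^bsub>P\<^esub> y)"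
  shows "Q x"
proof -
  interpret P: abelian_group P by (rule abelian_group_P)
  have cl: "cl (frag_of s) \<in> carrier P" if "s \<in> S" for s
    using that by (simp add: carrier_P)
  have minus: "Q (\<ominus>\<^bsub>P\<^esub> cl (frag_of s))" if "s \<in> S" for s
    using neg[OF that] cl that gen P.minus_equality by metis
  obtain s where s: "s \<in> S" using S by auto
  have zero: "Q \<zero>\<^bsub>P\<^esub>" using neg[OF s] add cl gen s by metis
  \<comment> \<open>The negative is carried along because \<open>P_induct\<close> forms differences,
    and x - y is reached by addition only from the negative of y.\<close>
  have "Q x \<and> Q (\<ominus>\<^bsub>P\<^esub> x)" using x
  proof (induction rule: P_induct)
    case zero
    have "\<ominus>\<^bsub>P\<^esub> \<zero>\<^bsub>P\<^esub> = \<zero>\<^bsub>P\<^esub>" by (rule P.minus_equality) simp_all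
    then show ?case using \<open>Q \<zero>\<^bsub>P\<^esub>\<close> by metis
  next
    case (gen s)
    then show ?case using minus \<open>\<And>s. s \<in> S \<Longrightarrow> Q (cl (frag_of s))\<close> by blast
  next
    case (diff x y)
    have "\<ominus>\<^bsub>P\<^esub> (x \<ominus>\<^bsub>P\<^esub> y) = \<ominus>\<^bsub>P\<^esub> x \<oplus>\<^bsub>P\<^esub> y"
      using diff by (simp add: a_minus_def P.minus_add)
    then show ?case
      using diff add[of x "\<ominus>\<^bsub>P\<^esub> y"] add[of "\<ominus>\<^bsub>P\<^esub> x" y] by (simp add: a_minus_def)
  qed
  then show ?thesis ..
qed

text \<open>The universal property. The extension of \<open>f\<close> vanishes on the relators,
  hence on the subgroup they generate, so it is constant on each coset and \<open>the_elem\<close>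
  returns that constant.\<close>

lemma induced_P:
  fixes G (structure)
  assumes G: "abelian_group G" and f: "f \<in> S \<rightarrow> carrier G"
    and f_rels: "\<And>r. r \<in> R \<Longrightarrow> frag_extend G f r = \<zero>"
  shows "ahom P G (induced G f)"
    and "\<And>s. s \<in> S \<Longrightarrow> induced G f (cl (frag_of s)) = f s"
proof -
  interpret abelian_group G by fact
  interpret e: group_hom F "add_monoid G" "frag_extend G f"
    using f by (rule frag_extend_hom)
  have "K \<subseteq> kernel F (add_monoid G) (frag_extend G f)"
    by (rule F.generate_subgroup_incl[OF _ e.subgroup_kernel]) (use f_rels rels in \<open>auto simp del: carrier_free_Abelian_group_iff simp: kernel_def\<close>)
  then have K0: "k \<in> carrier F" "frag_extend G f k = \<zero>" if "k \<in> K" for k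
    using that by (auto simp: kernel_def)
  have ind: "induced G f (cl c) = frag_extend G f c" if c: "c \<in> carrier F" for c
  proof -
    have "frag_extend G f ` cl c = {frag_extend G f c}"
    proof safe
      fix d assume "d \<in> cl c"
      then obtain k where "k \<in> K" "d = k + c" by (auto simp: pres_class_def r_coset_def)
      then show "frag_extend G f d = frag_extend G f c"
        using e.hom_mult[of k c] c K0 e.hom_closed[of c] by simp
    next
      have "c \<in> cl c" using F.rcos_self[OF c K_subgroup] by (simp add: pres_class_def)
      then show "frag_extend G f c \<in> frag_extend G f ` cl c" by simp
    qed
    then show ?thesis by (simp add: induced_eq)
  qed
  show "ahom P G (induced G f)"
  proof (rule ahomI[OF abelian_group_P G])
    show "induced G f x \<in> carrier G" if "x \<in> carrier P" for x
      using that ind e.hom_closed by (auto simp del: carrier_free_Abelian_group_iff simp: carrier_P)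
    fix x y assume "x \<in> carrier P" "y \<in> carrier P"
    then obtain c d where "c \<in> carrier F" "d \<in> carrier F" "x = cl c" "y = cl d"
      by (auto simp: carrier_P)
    then show "induced G f (x \<oplus>\<^bsub>P\<^esub> y) = induced G f x \<oplus> induced G f y"
      using e.hom_mult[of c d] F.m_closed[of c d] by (simp add: ind flip: cl_add)
  qed
  show "induced G f (cl (frag_of s)) = f s" if "s \<in> S" for s
    using that f by (simp add: ind frag_extend_frag_of Pi_iff)
qed

end

text \<open>The records \<open>tensor\<close>, \<open>tensor_module\<close>,
  \<open>TVec_bullet\<close> and \<open>DA\<close> add or replace fields of an underlying group
  while its carrier, sum and zero stay the same. This carries the group structure over.\<close>

lemma abelian_group_transfer:
  assumes "abelian_group G" "carrier G' = carrier G" "add G' = add G" "zero G' = zero G"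
  shows "abelian_group G'"
proof -
  interpret G: abelian_group G by fact
  show ?thesis
  proof (rule abelian_groupI)
    show "\<exists>y\<in>carrier G'. y \<oplus>\<^bsub>G'\<^esub> x = \<zero>\<^bsub>G'\<^esub>" if "x \<in> carrier G'" for x
      using that assms G.l_neg by (auto intro!: bexI[of _ "\<ominus>\<^bsub>G\<^esub> x"])
  qed (simp_all add: assms G.a_ac)
qed

lemma ahom_transfer:
  assumes "ahom G H f" "carrier G' = carrier G" "add G' = add G" "zero G' = zero G"
    "carrier H' = carrier H" "add H' = add H" "zero H' = zero H"
  shows "ahom G' H' f"
proof -
  interpret abelian_group_hom G H f by fact
  show ?thesis
    by (rule ahomI)
      (use assms abelian_group_transfer[OF G.abelian_group_axioms, of G']
        abelian_group_transfer[OF H.abelian_group_axioms, of H'] in auto)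
qed

context abelian_group begin

lemma diff_zero_iff:
  assumes "x \<in> carrier G" "y \<in> carrier G" shows "x \<ominus> y = \<zero> \<longleftrightarrow> x = y"
  using assms minus_equality[of x "\<ominus> y"] r_neg by (auto simp: a_minus_def)

lemma frag_extend_diff:
  assumes "f \<in> S \<rightarrow> carrier G" "a \<in> carrier (free_Abelian_group S)" "b \<in> carrier (free_Abelian_group S)"
  shows "frag_extend G f (a - b) = frag_extend G f a \<ominus> frag_extend G f b"
proof -
  interpret e: group_hom "free_Abelian_group S" "add_monoid G" "frag_extend G f"
    using assms(1) by (rule frag_extend_hom)
  show ?thesis
    using e.hom_mult[of a "- b"] e.hom_inv[of b] assms(2,3) by (simp add: a_minus_def a_inv_def)
qed

lemma frag_extend_rel2:
  assumes f: "f \<in> S \<rightarrow> carrier G" and "s \<in> S" "t \<in> S" "f s = f t"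
  shows "frag_extend G f (frag_of s - frag_of t) = \<zero>"
  using assms(2-4) funcset_mem[OF f, of t]
  by (simp add: frag_extend_diff[OF f] frag_extend_frag_of diff_zero_iff)

lemma frag_extend_rel3:
  assumes f: "f \<in> S \<rightarrow> carrier G" and "s \<in> S" "t \<in> S" "r \<in> S" "f s = f t \<oplus> f r"
  shows "frag_extend G f (frag_of s - frag_of t - frag_of r) = \<zero>"
proof -
  have "f t \<in> carrier G" "f r \<in> carrier G" using assms by auto
  moreover from this have "f t \<oplus> f r \<ominus> f t \<ominus> f r = \<zero>"
    by (simp add: a_minus_def a_comm[of "f t"] a_assoc r_neg)
  ultimately show ?thesis
    using assms(2-5) frag_diff_closed(1)[of s S t]
    by (simp add: frag_extend_diff[OF f] frag_extend_frag_of del: carrier_free_Abelian_group_iff)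
qed

lemma eq_plusI:
  assumes "x \<ominus> y \<ominus> z = \<zero>" "x \<in> carrier G" "y \<in> carrier G" "z \<in> carrier G"
  shows "x = y \<oplus> z"
proof -
  have "x \<ominus> (y \<oplus> z) = x \<ominus> y \<ominus> z"
    using assms(2-4) by (simp only: a_minus_def minus_add a_assoc a_inv_closed)
  then have "x \<ominus> (y \<oplus> z) = \<zero>" using assms(1) by (rule trans)
  with assms(2-4) diff_zero_iff show ?thesis by blast
qed

end

context presentation begin

lemma cl_rel2:
  assumes "frag_of s - frag_of t \<in> R" "s \<in> S" "t \<in> S"
  shows "cl (frag_of s) = cl (frag_of t)"
proof -
  interpret P: abelian_group P by (rule abelian_group_P)
  have "cl (frag_of s) \<ominus>\<^bsub>P\<^esub> cl (frag_of t) = \<zero>\<^bsub>P\<^esub>"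
    using cl_rel[OF assms(1)] assms by (simp add: cl_diff)
  then show ?thesis using assms P.diff_zero_iff by (simp add: carrier_P)
qed

lemma cl_rel3:
  assumes "frag_of s - frag_of t - frag_of r \<in> R" "s \<in> S" "t \<in> S" "r \<in> S"
  shows "cl (frag_of s) = cl (frag_of t) \<oplus>\<^bsub>P\<^esub> cl (frag_of r)"
proof -
  interpret P: abelian_group P by (rule abelian_group_P)
  have "cl (frag_of s) \<ominus>\<^bsub>P\<^esub> cl (frag_of t) \<ominus>\<^bsub>P\<^esub> cl (frag_of r) = \<zero>\<^bsub>P\<^esub>"
    using cl_rel[OF assms(1)] assms F.m_closed[of "frag_of s" "- frag_of t"] by (simp add: cl_diff)
  then show ?thesis using assms by (intro P.eq_plusI) (auto simp: carrier_P)
qed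

end

section \<open>Modules and tensor products over a noncommutative ring\<close>

locale left_module =
  fixes A :: "('a, 'z) ring_scheme" (structure) and M :: "('a, 'm, 'y) module_scheme"
  assumes ring_A: "ring A" and abelian_group: "abelian_group M"
    and smult_closed: "\<And>a x. \<lbrakk>a \<in> carrier A; x \<in> carrier M\<rbrakk> \<Longrightarrow> a \<odot>\<^bsub>M\<^esub> x \<in> carrier M"
    and smult_l_distr: "\<And>a b x. \<lbrakk>a \<in> carrier A; b \<in> carrier A; x \<in> carrier M\<rbrakk> \<Longrightarrow>
      (a \<oplus> b) \<odot>\<^bsub>M\<^esub> x = a \<odot>\<^bsub>M\<^esub> x \<oplus>\<^bsub>M\<^esub> b \<odot>\<^bsub>M\<^esub> x"
    and smult_r_distr: "\<And>a x y. \<lbrakk>a \<in> carrier A; x \<in> carrier M; y \<in> carrier M\<rbrakk> \<Longrightarrow>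
      a \<odot>\<^bsub>M\<^esub> (x \<oplus>\<^bsub>M\<^esub> y) = a \<odot>\<^bsub>M\<^esub> x \<oplus>\<^bsub>M\<^esub> a \<odot>\<^bsub>M\<^esub> y"
    and smult_assoc: "\<And>a b x. \<lbrakk>a \<in> carrier A; b \<in> carrier A; x \<in> carrier M\<rbrakk> \<Longrightarrow>
      (a \<otimes> b) \<odot>\<^bsub>M\<^esub> x = a \<odot>\<^bsub>M\<^esub> (b \<odot>\<^bsub>M\<^esub> x)"
    and smult_one: "\<And>x. x \<in> carrier M \<Longrightarrow> \<one> \<odot>\<^bsub>M\<^esub> x = x"
begin

sublocale A: ring A by (rule ring_A)
sublocale abelian_group M by (rule abelian_group)

lemma smult_ahom_r: "a \<in> carrier A \<Longrightarrow> ahom M M (\<lambda>x. a \<odot>\<^bsub>M\<^esub> x)"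
  by (rule ahomI[OF abelian_group abelian_group]) (auto simp: smult_closed smult_r_distr)

lemma smult_ahom_l: "x \<in> carrier M \<Longrightarrow> ahom A M (\<lambda>a. a \<odot>\<^bsub>M\<^esub> x)"
  by (rule ahomI[OF A.abelian_group_axioms abelian_group])
    (auto simp: smult_closed smult_l_distr)

end

locale right_module =
  fixes A :: "('a, 'z) ring_scheme" (structure) and M :: "('a, 'm, 'y) bimodule_scheme"
  assumes ring_A': "ring A" and abelian_group': "abelian_group M"
    and rsmult_closed: "\<And>a x. \<lbrakk>a \<in> carrier A; x \<in> carrier M\<rbrakk> \<Longrightarrow> x \<lhd>\<^bsub>M\<^esub> a \<in> carrier M"
    and rsmult_r_distr: "\<And>a b x. \<lbrakk>a \<in> carrier A; b \<in> carrier A; x \<in> carrier M\<rbrakk> \<Longrightarrow>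
      x \<lhd>\<^bsub>M\<^esub> (a \<oplus> b) = x \<lhd>\<^bsub>M\<^esub> a \<oplus>\<^bsub>M\<^esub> x \<lhd>\<^bsub>M\<^esub> b"
    and rsmult_l_distr: "\<And>a x y. \<lbrakk>a \<in> carrier A; x \<in> carrier M; y \<in> carrier M\<rbrakk> \<Longrightarrow>
      (x \<oplus>\<^bsub>M\<^esub> y) \<lhd>\<^bsub>M\<^esub> a = x \<lhd>\<^bsub>M\<^esub> a \<oplus>\<^bsub>M\<^esub> y \<lhd>\<^bsub>M\<^esub> a"
    and rsmult_assoc: "\<And>a b x. \<lbrakk>a \<in> carrier A; b \<in> carrier A; x \<in> carrier M\<rbrakk> \<Longrightarrow>
      x \<lhd>\<^bsub>M\<^esub> (a \<otimes> b) = (x \<lhd>\<^bsub>M\<^esub> a) \<lhd>\<^bsub>M\<^esub> b"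
    and rsmult_one: "\<And>x. x \<in> carrier M \<Longrightarrow> x \<lhd>\<^bsub>M\<^esub> \<one> = x"

locale bimod = left_module A M + right_module A M
  for A :: "('a, 'z) ring_scheme" (structure) and M :: "('a, 'm, 'y) bimodule_scheme" +
  assumes smult_rsmult: "\<And>a b x. \<lbrakk>a \<in> carrier A; b \<in> carrier A; x \<in> carrier M\<rbrakk> \<Longrightarrow>
      (a \<odot>\<^bsub>M\<^esub> x) \<lhd>\<^bsub>M\<^esub> b = a \<odot>\<^bsub>M\<^esub> (x \<lhd>\<^bsub>M\<^esub> b)"
begin

lemma rsmult_ahom_r: "x \<in> carrier M \<Longrightarrow> ahom A M (\<lambda>a. x \<lhd>\<^bsub>M\<^esub> a)"
  by (rule ahomI[OF A.abelian_group_axioms abelian_group])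
    (auto simp: rsmult_closed rsmult_r_distr)

lemma rsmult_ahom_l: "a \<in> carrier A \<Longrightarrow> ahom M M (\<lambda>x. x \<lhd>\<^bsub>M\<^esub> a)"
  by (rule ahomI[OF abelian_group abelian_group])
    (auto simp: rsmult_closed rsmult_l_distr)

end

section \<open>The tensor product of a bimodule with a left module\<close>

locale tensor_product = M: bimod A M + N: left_module A N
  for A :: "('a, 'z) ring_scheme" (structure)
    and M :: "('a, 'm, 'y) bimodule_scheme" and N :: "('a, 'n, 'x) module_scheme"
begin

abbreviation MN where "MN \<equiv> tensor A M N"
abbreviation pt where "pt \<equiv> pure_tensor A M N"

sublocale pres: presentation "carrier M \<times> carrier N" "tensor_rels A M N"
proof
  show "tensor_rels A M N \<subseteq> carrier (free_Abelian_group (carrier M \<times> carrier N))"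
  proof
    fix r assume "r \<in> tensor_rels A M N"
    then show "r \<in> carrier (free_Abelian_group (carrier M \<times> carrier N))"
      unfolding tensor_rels_def
      by (auto simp del: carrier_free_Abelian_group_iff intro!: frag_diff_closed
          simp: M.rsmult_closed N.smult_closed)
  qed
qed

lemma MN_simps:
  "carrier MN = carrier (presented (carrier M \<times> carrier N) (tensor_rels A M N))"
  "add MN = add (presented (carrier M \<times> carrier N) (tensor_rels A M N))"
  "zero MN = zero (presented (carrier M \<times> carrier N) (tensor_rels A M N))"
  by (simp_all add: tensor_def Let_def ring.defs)

lemma abelian_group_MN: "abelian_group MN"
  by (rule abelian_group_transfer[OF pres.abelian_group_P]) (simp_all add: MN_simps)

sublocale MN: abelian_group MN by (rule abelian_group_MN)

lemma pure_closed [simp, intro]: "\<lbrakk>x \<in> carrier M; y \<in> carrier N\<rbrakk> \<Longrightarrow> pt x y \<in> carrier MN"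
  by (simp add: pure_tensor_def MN_simps pres.carrier_P)

lemma pure_add_l:
  "\<lbrakk>x \<in> carrier M; x' \<in> carrier M; y \<in> carrier N\<rbrakk> \<Longrightarrow>
    pt (x \<oplus>\<^bsub>M\<^esub> x') y = pt x y \<oplus>\<^bsub>MN\<^esub> pt x' y"
  unfolding pure_tensor_def MN_simps
  by (rule pres.cl_rel3) (auto simp: tensor_rels_def)

lemma pure_add_r:
  "\<lbrakk>x \<in> carrier M; y \<in> carrier N; y' \<in> carrier N\<rbrakk> \<Longrightarrow>
    pt x (y \<oplus>\<^bsub>N\<^esub> y') = pt x y \<oplus>\<^bsub>MN\<^esub> pt x y'"
  unfolding pure_tensor_def MN_simps
  by (rule pres.cl_rel3) (auto simp: tensor_rels_def)

lemma pure_balanced: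
  "\<lbrakk>x \<in> carrier M; a \<in> carrier A; y \<in> carrier N\<rbrakk> \<Longrightarrow> pt (x \<lhd>\<^bsub>M\<^esub> a) y = pt x (a \<odot>\<^bsub>N\<^esub> y)"
  unfolding pure_tensor_def
  by (rule pres.cl_rel2) (auto simp: tensor_rels_def M.rsmult_closed N.smult_closed)

lemma pure_ahom_l: "y \<in> carrier N \<Longrightarrow> ahom M MN (\<lambda>x. pt x y)"
  by (rule ahomI[OF M.abelian_group abelian_group_MN]) (auto simp: pure_add_l)

lemma pure_ahom_r: "x \<in> carrier M \<Longrightarrow> ahom N MN (\<lambda>y. pt x y)"
  by (rule ahomI[OF N.abelian_group abelian_group_MN]) (auto simp: pure_add_r)

text \<open>The negative of a pure tensor is again pure, with the first factor negated, so sums of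
  pure tensors exhaust the group and no case for differences arises.\<close>

lemma induct_MN [consumes 1, case_names pure add]:
  assumes "X \<in> carrier MN"
    and pure: "\<And>x y. \<lbrakk>x \<in> carrier M; y \<in> carrier N\<rbrakk> \<Longrightarrow> Q (pt x y)"
    and add: "\<And>X Y. \<lbrakk>X \<in> carrier MN; Y \<in> carrier MN; Q X; Q Y\<rbrakk> \<Longrightarrow> Q (X \<oplus>\<^bsub>MN\<^esub> Y)"
  shows "Q X"
  using assms(1) unfolding MN_simps
proof (induction rule: pres.P_induct_add)
  case (neg s)
  then obtain x y where s: "s = (x, y)" "x \<in> carrier M" "y \<in> carrier N" by auto
  have "pt (\<ominus>\<^bsub>M\<^esub> x) y \<oplus>\<^bsub>MN\<^esub> pt x y = pt (\<ominus>\<^bsub>M\<^esub> x \<oplus>\<^bsub>M\<^esub> x) y" using s by (simp add: pure_add_l)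
  also have "\<dots> = \<zero>\<^bsub>MN\<^esub>" using s ahom_zero[OF pure_ahom_l[of y]] by (simp add: M.l_neg)
  finally show ?case using s by (intro bexI[of _ "(\<ominus>\<^bsub>M\<^esub> x, y)"]) (simp_all add: pure_tensor_def MN_simps)
next
  case (gen s)
  then show ?case using pure by (auto simp: pure_tensor_def)
next
  case (add x y)
  then show ?case using assms(3) by (simp add: MN_simps)
qed (use M.zero_closed N.zero_closed in blast)

lemma ahom_eqI:
  assumes "ahom MN G f" "ahom MN G g"
    and "\<And>x y. \<lbrakk>x \<in> carrier M; y \<in> carrier N\<rbrakk> \<Longrightarrow> f (pt x y) = g (pt x y)"
    and "X \<in> carrier MN"
  shows "f X = g X"
  using assms(4)
  by (induction rule: induct_MN) (simp_all add: assms(3) ahom_add[OF assms(1)] ahom_add[OF assms(2)])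

text \<open>The maps that factor through the tensor product. Stating additivity by
  \<open>ahom\<close> makes the predicate also record that the target is an abelian group.\<close>

definition balanced where
  "balanced G f \<longleftrightarrow> (\<forall>x\<in>carrier M. ahom N G (f x)) \<and>
     (\<forall>y\<in>carrier N. ahom M G (\<lambda>x. f x y)) \<and>
     (\<forall>x\<in>carrier M. \<forall>a\<in>carrier A. \<forall>y\<in>carrier N. f (x \<lhd>\<^bsub>M\<^esub> a) y = f x (a \<odot>\<^bsub>N\<^esub> y))"

lemma balancedI:
  assumes "\<And>x. x \<in> carrier M \<Longrightarrow> ahom N G (f x)"
    and "\<And>y. y \<in> carrier N \<Longrightarrow> ahom M G (\<lambda>x. f x y)"
    and "\<And>x a y. \<lbrakk>x \<in> carrier M; a \<in> carrier A; y \<in> carrier N\<rbrakk> \<Longrightarrow> f (x \<lhd>\<^bsub>M\<^esub> a) y = f x (a \<odot>\<^bsub>N\<^esub> y)"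
  shows "balanced G f"
  using assms by (auto simp: balanced_def)

lemma
  assumes "balanced G f"
  shows induced_presented: "ahom (presented (carrier M \<times> carrier N) (tensor_rels A M N)) G
      (induced G (\<lambda>(x, y). f x y))"
    and induced_ahom: "ahom MN G (induced G (\<lambda>(x, y). f x y))"
    and induced_pure: "\<And>x y. \<lbrakk>x \<in> carrier M; y \<in> carrier N\<rbrakk> \<Longrightarrow> induced G (\<lambda>(x, y). f x y) (pt x y) = f x y"
proof -
  from assms have 1: "\<And>x. x \<in> carrier M \<Longrightarrow> ahom N G (f x)"
    and 2: "\<And>y. y \<in> carrier N \<Longrightarrow> ahom M G (\<lambda>x. f x y)"
    and 3: "\<And>x a y. \<lbrakk>x \<in> carrier M; a \<in> carrier A; y \<in> carrier N\<rbrakk> \<Longrightarrow> f (x \<lhd>\<^bsub>M\<^esub> a) y = f x (a \<odot>\<^bsub>N\<^esub> y)"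
    by (auto simp: balanced_def)
  interpret G: abelian_group G using 1[of "\<zero>\<^bsub>M\<^esub>"] ahom_groups by auto
  let ?f = "\<lambda>(x, y). f x y"
  have f: "?f \<in> carrier M \<times> carrier N \<rightarrow> carrier G"
    using 1 ahom_closed by fastforce
  have rels: "frag_extend G ?f r = \<zero>\<^bsub>G\<^esub>" if "r \<in> tensor_rels A M N" for r
    using that unfolding tensor_rels_def
    by (auto intro!: G.frag_extend_rel3[OF f] G.frag_extend_rel2[OF f]
        simp: ahom_add[OF 1] ahom_add[OF 2] 3 M.rsmult_closed N.smult_closed)
  show "ahom (presented (carrier M \<times> carrier N) (tensor_rels A M N)) G (induced G ?f)"
    by (rule pres.induced_P[OF G.abelian_group_axioms f rels])
  then show "ahom MN G (induced G ?f)"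
    by (rule ahom_transfer) (simp_all add: MN_simps)
  show "induced G ?f (pt x y) = f x y" if "x \<in> carrier M" "y \<in> carrier N" for x y
    using pres.induced_P(2)[OF G.abelian_group_axioms f rels] that by (simp add: pure_tensor_def)
qed

lemma balanced_smult:
  assumes a: "a \<in> carrier A"
  shows "balanced MN (\<lambda>x. pt (a \<odot>\<^bsub>M\<^esub> x))"
  by (rule balancedI)
    (use a in \<open>simp_all add: M.smult_closed pure_balanced ahom_comp[OF M.smult_ahom_r pure_ahom_l]
      pure_ahom_r flip: M.smult_rsmult\<close>)

text \<open>The action in \<open>tensor\<close> is defined by \<open>induced\<close> into the bare
  presented group, which exists before the record has an action. Balancedness is therefore moved
  from \<open>MN\<close> to that group first.\<close>

lemma smult_MN:
  assumes a: "a \<in> carrier A"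
  shows smult_MN_ahom: "ahom MN MN (\<lambda>X. a \<odot>\<^bsub>MN\<^esub> X)"
    and smult_pure: "\<And>x y. \<lbrakk>x \<in> carrier M; y \<in> carrier N\<rbrakk> \<Longrightarrow> a \<odot>\<^bsub>MN\<^esub> pt x y = pt (a \<odot>\<^bsub>M\<^esub> x) y"
proof -
  let ?P = "presented (carrier M \<times> carrier N) (tensor_rels A M N)"
  have "balanced ?P (\<lambda>x. pt (a \<odot>\<^bsub>M\<^esub> x))"
    using balanced_smult[OF a] unfolding balanced_def
    by (auto intro: ahom_transfer simp: MN_simps)
  note * = induced_presented[OF this] induced_pure[OF this]
  have eq: "(\<lambda>X. a \<odot>\<^bsub>MN\<^esub> X) = induced ?P (\<lambda>(x, y). pt (a \<odot>\<^bsub>M\<^esub> x) y)"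
    by (simp add: tensor_def Let_def ring.defs module.defs)
  show "ahom MN MN (\<lambda>X. a \<odot>\<^bsub>MN\<^esub> X)"
    unfolding eq by (rule ahom_transfer[OF *(1)]) (simp_all add: MN_simps)
  show "a \<odot>\<^bsub>MN\<^esub> pt x y = pt (a \<odot>\<^bsub>M\<^esub> x) y" if "x \<in> carrier M" "y \<in> carrier N" for x y
    using *(2)[OF that] fun_cong[OF eq] by simp
qed

end

section \<open>Dual modules and contractions\<close>

lemma regular_simps [simp]:
  "carrier (regular A) = carrier A" "add (regular A) = add A" "zero (regular A) = zero A"
  "smult (regular A) = mult A" "rsmult (regular A) = mult A"
  by (simp_all add: regular_def)

lemma dual_simps:
  "carrier (dual A M) = right_hom A M (regular A)"
  "\<zero>\<^bsub>dual A M\<^esub> = (\<lambda>x\<in>carrier M. \<zero>\<^bsub>A\<^esub>)"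
  "f \<oplus>\<^bsub>dual A M\<^esub> g = (\<lambda>x\<in>carrier M. f x \<oplus>\<^bsub>A\<^esub> g x)"
  "a \<odot>\<^bsub>dual A M\<^esub> f = (\<lambda>x\<in>carrier M. a \<otimes>\<^bsub>A\<^esub> f x)"
  "f \<lhd>\<^bsub>dual A M\<^esub> a = (\<lambda>x\<in>carrier M. f (a \<odot>\<^bsub>M\<^esub> x))"
  by (simp_all add: dual_def)

lemma dual_eqI:
  assumes "f \<in> carrier (dual A M)" "g \<in> carrier (dual A M)" "\<And>x. x \<in> carrier M \<Longrightarrow> f x = g x"
  shows "f = g"
  using assms by (intro PiE_ext[of f "carrier M" "\<lambda>_. carrier A" g]) (auto simp: dual_simps right_hom_def)

context bimod begin

lemma dual_ahom: "f \<in> carrier (dual A M) \<Longrightarrow> ahom M A f"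
  by (rule ahomI[OF abelian_group A.abelian_group_axioms])
    (auto simp: dual_simps right_hom_def)

lemma dual_closed: "\<lbrakk>f \<in> carrier (dual A M); x \<in> carrier M\<rbrakk> \<Longrightarrow> f x \<in> carrier A"
  by (auto simp: dual_simps right_hom_def)

lemma dual_rsmult: "\<lbrakk>f \<in> carrier (dual A M); x \<in> carrier M; a \<in> carrier A\<rbrakk> \<Longrightarrow> f (x \<lhd>\<^bsub>M\<^esub> a) = f x \<otimes> a"
  by (auto simp: dual_simps right_hom_def)

lemma dualI:
  assumes "ahom M A f" "\<And>x a. \<lbrakk>x \<in> carrier M; a \<in> carrier A\<rbrakk> \<Longrightarrow> f (x \<lhd>\<^bsub>M\<^esub> a) = f x \<otimes> a"
  shows "(\<lambda>x\<in>carrier M. f x) \<in> carrier (dual A M)"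
  using assms by (auto simp: dual_simps right_hom_def ahom_closed[OF assms(1)] ahom_add[OF assms(1)] rsmult_closed)

lemma dual_zero_closed: "\<zero>\<^bsub>dual A M\<^esub> \<in> carrier (dual A M)"
  unfolding dual_simps(2) by (rule dualI) (simp_all add: ahom_const_zero abelian_group A.abelian_group_axioms)

lemma dual_add_closed:
  "\<lbrakk>f \<in> carrier (dual A M); g \<in> carrier (dual A M)\<rbrakk> \<Longrightarrow> f \<oplus>\<^bsub>dual A M\<^esub> g \<in> carrier (dual A M)"
  unfolding dual_simps(3) by (rule dualI)
    (simp_all add: ahom_plus dual_ahom dual_rsmult dual_closed A.l_distr)

lemma dual_smult_closed:
  "\<lbrakk>a \<in> carrier A; f \<in> carrier (dual A M)\<rbrakk> \<Longrightarrow> a \<odot>\<^bsub>dual A M\<^esub> f \<in> carrier (dual A M)"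
  unfolding dual_simps(4) by (rule dualI)
    (auto intro!: ahomI abelian_group A.abelian_group_axioms
      simp: dual_closed dual_rsmult A.m_assoc A.r_distr ahom_add[OF dual_ahom])

lemma dual_rsmult_closed:
  "\<lbrakk>a \<in> carrier A; f \<in> carrier (dual A M)\<rbrakk> \<Longrightarrow> f \<lhd>\<^bsub>dual A M\<^esub> a \<in> carrier (dual A M)"
  unfolding dual_simps(5) by (rule dualI)
    (auto intro!: ahomI abelian_group A.abelian_group_axioms
      simp: dual_closed dual_rsmult smult_closed smult_r_distr ahom_add[OF dual_ahom]
      simp flip: smult_rsmult)

lemma dual_uminus_closed:
  "f \<in> carrier (dual A M) \<Longrightarrow> (\<lambda>x\<in>carrier M. \<ominus> f x) \<in> carrier (dual A M)"
  by (rule dualI) (simp_all add: ahom_uminus dual_ahom dual_rsmult dual_closed A.l_minus)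

lemma dual_apply:
  assumes "x \<in> carrier M"
  shows "\<zero>\<^bsub>dual A M\<^esub> x = \<zero>" "(f \<oplus>\<^bsub>dual A M\<^esub> g) x = f x \<oplus> g x"
    "(a \<odot>\<^bsub>dual A M\<^esub> f) x = a \<otimes> f x" "(f \<lhd>\<^bsub>dual A M\<^esub> a) x = f (a \<odot>\<^bsub>M\<^esub> x)"
  using assms by (simp_all add: dual_simps)

lemma abelian_group_dual: "abelian_group (dual A M)"
proof (rule abelian_groupI)
  show "\<exists>g\<in>carrier (dual A M). g \<oplus>\<^bsub>dual A M\<^esub> f = \<zero>\<^bsub>dual A M\<^esub>" if "f \<in> carrier (dual A M)" for f
    by (rule bexI[OF _ dual_uminus_closed[OF that]])
      (use dual_closed[OF that] in \<open>auto simp: dual_simps A.l_neg intro!: restrict_ext\<close>)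
qed (auto intro!: dual_add_closed dual_zero_closed dual_eqI[of _ A M] simp: dual_apply dual_closed A.a_ac)

lemma bimod_dual: "bimod A (dual A M)"
proof (intro bimod.intro left_module.intro right_module.intro bimod_axioms.intro)
qed (auto intro!: ring_A abelian_group_dual dual_add_closed dual_smult_closed dual_rsmult_closed
      dual_eqI[of _ A M] simp: dual_apply dual_closed smult_closed A.l_distr A.r_distr A.m_assoc
      smult_assoc smult_one smult_l_distr ahom_add[OF dual_ahom])

lemma dual_apply_ahom: "x \<in> carrier M \<Longrightarrow> ahom (dual A M) A (\<lambda>f. f x)"
  by (rule ahomI[OF abelian_group_dual A.abelian_group_axioms])
    (auto simp: dual_closed dual_apply)

text \<open>The witnesses are the images of the standard basis vectors and the coordinate functions.\<close>

lemma fg_projective_dual_basis: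
  assumes "fg_projective_right A M"
  obtains m \<eta> \<alpha> where "\<And>k. k < m \<Longrightarrow> \<eta> k \<in> carrier M" "\<And>k. k < m \<Longrightarrow> \<alpha> k \<in> carrier (dual A M)"
    "\<And>x. x \<in> carrier M \<Longrightarrow> x = (\<Oplus>\<^bsub>M\<^esub>k\<in>{..<m::nat}. \<eta> k \<lhd>\<^bsub>M\<^esub> \<alpha> k x)"
proof -
  obtain m i p where i: "i \<in> right_hom A M (free_bimodule A m)"
    and p: "p \<in> right_hom A (free_bimodule A m) M" and pi: "\<And>x. x \<in> carrier M \<Longrightarrow> p (i x) = x"
    using assms by (auto simp: fg_projective_right_def)
  define e where "e k = (\<lambda>j\<in>{..<m}. if j = k then \<one> else \<zero>)" for k
  have e: "e k \<in> carrier (free_bimodule A m)" for k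
    by (auto simp: e_def free_bimodule_def)
  have p_closed: "p z \<in> carrier M" if "z \<in> carrier (free_bimodule A m)" for z
    using p that by (auto simp: right_hom_def)
  \<comment> \<open>The vector is cut off after \<open>l\<close> coordinates, so that each step of
    the induction adds one multiple of a basis vector; \<open>l = m\<close> gives the whole
    vector.\<close>
  have p_sum: "p (\<lambda>j\<in>{..<m}. if j < l then z j else \<zero>) = (\<Oplus>\<^bsub>M\<^esub>k\<in>{..<l}. p (e k) \<lhd>\<^bsub>M\<^esub> z k)"
    if z: "z \<in> carrier (free_bimodule A m)" and "l \<le> m" for z l
    using that(2)
  proof (induction l)
    case 0
    have zero: "(\<lambda>j\<in>{..<m}. \<zero>) \<in> carrier (free_bimodule A m)" by (auto simp: free_bimodule_def)
    \<comment> \<open>\<open>p\<close> is given only as an additive right linear map, so that it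
      preserves zero is derived from 0 + 0 = 0.\<close>
    have "(\<lambda>j\<in>{..<m}. \<zero>) \<oplus>\<^bsub>free_bimodule A m\<^esub> (\<lambda>j\<in>{..<m}. \<zero>) = (\<lambda>j\<in>{..<m}. \<zero>)"
      by (auto simp: free_bimodule_def intro!: restrict_ext)
    moreover have "p (z \<oplus>\<^bsub>free_bimodule A m\<^esub> z) = p z \<oplus>\<^bsub>M\<^esub> p z"
      if "z \<in> carrier (free_bimodule A m)" for z
      using p that by (simp add: right_hom_def)
    ultimately have "p (\<lambda>j\<in>{..<m}. \<zero>) = p (\<lambda>j\<in>{..<m}. \<zero>) \<oplus>\<^bsub>M\<^esub> p (\<lambda>j\<in>{..<m}. \<zero>)"
      using zero by metis
    then have "p (\<lambda>j\<in>{..<m}. \<zero>) = \<zero>\<^bsub>M\<^esub>"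
      using p_closed[OF zero] by (simp add: add.r_cancel_one')
    moreover have "(\<lambda>j\<in>{..<m}. if j < 0 then z j else \<zero>) = (\<lambda>j\<in>{..<m}. \<zero>)" by simp
    ultimately show ?case by (simp only: lessThan_0 finsum_empty)
  next
    case (Suc l)
    let ?z = "\<lambda>l. \<lambda>j\<in>{..<m}. if j < l then z j else \<zero>"
    have zj: "z j \<in> carrier A" if "j < m" for j using z that by (auto simp: free_bimodule_def)
    have z': "?z l \<in> carrier (free_bimodule A m)" using zj by (auto simp: free_bimodule_def)
    have ez: "e l \<lhd>\<^bsub>free_bimodule A m\<^esub> z l \<in> carrier (free_bimodule A m)"
      using zj Suc.prems by (auto simp: free_bimodule_def e_def)
    have "?z (Suc l) = ?z l \<oplus>\<^bsub>free_bimodule A m\<^esub> (e l \<lhd>\<^bsub>free_bimodule A m\<^esub> z l)"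
      using zj Suc.prems by (auto simp: free_bimodule_def e_def less_Suc_eq intro!: restrict_ext)
    then have "p (?z (Suc l)) = p (?z l) \<oplus>\<^bsub>M\<^esub> p (e l \<lhd>\<^bsub>free_bimodule A m\<^esub> z l)"
      using p z' ez by (simp add: right_hom_def)
    also have "p (e l \<lhd>\<^bsub>free_bimodule A m\<^esub> z l) = p (e l) \<lhd>\<^bsub>M\<^esub> z l"
      using p e zj Suc.prems by (auto simp: right_hom_def)
    also have "p (?z l) \<oplus>\<^bsub>M\<^esub> p (e l) \<lhd>\<^bsub>M\<^esub> z l =
        p (e l) \<lhd>\<^bsub>M\<^esub> z l \<oplus>\<^bsub>M\<^esub> (\<Oplus>\<^bsub>M\<^esub>k\<in>{..<l}. p (e k) \<lhd>\<^bsub>M\<^esub> z k)"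
      unfolding Suc.IH[OF Suc_leD[OF Suc.prems]]
      using Suc.prems zj by (intro a_comm finsum_closed) (auto intro!: rsmult_closed p_closed e)
    also have "\<dots> = (\<Oplus>\<^bsub>M\<^esub>k\<in>{..<Suc l}. p (e k) \<lhd>\<^bsub>M\<^esub> z k)"
      unfolding lessThan_Suc
      using Suc.prems zj by (intro finsum_insert[symmetric]) (auto intro!: rsmult_closed p_closed e)
    finally show ?case .
  qed
  show ?thesis
  proof (rule that[where m = m and \<eta> = "\<lambda>k. p (e k)" and \<alpha> = "\<lambda>k. \<lambda>x\<in>carrier M. i x k"])
    fix k assume k: "k < m"
    show "p (e k) \<in> carrier M" by (rule p_closed[OF e])
    show "(\<lambda>x\<in>carrier M. i x k) \<in> carrier (dual A M)"
      using i k by (intro dualI ahomI abelian_group A.abelian_group_axioms)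
        (auto simp: right_hom_def free_bimodule_def)
  next
    fix x assume x: "x \<in> carrier M"
    have ix: "i x \<in> carrier (free_bimodule A m)" using i x by (auto simp: right_hom_def)
    then have "(\<lambda>j\<in>{..<m}. if j < m then i x j else \<zero>) = i x"
      by (auto simp: free_bimodule_def fun_eq_iff restrict_def PiE_def extensional_def)
    then have "x = (\<Oplus>\<^bsub>M\<^esub>k\<in>{..<m}. p (e k) \<lhd>\<^bsub>M\<^esub> i x k)"
      using p_sum[OF ix order_refl] pi[OF x] by simp
    also have "\<dots> = (\<Oplus>\<^bsub>M\<^esub>k\<in>{..<m}. p (e k) \<lhd>\<^bsub>M\<^esub> (\<lambda>x\<in>carrier M. i x k) x)"
      using x by simp
    finally show "x = (\<Oplus>\<^bsub>M\<^esub>k\<in>{..<m}. p (e k) \<lhd>\<^bsub>M\<^esub> (\<lambda>x\<in>carrier M. i x k) x)" .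
  qed
qed

end

section \<open>Contraction with elements of the dual module\<close>

context tensor_product begin

abbreviation contr where "contr \<equiv> contract N"

lemma contract_balanced: "\<alpha> \<in> carrier (dual A M) \<Longrightarrow> balanced N (\<lambda>x y. \<alpha> x \<odot>\<^bsub>N\<^esub> y)"
  by (rule balancedI)
    (simp_all add: N.smult_ahom_r M.dual_closed M.dual_rsmult N.smult_assoc
      ahom_comp[OF M.dual_ahom N.smult_ahom_l])

lemma contract_ahom: "\<alpha> \<in> carrier (dual A M) \<Longrightarrow> ahom MN N (contr \<alpha>)"
  unfolding contract_def by (rule induced_ahom[OF contract_balanced])

lemma contract_pure:
  "\<lbrakk>\<alpha> \<in> carrier (dual A M); x \<in> carrier M; y \<in> carrier N\<rbrakk> \<Longrightarrow> contr \<alpha> (pt x y) = \<alpha> x \<odot>\<^bsub>N\<^esub> y"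
  unfolding contract_def by (rule induced_pure[OF contract_balanced])

lemma contract_closed: "\<lbrakk>\<alpha> \<in> carrier (dual A M); X \<in> carrier MN\<rbrakk> \<Longrightarrow> contr \<alpha> X \<in> carrier N"
  by (simp add: ahom_closed[OF contract_ahom])

lemma contract_add:
  "\<lbrakk>\<alpha> \<in> carrier (dual A M); \<beta> \<in> carrier (dual A M); X \<in> carrier MN\<rbrakk> \<Longrightarrow>
    contr (\<alpha> \<oplus>\<^bsub>dual A M\<^esub> \<beta>) X = contr \<alpha> X \<oplus>\<^bsub>N\<^esub> contr \<beta> X"
  by (rule ahom_eqI[where G = N])
    (simp_all add: contract_ahom ahom_plus M.dual_add_closed contract_pure M.dual_apply M.dual_closed
      N.smult_l_distr)

lemma contract_dual_ahom: "X \<in> carrier MN \<Longrightarrow> ahom (dual A M) N (\<lambda>\<alpha>. contr \<alpha> X)"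
  by (rule ahomI[OF M.abelian_group_dual N.abelian_group])
    (auto simp: contract_closed contract_add)

lemma contract_smult_dual:
  "\<lbrakk>a \<in> carrier A; \<alpha> \<in> carrier (dual A M); X \<in> carrier MN\<rbrakk> \<Longrightarrow>
    contr (a \<odot>\<^bsub>dual A M\<^esub> \<alpha>) X = a \<odot>\<^bsub>N\<^esub> contr \<alpha> X"
  by (rule ahom_eqI[where G = N])
    (simp_all add: contract_ahom M.dual_smult_closed contract_pure M.dual_apply M.dual_closed
      N.smult_assoc ahom_comp[OF contract_ahom N.smult_ahom_r])

lemma contract_smult:
  "\<lbrakk>a \<in> carrier A; \<alpha> \<in> carrier (dual A M); X \<in> carrier MN\<rbrakk> \<Longrightarrow>
    contr \<alpha> (a \<odot>\<^bsub>MN\<^esub> X) = contr (\<alpha> \<lhd>\<^bsub>dual A M\<^esub> a) X"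
  by (rule ahom_eqI[where G = N])
    (simp_all add: contract_ahom M.dual_rsmult_closed contract_pure M.dual_apply smult_pure M.smult_closed
      ahom_comp[OF smult_MN_ahom contract_ahom])

text \<open>On a pure tensor, expand the left factor in the dual basis and move each coefficient
  \<open>\<alpha> k x\<close> across the tensor sign: there it becomes the contraction with
  \<open>\<alpha> k\<close>.\<close>

lemma dual_basis_expansion:
  assumes \<eta>: "\<And>k. k < m \<Longrightarrow> \<eta> k \<in> carrier M" and \<alpha>: "\<And>k. k < m \<Longrightarrow> \<alpha> k \<in> carrier (dual A M)"
    and basis: "\<And>x. x \<in> carrier M \<Longrightarrow> x = (\<Oplus>\<^bsub>M\<^esub>k\<in>{..<m::nat}. \<eta> k \<lhd>\<^bsub>M\<^esub> \<alpha> k x)"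
    and X: "X \<in> carrier MN"
  shows "X = (\<Oplus>\<^bsub>MN\<^esub>k\<in>{..<m}. pt (\<eta> k) (contr (\<alpha> k) X))"
proof (rule ahom_eqI[where f = "\<lambda>X. X" and g = "\<lambda>X. \<Oplus>\<^bsub>MN\<^esub>k\<in>{..<m}. pt (\<eta> k) (contr (\<alpha> k) X)"
      and G = MN, OF _ _ _ X])
  show "ahom MN MN (\<lambda>X. X)"
    by (rule ahomI) (simp_all add: abelian_group_MN)
  show "ahom MN MN (\<lambda>X. \<Oplus>\<^bsub>MN\<^esub>k\<in>{..<m}. pt (\<eta> k) (contr (\<alpha> k) X))"
    using \<eta> \<alpha> by (intro ahom_sum abelian_group_MN ahom_comp[OF contract_ahom pure_ahom_r]) auto
  fix x y assume xy: "x \<in> carrier M" "y \<in> carrier N"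
  have "pt x y = pt (\<Oplus>\<^bsub>M\<^esub>k\<in>{..<m}. \<eta> k \<lhd>\<^bsub>M\<^esub> \<alpha> k x) y" using basis[OF xy(1)] by simp
  also have "\<dots> = (\<Oplus>\<^bsub>MN\<^esub>k\<in>{..<m}. pt (\<eta> k \<lhd>\<^bsub>M\<^esub> \<alpha> k x) y)"
    using xy \<eta> \<alpha> by (intro ahom_finsum[OF pure_ahom_l]) (auto simp: M.rsmult_closed M.dual_closed)
  also have "\<dots> = (\<Oplus>\<^bsub>MN\<^esub>k\<in>{..<m}. pt (\<eta> k) (contr (\<alpha> k) (pt x y)))"
    using xy \<eta> \<alpha> by (intro MN.finsum_cong')
      (auto simp: pure_balanced contract_pure M.dual_closed N.smult_closed)
  finally show "pt x y = (\<Oplus>\<^bsub>MN\<^esub>k\<in>{..<m}. pt (\<eta> k) (contr (\<alpha> k) (pt x y)))" .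
qed

lemma contract_faithful:
  assumes "fg_projective_right A M" and X: "X \<in> carrier MN"
    and zero: "\<And>\<alpha>. \<alpha> \<in> carrier (dual A M) \<Longrightarrow> contr \<alpha> X = \<zero>\<^bsub>N\<^esub>"
  shows "X = \<zero>\<^bsub>MN\<^esub>"
proof -
  obtain m \<eta> \<alpha> where \<eta>: "\<And>k. k < m \<Longrightarrow> \<eta> k \<in> carrier M" and \<alpha>: "\<And>k. k < m \<Longrightarrow> \<alpha> k \<in> carrier (dual A M)"
    and basis: "\<And>x. x \<in> carrier M \<Longrightarrow> x = (\<Oplus>\<^bsub>M\<^esub>k\<in>{..<m::nat}. \<eta> k \<lhd>\<^bsub>M\<^esub> \<alpha> k x)"
    by (rule M.fg_projective_dual_basis[OF assms(1)]) (rule that)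
  have "X = (\<Oplus>\<^bsub>MN\<^esub>k\<in>{..<m}. pt (\<eta> k) (contr (\<alpha> k) X))"
    by (rule dual_basis_expansion[OF \<eta> \<alpha> basis X])
  also have "\<dots> = (\<Oplus>\<^bsub>MN\<^esub>k\<in>{..<m}. \<zero>\<^bsub>MN\<^esub>)"
    using \<eta> \<alpha> by (intro MN.finsum_cong') (auto simp: zero ahom_zero[OF pure_ahom_r])
  also have "\<dots> = \<zero>\<^bsub>MN\<^esub>" by (rule MN.finsum_zero)
  finally show ?thesis .
qed

end

section \<open>The right action on a tensor product of bimodules\<close>

locale tensor_product_bimod = tensor_product A M N + N: right_module A N + N: bimod A N
  for A :: "('a, 'z) ring_scheme" (structure)
    and M :: "('a, 'm, 'y) bimodule_scheme" and N :: "('a, 'n, 'x) bimodule_scheme"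
begin

abbreviation rs where "rs \<equiv> tensor_rsmult A M N"

lemma rsmult_balanced: "a \<in> carrier A \<Longrightarrow> balanced MN (\<lambda>x y. pt x (y \<lhd>\<^bsub>N\<^esub> a))"
  by (rule balancedI)
    (simp_all add: N.rsmult_closed ahom_comp[OF N.rsmult_ahom_l pure_ahom_r] pure_ahom_l pure_balanced
     N.smult_rsmult)

lemma rsmult_MN_ahom: "a \<in> carrier A \<Longrightarrow> ahom MN MN (\<lambda>X. rs X a)"
  unfolding tensor_rsmult_def by (rule induced_ahom[OF rsmult_balanced])

lemma rsmult_pure:
  "\<lbrakk>a \<in> carrier A; x \<in> carrier M; y \<in> carrier N\<rbrakk> \<Longrightarrow> rs (pt x y) a = pt x (y \<lhd>\<^bsub>N\<^esub> a)"
  unfolding tensor_rsmult_def by (rule induced_pure[OF rsmult_balanced])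

lemma contract_rsmult:
  "\<lbrakk>a \<in> carrier A; \<alpha> \<in> carrier (dual A M); X \<in> carrier MN\<rbrakk> \<Longrightarrow>
    contr \<alpha> (rs X a) = contr \<alpha> X \<lhd>\<^bsub>N\<^esub> a"
  by (rule ahom_eqI[where G = N])
    (simp_all add: rsmult_pure contract_pure N.smult_rsmult M.dual_closed N.rsmult_closed
      ahom_comp[OF rsmult_MN_ahom contract_ahom] ahom_comp[OF contract_ahom N.rsmult_ahom_l])

end

section \<open>The tensor algebra\<close>

locale tensor_words = V: bimod A V
  for A :: "('a, 'z) ring_scheme" (structure) and V :: "('a, 'v, 'y) bimodule_scheme"
begin

text \<open>Membership in \<open>Vs\<close> stays a statement about lists, which simplification
  splits along \<open>#\<close> and \<open>@\<close>, instead of turning into one about the set of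
  letters.\<close>

declare in_lists_conv_set [simp del] in_listsD [rule del] in_listsI [rule del]

abbreviation TV where "TV \<equiv> tensor_module A V"
abbreviation wd where "wd \<equiv> word A V"
abbreviation Vs where "Vs \<equiv> lists (carrier V)"

sublocale wpres: presentation "carrier A \<times> Vs" "word_rels A V"
proof
  show "word_rels A V \<subseteq> carrier (free_Abelian_group (carrier A \<times> Vs))"
  proof
    fix r assume r: "r \<in> word_rels A V"
    show "r \<in> carrier (free_Abelian_group (carrier A \<times> Vs))"
      using r unfolding word_rels_def
      apply (elim UnE CollectE exE conjE)
         apply (hypsubst, rule frag_diff_closed(2), simp, simp, simp)
        apply (hypsubst, rule frag_diff_closed(2), simp, simp, simp)
       apply (hypsubst, rule frag_diff_closed(1), simp, simp add: V.smult_closed)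
      apply (hypsubst, rule frag_diff_closed(1), simp add: V.rsmult_closed, simp add: V.smult_closed)
      done
  qed
qed

lemma TV_simps:
  "carrier TV = carrier (presented (carrier A \<times> Vs) (word_rels A V))"
  "add TV = add (presented (carrier A \<times> Vs) (word_rels A V))"
  "zero TV = zero (presented (carrier A \<times> Vs) (word_rels A V))"
  by (simp_all add: tensor_module_def Let_def ring.defs)

lemma abelian_group_TV: "abelian_group TV"
  by (rule abelian_group_transfer[OF wpres.abelian_group_P]) (simp_all add: TV_simps)

sublocale TV: abelian_group TV by (rule abelian_group_TV)

lemma word_closed: "\<lbrakk>a \<in> carrier A; vs \<in> Vs\<rbrakk> \<Longrightarrow> wd a vs \<in> carrier TV"
  by (simp add: word_def TV_simps wpres.carrier_P)

lemma word_add_coeff: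
  "\<lbrakk>a \<in> carrier A; b \<in> carrier A; vs \<in> Vs\<rbrakk> \<Longrightarrow> wd (a \<oplus> b) vs = wd a vs \<oplus>\<^bsub>TV\<^esub> wd b vs"
  unfolding word_def TV_simps by (rule wpres.cl_rel3) ((unfold word_rels_def, rule UnI1, rule UnI1, rule UnI1, rule CollectI, intro exI conjI, rule refl, simp_all))

lemma word_add_letter:
  "\<lbrakk>a \<in> carrier A; v \<in> carrier V; w \<in> carrier V; xs \<in> Vs; ys \<in> Vs\<rbrakk> \<Longrightarrow>
    wd a (xs @ (v \<oplus>\<^bsub>V\<^esub> w) # ys) = wd a (xs @ v # ys) \<oplus>\<^bsub>TV\<^esub> wd a (xs @ w # ys)"
  unfolding word_def TV_simps by (rule wpres.cl_rel3) ((unfold word_rels_def, rule UnI1, rule UnI1, rule UnI2, rule CollectI, intro exI conjI, rule refl, simp_all))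

lemma word_add_head:
  "\<lbrakk>a \<in> carrier A; v \<in> carrier V; w \<in> carrier V; ys \<in> Vs\<rbrakk> \<Longrightarrow>
    wd a ((v \<oplus>\<^bsub>V\<^esub> w) # ys) = wd a (v # ys) \<oplus>\<^bsub>TV\<^esub> wd a (w # ys)"
  using word_add_letter[of a v w "[]" ys] by simp

lemma word_coeff:
  "\<lbrakk>a \<in> carrier A; b \<in> carrier A; v \<in> carrier V; ys \<in> Vs\<rbrakk> \<Longrightarrow>
    wd (a \<otimes> b) (v # ys) = wd a ((b \<odot>\<^bsub>V\<^esub> v) # ys)"
  unfolding word_def by (rule wpres.cl_rel2) ((unfold word_rels_def, rule UnI1, rule UnI2, rule CollectI, intro exI conjI, rule refl, simp_all add: V.smult_closed))

lemma word_middle: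
  "\<lbrakk>a \<in> carrier A; b \<in> carrier A; v \<in> carrier V; w \<in> carrier V; xs \<in> Vs; ys \<in> Vs\<rbrakk> \<Longrightarrow>
    wd a (xs @ (v \<lhd>\<^bsub>V\<^esub> b) # w # ys) = wd a (xs @ v # (b \<odot>\<^bsub>V\<^esub> w) # ys)"
  unfolding word_def by (rule wpres.cl_rel2) ((unfold word_rels_def, rule UnI2, rule CollectI, intro exI conjI, rule refl, simp_all add: V.smult_closed V.rsmult_closed))

lemma word_ahom_coeff: "vs \<in> Vs \<Longrightarrow> ahom A TV (\<lambda>a. wd a vs)"
  by (rule ahomI[OF V.A.abelian_group_axioms abelian_group_TV])
    (auto simp: word_add_coeff word_closed)

lemma word_ahom_letter:
  "\<lbrakk>a \<in> carrier A; xs \<in> Vs; ys \<in> Vs\<rbrakk> \<Longrightarrow> ahom V TV (\<lambda>v. wd a (xs @ v # ys))"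
  by (rule ahomI[OF V.abelian_group abelian_group_TV])
    (auto simp: word_add_letter word_closed)

lemma induct_TV [consumes 1, case_names word add]:
  assumes "x \<in> carrier TV"
    and word: "\<And>a vs. \<lbrakk>a \<in> carrier A; vs \<in> Vs\<rbrakk> \<Longrightarrow> Q (wd a vs)"
    and add: "\<And>x y. \<lbrakk>x \<in> carrier TV; y \<in> carrier TV; Q x; Q y\<rbrakk> \<Longrightarrow> Q (x \<oplus>\<^bsub>TV\<^esub> y)"
  shows "Q x"
  using assms(1) unfolding TV_simps
proof (induction rule: wpres.P_induct_add)
  case (neg s)
  then obtain a vs where s: "s = (a, vs)" "a \<in> carrier A" "vs \<in> Vs" by auto
  have "wd (\<ominus> a) vs \<oplus>\<^bsub>TV\<^esub> wd a vs = wd (\<ominus> a \<oplus> a) vs" using s by (simp add: word_add_coeff)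
  also have "\<dots> = \<zero>\<^bsub>TV\<^esub>" using s ahom_zero[OF word_ahom_coeff[of vs]] by (simp add: V.A.l_neg)
  finally show ?case using s by (intro bexI[of _ "(\<ominus> a, vs)"]) (simp_all add: word_def TV_simps)
next
  case (gen s)
  then show ?case using word by (auto simp: word_def)
next
  case (add x y)
  then show ?case using assms(3) by (simp add: TV_simps)
qed (use V.A.zero_closed lists.Nil in blast)

lemma TV_ahom_eqI:
  assumes "ahom TV G f" "ahom TV G g"
    and "\<And>a vs. \<lbrakk>a \<in> carrier A; vs \<in> Vs\<rbrakk> \<Longrightarrow> f (wd a vs) = g (wd a vs)"
    and "x \<in> carrier TV"
  shows "f x = g x"
  using assms(4)
  by (induction rule: induct_TV) (simp_all add: assms(3) ahom_add[OF assms(1)] ahom_add[OF assms(2)])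

text \<open>The maps that factor through the tensor algebra. The coefficient acts as an extra tensor
  factor in front of the letters, hence the separate condition joining it to the first
  letter.\<close>

definition word_map where
  "word_map G f \<longleftrightarrow> (\<forall>vs\<in>Vs. ahom A G (\<lambda>a. f a vs)) \<and>
     (\<forall>a\<in>carrier A. \<forall>xs\<in>Vs. \<forall>ys\<in>Vs. ahom V G (\<lambda>v. f a (xs @ v # ys))) \<and>
     (\<forall>a\<in>carrier A. \<forall>b\<in>carrier A. \<forall>v\<in>carrier V. \<forall>ys\<in>Vs.
        f (a \<otimes> b) (v # ys) = f a ((b \<odot>\<^bsub>V\<^esub> v) # ys)) \<and>
     (\<forall>a\<in>carrier A. \<forall>b\<in>carrier A. \<forall>v\<in>carrier V. \<forall>w\<in>carrier V. \<forall>xs\<in>Vs. \<forall>ys\<in>Vs.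
        f a (xs @ (v \<lhd>\<^bsub>V\<^esub> b) # w # ys) = f a (xs @ v # (b \<odot>\<^bsub>V\<^esub> w) # ys))"

lemma word_mapI:
  assumes "\<And>vs. vs \<in> Vs \<Longrightarrow> ahom A G (\<lambda>a. f a vs)"
    and "\<And>a xs ys. \<lbrakk>a \<in> carrier A; xs \<in> Vs; ys \<in> Vs\<rbrakk> \<Longrightarrow> ahom V G (\<lambda>v. f a (xs @ v # ys))"
    and "\<And>a b v ys. \<lbrakk>a \<in> carrier A; b \<in> carrier A; v \<in> carrier V; ys \<in> Vs\<rbrakk> \<Longrightarrow>
      f (a \<otimes> b) (v # ys) = f a ((b \<odot>\<^bsub>V\<^esub> v) # ys)"
    and "\<And>a b v w xs ys. \<lbrakk>a \<in> carrier A; b \<in> carrier A; v \<in> carrier V; w \<in> carrier V; xs \<in> Vs; ys \<in> Vs\<rbrakk> \<Longrightarrow>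
      f a (xs @ (v \<lhd>\<^bsub>V\<^esub> b) # w # ys) = f a (xs @ v # (b \<odot>\<^bsub>V\<^esub> w) # ys)"
  shows "word_map G f"
  unfolding word_map_def by (intro conjI ballI; rule assms; assumption)

lemma
  assumes "word_map G f"
  shows induced_wpresented: "ahom (presented (carrier A \<times> Vs) (word_rels A V)) G
      (induced G (\<lambda>(a, vs). f a vs))"
    and induced_TV_ahom: "ahom TV G (induced G (\<lambda>(a, vs). f a vs))"
    and induced_word: "\<And>a vs. \<lbrakk>a \<in> carrier A; vs \<in> Vs\<rbrakk> \<Longrightarrow> induced G (\<lambda>(a, vs). f a vs) (wd a vs) = f a vs"
proof -
  from assms have 1: "\<And>vs. vs \<in> Vs \<Longrightarrow> ahom A G (\<lambda>a. f a vs)"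
    and 2: "\<And>a xs ys. \<lbrakk>a \<in> carrier A; xs \<in> Vs; ys \<in> Vs\<rbrakk> \<Longrightarrow> ahom V G (\<lambda>v. f a (xs @ v # ys))"
    and 3: "\<And>a b v ys. \<lbrakk>a \<in> carrier A; b \<in> carrier A; v \<in> carrier V; ys \<in> Vs\<rbrakk> \<Longrightarrow>
      f (a \<otimes> b) (v # ys) = f a ((b \<odot>\<^bsub>V\<^esub> v) # ys)"
    and 4: "\<And>a b v w xs ys. \<lbrakk>a \<in> carrier A; b \<in> carrier A; v \<in> carrier V; w \<in> carrier V; xs \<in> Vs; ys \<in> Vs\<rbrakk> \<Longrightarrow>
      f a (xs @ (v \<lhd>\<^bsub>V\<^esub> b) # w # ys) = f a (xs @ v # (b \<odot>\<^bsub>V\<^esub> w) # ys)"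
    unfolding word_map_def by blast+
  interpret G: abelian_group G using 1[of "[]"] ahom_groups by auto
  let ?f = "\<lambda>(a, vs). f a vs"
  have f: "?f \<in> carrier A \<times> Vs \<rightarrow> carrier G"
    using 1 ahom_closed by fastforce
  have rels: "frag_extend G ?f r = \<zero>\<^bsub>G\<^esub>" if "r \<in> word_rels A V" for r
    using that unfolding word_rels_def
    by (auto intro!: G.frag_extend_rel3[OF f] G.frag_extend_rel2[OF f]
        simp: ahom_add[OF 1] ahom_add[OF 2] 3 4 V.rsmult_closed V.smult_closed)
  show "ahom (presented (carrier A \<times> Vs) (word_rels A V)) G (induced G ?f)"
    by (rule wpres.induced_P[OF G.abelian_group_axioms f rels])
  then show "ahom TV G (induced G ?f)"
    by (rule ahom_transfer) (simp_all add: TV_simps)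
  show "induced G ?f (wd a vs) = f a vs" if "a \<in> carrier A" "vs \<in> Vs" for a vs
    using wpres.induced_P(2)[OF G.abelian_group_axioms f rels] that by (simp add: word_def)
qed

lemma smult_TV:
  assumes b: "b \<in> carrier A"
  shows smult_TV_ahom: "ahom TV TV (\<lambda>x. b \<odot>\<^bsub>TV\<^esub> x)"
    and smult_word: "\<And>a vs. \<lbrakk>a \<in> carrier A; vs \<in> Vs\<rbrakk> \<Longrightarrow> b \<odot>\<^bsub>TV\<^esub> wd a vs = wd (b \<otimes> a) vs"
proof -
  let ?P = "presented (carrier A \<times> Vs) (word_rels A V)"
  have ahom_b: "ahom A A (\<lambda>a. b \<otimes> a)"
    by (rule ahomI) (simp_all add: b V.A.r_distr V.A.abelian_group_axioms)
  have "word_map TV (\<lambda>a vs. wd (b \<otimes> a) vs)"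
    using b by (intro word_mapI) (simp_all add: ahom_comp[OF ahom_b word_ahom_coeff] word_ahom_letter
      word_middle word_coeff V.smult_closed flip: V.A.m_assoc)
  then have "word_map ?P (\<lambda>a vs. wd (b \<otimes> a) vs)"
    unfolding word_map_def
    by (simp add: ahom_transfer[OF _ refl refl refl, where G = A and H = TV]
      ahom_transfer[OF _ refl refl refl, where G = V and H = TV] TV_simps)
  note * = induced_wpresented[OF this] induced_word[OF this]
  have eq: "(\<lambda>x. b \<odot>\<^bsub>TV\<^esub> x) = induced ?P (\<lambda>(a, vs). wd (b \<otimes> a) vs)"
    by (simp add: tensor_module_def Let_def ring.defs module.defs)
  show "ahom TV TV (\<lambda>x. b \<odot>\<^bsub>TV\<^esub> x)"
    unfolding eq by (rule ahom_transfer[OF *(1)]) (simp_all add: TV_simps)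
  show "b \<odot>\<^bsub>TV\<^esub> wd a vs = wd (b \<otimes> a) vs" if "a \<in> carrier A" "vs \<in> Vs" for a vs
    using *(2)[OF that] fun_cong[OF eq] by simp
qed

lemma left_module_TV: "left_module A TV"
proof (rule left_module.intro)
  show "ring A" "abelian_group TV" by (rule V.ring_A abelian_group_TV)+
  fix a x assume x: "x \<in> carrier TV"
  show "\<one> \<odot>\<^bsub>TV\<^esub> x = x"
    using x by (induction rule: induct_TV) (simp_all add: smult_word ahom_add[OF smult_TV_ahom])
  fix y assume [simp]: "a \<in> carrier A"
  show "a \<odot>\<^bsub>TV\<^esub> x \<in> carrier TV" using x by (simp add: ahom_closed[OF smult_TV_ahom])
  assume "y \<in> carrier TV"
  with x show "a \<odot>\<^bsub>TV\<^esub> (x \<oplus>\<^bsub>TV\<^esub> y) = a \<odot>\<^bsub>TV\<^esub> x \<oplus>\<^bsub>TV\<^esub> a \<odot>\<^bsub>TV\<^esub> y"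
    by (simp add: ahom_add[OF smult_TV_ahom])
next
  fix a b x assume [simp]: "a \<in> carrier A" "b \<in> carrier A" and x: "x \<in> carrier TV"
  show "(a \<oplus> b) \<odot>\<^bsub>TV\<^esub> x = a \<odot>\<^bsub>TV\<^esub> x \<oplus>\<^bsub>TV\<^esub> b \<odot>\<^bsub>TV\<^esub> x"
    using x by (rule TV_ahom_eqI[where G = TV, rotated 3])
      (simp_all add: ahom_plus smult_TV_ahom smult_word V.A.l_distr word_add_coeff)
  show "(a \<otimes> b) \<odot>\<^bsub>TV\<^esub> x = a \<odot>\<^bsub>TV\<^esub> (b \<odot>\<^bsub>TV\<^esub> x)"
    using x by (rule TV_ahom_eqI[where G = TV, rotated 3])
      (simp_all add: ahom_comp[OF smult_TV_ahom smult_TV_ahom] smult_TV_ahom smult_word V.A.m_assoc)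
qed

sublocale TV: left_module A TV by (rule left_module_TV)

section \<open>Tensoring with a letter on the left\<close>

abbreviation cons where "cons \<equiv> tensor_cons A V"

text \<open>The coefficient is absorbed into \<open>v\<close> from the right. The relation between
  coefficient and first letter thus becomes the relation between two adjacent letters, which is
  \<open>word_middle\<close>.\<close>

lemma word_map_cons:
  assumes v: "v \<in> carrier V"
  shows "word_map TV (\<lambda>a vs. wd \<one> ((v \<lhd>\<^bsub>V\<^esub> a) # vs))"
proof (rule word_mapI)
  have va: "v \<lhd>\<^bsub>V\<^esub> a \<in> carrier V" if "a \<in> carrier A" for a
    using v that by (simp add: V.rsmult_closed)
  show "ahom A TV (\<lambda>a. wd \<one> ((v \<lhd>\<^bsub>V\<^esub> a) # vs))" if "vs \<in> Vs" for vs
    using ahom_comp[OF V.rsmult_ahom_r[OF v] word_ahom_letter[OF V.A.one_closed lists.Nil that]] by simp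
  show "ahom V TV (\<lambda>w. wd \<one> ((v \<lhd>\<^bsub>V\<^esub> a) # xs @ w # ys))"
    if "a \<in> carrier A" "xs \<in> Vs" "ys \<in> Vs" for a xs ys
    using word_ahom_letter[of \<one> "(v \<lhd>\<^bsub>V\<^esub> a) # xs" ys] that va by simp
  show "wd \<one> ((v \<lhd>\<^bsub>V\<^esub> (a \<otimes> b)) # w # ys) = wd \<one> ((v \<lhd>\<^bsub>V\<^esub> a) # (b \<odot>\<^bsub>V\<^esub> w) # ys)"
    if "a \<in> carrier A" "b \<in> carrier A" "w \<in> carrier V" "ys \<in> Vs" for a b w ys
    using word_middle[of \<one> b "v \<lhd>\<^bsub>V\<^esub> a" w "[]" ys] that v va by (simp add: V.rsmult_assoc)
  show "wd \<one> ((v \<lhd>\<^bsub>V\<^esub> a) # xs @ (v' \<lhd>\<^bsub>V\<^esub> b) # w # ys) =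
      wd \<one> ((v \<lhd>\<^bsub>V\<^esub> a) # xs @ v' # (b \<odot>\<^bsub>V\<^esub> w) # ys)"
    if "a \<in> carrier A" "b \<in> carrier A" "v' \<in> carrier V" "w \<in> carrier V" "xs \<in> Vs" "ys \<in> Vs"
    for a b v' w xs ys
    using word_middle[of \<one> b v' w "(v \<lhd>\<^bsub>V\<^esub> a) # xs" ys] that va by simp
qed

lemma cons_ahom: "v \<in> carrier V \<Longrightarrow> ahom TV TV (cons v)"
  unfolding tensor_cons_def[abs_def] by (rule induced_TV_ahom[OF word_map_cons])

lemma cons_word:
  "\<lbrakk>v \<in> carrier V; a \<in> carrier A; vs \<in> Vs\<rbrakk> \<Longrightarrow> cons v (wd a vs) = wd \<one> ((v \<lhd>\<^bsub>V\<^esub> a) # vs)"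
  unfolding tensor_cons_def by (rule induced_word[OF word_map_cons])

lemma cons_closed: "\<lbrakk>v \<in> carrier V; x \<in> carrier TV\<rbrakk> \<Longrightarrow> cons v x \<in> carrier TV"
  by (rule ahom_closed[OF cons_ahom])

lemma cons_add: "\<lbrakk>v \<in> carrier V; w \<in> carrier V; x \<in> carrier TV\<rbrakk> \<Longrightarrow> cons (v \<oplus>\<^bsub>V\<^esub> w) x = cons v x \<oplus>\<^bsub>TV\<^esub> cons w x"
  by (rule TV_ahom_eqI[where G = TV])
    (simp_all add: cons_ahom ahom_plus cons_word V.rsmult_l_distr V.rsmult_closed word_add_head)

lemma cons_ahom_l: "x \<in> carrier TV \<Longrightarrow> ahom V TV (\<lambda>v. cons v x)"
  by (rule ahomI[OF V.abelian_group abelian_group_TV]) (simp_all add: cons_closed cons_add)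

lemma cons_smult:
  "\<lbrakk>v \<in> carrier V; a \<in> carrier A; x \<in> carrier TV\<rbrakk> \<Longrightarrow> cons v (a \<odot>\<^bsub>TV\<^esub> x) = cons (v \<lhd>\<^bsub>V\<^esub> a) x"
  by (rule TV_ahom_eqI[where G = TV])
    (simp_all add: cons_ahom ahom_comp[OF smult_TV_ahom cons_ahom] smult_word cons_word V.rsmult_closed V.rsmult_assoc)

lemma word_one: "\<lbrakk>a \<in> carrier A; v \<in> carrier V; vs \<in> Vs\<rbrakk> \<Longrightarrow> wd a (v # vs) = wd \<one> ((a \<odot>\<^bsub>V\<^esub> v) # vs)"
  using word_coeff[of \<one> a v vs] by simp

lemma cons_smult_l:
  "\<lbrakk>v \<in> carrier V; a \<in> carrier A; x \<in> carrier TV\<rbrakk> \<Longrightarrow> cons (a \<odot>\<^bsub>V\<^esub> v) x = a \<odot>\<^bsub>TV\<^esub> cons v x"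
  by (rule TV_ahom_eqI[where G = TV])
    (simp_all add: cons_ahom ahom_comp[OF cons_ahom smult_TV_ahom] smult_word cons_word V.rsmult_closed
      V.smult_rsmult V.smult_closed word_one[of a])

lemma cons_one_word: "\<lbrakk>v \<in> carrier V; vs \<in> Vs\<rbrakk> \<Longrightarrow> cons v (wd \<one> vs) = wd \<one> (v # vs)"
  by (simp add: cons_word V.rsmult_one)

text \<open>This brings a word of positive length into the form that \<open>sq_word\<close> and
  \<open>bullet_deg\<close> recurse on: one vector field, then a word with coefficient one.\<close>

lemma word_Cons: "\<lbrakk>a \<in> carrier A; v \<in> carrier V; vs \<in> Vs\<rbrakk> \<Longrightarrow> wd a (v # vs) = cons (a \<odot>\<^bsub>V\<^esub> v) (wd \<one> vs)"
  by (simp add: cons_one_word V.smult_closed word_one[of a])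

text \<open>The tensor power of order k inside the presented group. Words can be negated through
  their coefficient, so sums suffice. The predicate tracks the degree of elements that are not
  single words, such as derivatives of words.\<close>

inductive homogeneous for k where
  homogeneous_word: "\<lbrakk>a \<in> carrier A; vs \<in> Vs; length vs = k\<rbrakk> \<Longrightarrow> homogeneous k (wd a vs)"
| homogeneous_add: "\<lbrakk>homogeneous k x; homogeneous k y\<rbrakk> \<Longrightarrow> homogeneous k (x \<oplus>\<^bsub>TV\<^esub> y)"

lemma homogeneous_closed: "homogeneous k x \<Longrightarrow> x \<in> carrier TV"
  by (induction rule: homogeneous.induct) (simp_all add: word_closed)

lemma homogeneous_smult: "\<lbrakk>homogeneous k x; b \<in> carrier A\<rbrakk> \<Longrightarrow> homogeneous k (b \<odot>\<^bsub>TV\<^esub> x)"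
  by (induction rule: homogeneous.induct)
    (simp_all add: smult_word homogeneous_word TV.smult_r_distr homogeneous_closed homogeneous_add)

lemma homogeneous_cons: "\<lbrakk>homogeneous k x; v \<in> carrier V\<rbrakk> \<Longrightarrow> homogeneous (Suc k) (cons v x)"
  by (induction rule: homogeneous.induct)
    (simp_all add: cons_word homogeneous_word V.rsmult_closed ahom_add[OF cons_ahom] homogeneous_closed homogeneous_add)

end

section \<open>Forms\<close>

text \<open>Otherwise the simplifier turns \<open>forms \<Omega> 1\<close> into \<open>forms \<Omega> (Suc 0)\<close>.\<close>

declare One_nat_def [simp del]

lemma base_ring_simps [simp]:
  "carrier (base_ring \<Omega>) = grade \<Omega> 0" "mult (base_ring \<Omega>) = mult \<Omega>" "one (base_ring \<Omega>) = one \<Omega>"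
  "zero (base_ring \<Omega>) = zero \<Omega>" "add (base_ring \<Omega>) = add \<Omega>"
  by (simp_all add: base_ring_def)

lemma forms_simps [simp]:
  "carrier (forms \<Omega> k) = grade \<Omega> k" "mult (forms \<Omega> k) = mult \<Omega>" "one (forms \<Omega> k) = one \<Omega>"
  "zero (forms \<Omega> k) = zero \<Omega>" "add (forms \<Omega> k) = add \<Omega>" "smult (forms \<Omega> k) = mult \<Omega>"
  "rsmult (forms \<Omega> k) = mult \<Omega>"
  by (simp_all add: forms_def)

context dg_algebra
begin

sublocale C: module complex_ring \<Omega> by (rule complex_module)

lemma grade_subgroup: "subgroup (grade \<Omega> k) (add_monoid \<Omega>)"
  using grade_submodule[of k] by (simp add: submodule_def)

lemma grade_carrier [intro]: "x \<in> grade \<Omega> k \<Longrightarrow> x \<in> carrier \<Omega>"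
  using subgroup.subset[OF grade_subgroup] by auto

lemmas grade01_carrier = grade_carrier[of _ 0] grade_carrier[of _ 1]

lemma grade_add: "\<lbrakk>x \<in> grade \<Omega> k; y \<in> grade \<Omega> k\<rbrakk> \<Longrightarrow> x \<oplus> y \<in> grade \<Omega> k"
  using subgroup.m_closed[OF grade_subgroup] by simp

lemma grade_zero: "\<zero> \<in> grade \<Omega> k"
  using subgroup.one_closed[OF grade_subgroup] by simp

lemma grade_uminus: "x \<in> grade \<Omega> k \<Longrightarrow> \<ominus> x \<in> grade \<Omega> k"
  using subgroup.m_inv_closed[OF grade_subgroup] by (simp add: a_inv_def)

lemma grade_minus: "\<lbrakk>x \<in> grade \<Omega> k; y \<in> grade \<Omega> k\<rbrakk> \<Longrightarrow> x \<ominus> y \<in> grade \<Omega> k"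
  unfolding a_minus_def by (intro grade_add grade_uminus)

lemma grade_mult_left: "\<lbrakk>a \<in> grade \<Omega> 0; x \<in> grade \<Omega> k\<rbrakk> \<Longrightarrow> a \<otimes> x \<in> grade \<Omega> k"
  using mult_grade[of a 0 x k] by simp

lemma grade_mult_right: "\<lbrakk>x \<in> grade \<Omega> k; a \<in> grade \<Omega> 0\<rbrakk> \<Longrightarrow> x \<otimes> a \<in> grade \<Omega> k"
  using mult_grade[of x k a 0] by simp

lemma grade_mult_one_forms: "\<lbrakk>x \<in> grade \<Omega> 1; y \<in> grade \<Omega> 1\<rbrakk> \<Longrightarrow> x \<otimes> y \<in> grade \<Omega> 2"
  using mult_grade[of x 1 y 1] by simp

lemma der_grade_zero: "a \<in> grade \<Omega> 0 \<Longrightarrow> der \<Omega> a \<in> grade \<Omega> 1"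
  using der_grade[of a 0] by (simp add: One_nat_def)

lemma der_grade_one: "x \<in> grade \<Omega> 1 \<Longrightarrow> der \<Omega> x \<in> grade \<Omega> 2"
  using der_grade[of x 1] by simp

lemma der_closed: "x \<in> grade \<Omega> k \<Longrightarrow> der \<Omega> x \<in> carrier \<Omega>"
  using der_grade by blast

lemmas grade_closed = grade_add grade_zero grade_uminus grade_minus grade_mult_left grade_mult_right
  der_grade_zero der_grade_one grade_mult_one_forms

lemma scale_one: "x \<in> carrier \<Omega> \<Longrightarrow> (1::complex) \<odot> x = x"
  using C.smult_one[of x] by (simp add: complex_ring_def)

lemma scale_minus_one: "x \<in> carrier \<Omega> \<Longrightarrow> (- 1::complex) \<odot> x = \<ominus> x"
proof -
  assume x: "x \<in> carrier \<Omega>"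
  have c: "(c::complex) \<odot> x \<in> carrier \<Omega>" for c
    using C.smult_closed[of c x] x by (simp add: complex_ring_def)
  have sum: "((c::complex) + d) \<odot> x = c \<odot> x \<oplus> d \<odot> x" for c d
    using C.smult_l_distr[of c d x] x by (simp add: complex_ring_def)
  have "(0::complex) \<odot> x = \<zero>"
    using sum[of 0 0] c[of 0] by (simp add: add.r_cancel_one')
  then have "(- 1::complex) \<odot> x \<oplus> x = \<zero>"
    using sum[of "- 1" 1] scale_one[OF x] by simp
  then show ?thesis using c[of "- 1"] x minus_equality by metis
qed

lemma der_mult_zero:
  assumes "a \<in> grade \<Omega> 0" "y \<in> grade \<Omega> k"
  shows "der \<Omega> (a \<otimes> y) = der \<Omega> a \<otimes> y \<oplus> a \<otimes> der \<Omega> y"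
  using der_mult[of a 0 y] assms der_closed[of y k] grade_carrier by (simp add: scale_one)

lemma der_mult_one:
  assumes "x \<in> grade \<Omega> 1" "y \<in> grade \<Omega> k"
  shows "der \<Omega> (x \<otimes> y) = der \<Omega> x \<otimes> y \<ominus> x \<otimes> der \<Omega> y"
  using der_mult[of x 1 y] assms der_closed[of y k] grade_carrier by (simp add: scale_minus_one a_minus_def)

text \<open>The Leibniz rule for 1 = 1 1 reads d1 = d1 + d1. It is the reason why the empty word has
  derivative zero and can be the unit of the product.\<close>

lemma der_one: "der \<Omega> \<one> = \<zero>"
  using der_mult_zero[OF one_grade one_grade] der_closed[OF one_grade] by (simp add: add.r_cancel_one')

lemma ring_A: "ring A"
proof (rule ringI)
  show "abelian_group A"
  proof (rule abelian_groupI)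
    show "\<exists>y\<in>carrier A. y \<oplus>\<^bsub>A\<^esub> x = \<zero>\<^bsub>A\<^esub>" if "x \<in> carrier A" for x
      using that l_neg[OF grade_carrier, of x 0] by (auto intro!: bexI[of _ "\<ominus> x"] grade_uminus)
  qed (auto simp: grade_closed a_ac grade_carrier)
  show "Group.monoid A"
    by (rule monoidI) (auto simp: grade_closed m_assoc grade_carrier one_grade)
qed (auto simp: grade_carrier l_distr r_distr)

lemma abelian_group_forms: "abelian_group (forms \<Omega> k)"
proof (rule abelian_groupI)
  show "\<exists>y\<in>carrier (forms \<Omega> k). y \<oplus>\<^bsub>forms \<Omega> k\<^esub> x = \<zero>\<^bsub>forms \<Omega> k\<^esub>" if "x \<in> carrier (forms \<Omega> k)" for x
    using that l_neg[OF grade_carrier, of x k] by (auto intro!: bexI[of _ "\<ominus> x"] grade_uminus)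
qed (auto simp: grade_closed a_ac grade_carrier)

lemma bimod_forms: "bimod A (forms \<Omega> k)"
  by (intro bimod.intro left_module.intro right_module.intro bimod_axioms.intro ring_A abelian_group_forms)
    (auto simp: grade_closed l_distr r_distr m_assoc grade_carrier)

sublocale O1: bimod A Omega1 by (rule bimod_forms)
sublocale O2: bimod A Omega2 by (rule bimod_forms)
sublocale V: bimod A Vec by (rule O1.bimod_dual)

text \<open>Negation in a record is defined by a description over its carrier, so the negation of
  \<open>forms \<Omega> k\<close> has to be identified with that of \<open>\<Omega>\<close>.\<close>

lemma forms_a_inv:
  assumes "x \<in> grade \<Omega> k" shows "\<ominus>\<^bsub>forms \<Omega> k\<^esub> x = \<ominus> x"
proof -
  interpret O: abelian_group "forms \<Omega> k" by (rule abelian_group_forms)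
  show ?thesis using assms grade_uminus[OF assms] O.minus_equality[of "\<ominus> x" x] l_neg by (simp add: grade_carrier)
qed

lemma forms_minus: "\<lbrakk>x \<in> grade \<Omega> k; y \<in> grade \<Omega> k\<rbrakk> \<Longrightarrow> x \<ominus>\<^bsub>forms \<Omega> k\<^esub> y = x \<ominus> y"
  by (simp add: a_minus_def forms_a_inv)

lemma forms_finsum:
  assumes "f \<in> I \<rightarrow> grade \<Omega> k" shows "finsum (forms \<Omega> k) f I = finsum \<Omega> f I"
proof -
  interpret O: abelian_group "forms \<Omega> k" by (rule abelian_group_forms)
  show ?thesis using assms
  proof (induction I rule: infinite_finite_induct)
    case (insert i I)
    then have "f \<in> I \<rightarrow> carrier \<Omega>" "f i \<in> carrier \<Omega>" by (auto intro: grade_carrier)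
    with insert show ?case by (simp add: Pi_iff)
  qed auto
qed

lemma der_ahom: "ahom (forms \<Omega> k) (forms \<Omega> (Suc k)) (der \<Omega>)"
  by (rule ahomI[OF abelian_group_forms abelian_group_forms])
    (auto simp: der_grade der_add grade_carrier)

lemma der_ahom_A: "ahom A Omega1 (der \<Omega>)"
  by (rule ahomI[OF O1.A.abelian_group_axioms abelian_group_forms])
    (auto simp: der_grade_zero der_add grade_carrier)

end

section \<open>The dual connection\<close>

context right_bimodule_connection
begin

declare in_lists_conv_set [simp del] in_listsD [rule del] in_listsI [rule del]

abbreviation add_T (infixl "\<oplus>\<^sub>T" 65) where "x \<oplus>\<^sub>T y \<equiv> x \<oplus>\<^bsub>TVec\<^esub> y"
abbreviation minus_T (infixl "\<ominus>\<^sub>T" 65) where "x \<ominus>\<^sub>T y \<equiv> x \<ominus>\<^bsub>TVec\<^esub> y"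
abbreviation smult_T (infixl "\<odot>\<^sub>T" 70) where "a \<odot>\<^sub>T x \<equiv> a \<odot>\<^bsub>TVec\<^esub> x"
abbreviation add_V (infixl "\<oplus>\<^sub>V" 65) where "v \<oplus>\<^sub>V w \<equiv> v \<oplus>\<^bsub>Vec\<^esub> w"
abbreviation smult_V (infixl "\<odot>\<^sub>V" 70) where "a \<odot>\<^sub>V v \<equiv> a \<odot>\<^bsub>Vec\<^esub> v"
abbreviation rsmult_V (infixl "\<lhd>\<^sub>V" 70) where "v \<lhd>\<^sub>V a \<equiv> v \<lhd>\<^bsub>Vec\<^esub> a"

sublocale OO: tensor_product_bimod A Omega1 Omega1
  by (intro tensor_product_bimod.intro tensor_product.intro bimod_forms
      bimod.axioms(1,2)[OF bimod_forms])

sublocale OV: tensor_product_bimod A Omega1 Vec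
  by (intro tensor_product_bimod.intro tensor_product.intro bimod_forms O1.bimod_dual
      bimod.axioms(1,2)[OF O1.bimod_dual])

sublocale T: tensor_words A Vec
  rewrites "tensor_module A Vec = TVec"
  by (intro tensor_words.intro O1.bimod_dual) (simp add: TVec_def)

sublocale OT: tensor_product A Omega1 TVec
  by (intro tensor_product.intro bimod_forms T.left_module_TV)

abbreviation contract1 where "contract1 \<equiv> contract Omega1"

lemma vec_closed: "\<lbrakk>v \<in> carrier Vec; x \<in> grade \<Omega> 1\<rbrakk> \<Longrightarrow> v x \<in> grade \<Omega> 0"
  using O1.dual_closed by simp

lemma vec_mult: "\<lbrakk>v \<in> carrier Vec; x \<in> grade \<Omega> 1; a \<in> grade \<Omega> 0\<rbrakk> \<Longrightarrow> v (x \<otimes> a) = v x \<otimes> a"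
  using O1.dual_rsmult[of v x a] by simp

lemma vec_apply:
  assumes "x \<in> grade \<Omega> 1"
  shows "(v \<oplus>\<^sub>V w) x = v x \<oplus> w x" "(a \<odot>\<^sub>V v) x = a \<otimes> v x" "(v \<lhd>\<^sub>V a) x = v (a \<otimes> x)"
  using O1.dual_apply[of x] assms by simp_all

lemma xi_grade: "i < n \<Longrightarrow> \<xi> i \<in> grade \<Omega> 1"
  using xi_form by simp

lemma dual_basis_forms: "x \<in> carrier Omega1 \<Longrightarrow> x = (\<Oplus>\<^bsub>Omega1\<^esub>i\<in>{..<n}. \<xi> i \<otimes> u i x)"
  using dual_basis[of x] by (subst forms_finsum) (auto simp: grade_closed vec_closed xi_grade u_Vec)

text \<open>Apply \<open>v\<close> to the dual basis expansion of a one-form and use right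
  linearity. So the \<open>u i\<close> generate the vector fields from the left.\<close>

lemma dual_basis_Vec:
  assumes v: "v \<in> carrier Vec"
  shows "v = (\<Oplus>\<^bsub>Vec\<^esub>i\<in>{..<n}. v (\<xi> i) \<odot>\<^sub>V u i)"
proof (rule dual_eqI[of _ A Omega1])
  have cl: "(\<lambda>i. v (\<xi> i) \<odot>\<^sub>V u i) \<in> {..<n} \<rightarrow> carrier Vec"
    using v by (auto simp: V.smult_closed vec_closed xi_grade u_Vec)
  then show "(\<Oplus>\<^bsub>Vec\<^esub>i\<in>{..<n}. v (\<xi> i) \<odot>\<^sub>V u i) \<in> carrier Vec"
    by (rule V.finsum_closed)
  fix x assume x: "x \<in> carrier Omega1"
  then have x': "x \<in> grade \<Omega> 1" by simp
  have "v x = v (\<Oplus>\<^bsub>Omega1\<^esub>i\<in>{..<n}. \<xi> i \<otimes> u i x)"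
    using dual_basis_forms[OF x] by simp
  also have "\<dots> = (\<Oplus>\<^bsub>A\<^esub>i\<in>{..<n}. v (\<xi> i \<otimes> u i x))"
    using x' by (intro ahom_finsum[OF O1.dual_ahom[OF v]]) (auto simp: grade_closed vec_closed xi_grade u_Vec)
  also have "\<dots> = (\<Oplus>\<^bsub>A\<^esub>i\<in>{..<n}. (v (\<xi> i) \<odot>\<^sub>V u i) x)"
    using x' v by (intro O1.A.finsum_cong')
      (auto simp: vec_apply vec_mult vec_closed xi_grade u_Vec grade_closed)
  also have "\<dots> = (\<Oplus>\<^bsub>Vec\<^esub>i\<in>{..<n}. v (\<xi> i) \<odot>\<^sub>V u i) x"
    by (rule ahom_finsum[OF O1.dual_apply_ahom[OF x] cl, symmetric])
  finally show "v x = (\<Oplus>\<^bsub>Vec\<^esub>i\<in>{..<n}. v (\<xi> i) \<odot>\<^sub>V u i) x" .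
qed (rule v)

lemma contract1_closed: "\<lbrakk>v \<in> carrier Vec; X \<in> carrier OO.MN\<rbrakk> \<Longrightarrow> contract1 v X \<in> grade \<Omega> 1"
  using OO.contract_closed[of v X] by simp

lemma contract1_rsmult: "\<lbrakk>a \<in> grade \<Omega> 0; v \<in> carrier Vec; X \<in> carrier OO.MN\<rbrakk> \<Longrightarrow> contract1 v (OO.rs X a) = contract1 v X \<otimes> a"
  using OO.contract_rsmult[of a v X] by simp

lemma contract1_add: "\<lbrakk>v \<in> carrier Vec; X \<in> carrier OO.MN; Y \<in> carrier OO.MN\<rbrakk> \<Longrightarrow>
    contract1 v (X \<oplus>\<^bsub>OO.MN\<^esub> Y) = contract1 v X \<oplus> contract1 v Y"
  using ahom_add[OF OO.contract_ahom] by simp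

lemma contract1_pure: "\<lbrakk>v \<in> carrier Vec; x \<in> grade \<Omega> 1; y \<in> grade \<Omega> 1\<rbrakk> \<Longrightarrow> contract1 v (OO.pt x y) = v x \<otimes> y"
  using OO.contract_pure by simp

section \<open>Elements of \<open>\<Omega>\<^sup>1 \<otimes>\<^sub>A Vec\<close> as endomorphisms of
  the one-forms\<close>

definition right_linear where
  "right_linear H \<longleftrightarrow> ahom Omega1 Omega1 H \<and>
     (\<forall>x\<in>grade \<Omega> 1. \<forall>a\<in>grade \<Omega> 0. H (x \<otimes> a) = H x \<otimes> a)"

lemma right_linear_closed: "\<lbrakk>right_linear H; x \<in> grade \<Omega> 1\<rbrakk> \<Longrightarrow> H x \<in> grade \<Omega> 1"
  unfolding right_linear_def using ahom_closed[of Omega1 Omega1 H x] by simp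

text \<open>\<open>ev_at x X\<close> is \<open>(id \<otimes> ev)(X \<otimes> x)\<close>. By the dual basis, \<open>\<Omega>\<^sup>1 \<otimes>\<^sub>A Vec A\<close> is isomorphic to
  \<open>Hom\<^sub>A(\<Omega>\<^sup>1, \<Omega>\<^sup>1)\<close>, so that identities in it can be checked after evaluation.\<close>

definition ev_at where
  "ev_at x X = induced Omega1 (\<lambda>(y, w). y \<otimes> w x) X"

lemma mult_ahom_r: "y \<in> grade \<Omega> 1 \<Longrightarrow> ahom A Omega1 (\<lambda>a. y \<otimes> a)"
  using O1.rsmult_ahom_r[of y] by simp

lemma mult_ahom_l: "a \<in> grade \<Omega> 0 \<Longrightarrow> ahom Omega1 Omega1 (\<lambda>y. y \<otimes> a)"
  using O1.rsmult_ahom_l[of a] by simp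

lemma ev_at_balanced: "x \<in> grade \<Omega> 1 \<Longrightarrow> OV.balanced Omega1 (\<lambda>y w. y \<otimes> w x)"
  by (rule OV.balancedI)
    (simp_all add: ahom_comp[OF O1.dual_apply_ahom mult_ahom_r] mult_ahom_l vec_closed vec_apply
     m_assoc grade01_carrier)

lemma ev_at_ahom: "x \<in> grade \<Omega> 1 \<Longrightarrow> ahom OV.MN Omega1 (ev_at x)"
  unfolding ev_at_def[abs_def] by (rule OV.induced_ahom[OF ev_at_balanced])

lemma ev_at_pure: "\<lbrakk>x \<in> grade \<Omega> 1; y \<in> grade \<Omega> 1; w \<in> carrier Vec\<rbrakk> \<Longrightarrow> ev_at x (OV.pt y w) = y \<otimes> w x"
  unfolding ev_at_def by (rule OV.induced_pure[OF ev_at_balanced]) simp_all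

lemma ev_at_closed: "\<lbrakk>x \<in> grade \<Omega> 1; X \<in> carrier OV.MN\<rbrakk> \<Longrightarrow> ev_at x X \<in> grade \<Omega> 1"
  using ahom_closed[OF ev_at_ahom] by simp

lemma ev_at_add: "\<lbrakk>x \<in> grade \<Omega> 1; X \<in> carrier OV.MN; Y \<in> carrier OV.MN\<rbrakk> \<Longrightarrow>
    ev_at x (X \<oplus>\<^bsub>OV.MN\<^esub> Y) = ev_at x X \<oplus> ev_at x Y"
  using ahom_add[OF ev_at_ahom] by simp

lemma ev_at_rsmult:
  assumes "x \<in> grade \<Omega> 1" "X \<in> carrier OV.MN" "a \<in> grade \<Omega> 0"
  shows "ev_at x (OV.rs X a) = ev_at (a \<otimes> x) X"
  by (rule OV.ahom_eqI[where G = Omega1 and X = X])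
    (use assms in \<open>simp_all add: ahom_comp[OF OV.rsmult_MN_ahom ev_at_ahom] ev_at_ahom grade_closed
     ev_at_pure OV.rsmult_pure V.rsmult_closed vec_apply\<close>)

lemma ev_at_smult:
  assumes "x \<in> grade \<Omega> 1" "X \<in> carrier OV.MN" "a \<in> grade \<Omega> 0"
  shows "ev_at x (a \<odot>\<^bsub>OV.MN\<^esub> X) = a \<otimes> ev_at x X"
proof (rule OV.ahom_eqI[where G = Omega1 and X = X])
  show "ahom OV.MN Omega1 (\<lambda>X. a \<otimes> ev_at x X)"
    using ahom_comp[OF ev_at_ahom[OF assms(1)] O1.smult_ahom_r[of a]] assms by simp
qed (use assms in \<open>simp_all add: ahom_comp[OF OV.smult_MN_ahom ev_at_ahom] ev_at_pure OV.smult_pure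
    grade_closed vec_closed m_assoc grade01_carrier\<close>)

text \<open>The tensor of an endomorphism, \<open>(H \<otimes> id)(coev(1))\<close>, which inverts
  the evaluation \<open>ev_at\<close>.\<close>

definition Phi where
  "Phi H = (\<Oplus>\<^bsub>OV.MN\<^esub>i\<in>{..<n}. OV.pt (H (\<xi> i)) (u i))"

lemma Phi_closed: "(\<And>x. x \<in> grade \<Omega> 1 \<Longrightarrow> H x \<in> grade \<Omega> 1) \<Longrightarrow> Phi H \<in> carrier OV.MN"
  unfolding Phi_def by (intro OV.MN.finsum_closed) (auto simp: OV.pure_closed xi_grade u_Vec)

text \<open>Right linearity moves \<open>u i x\<close> inside \<open>H\<close>, where the dual basis
  expansion of \<open>x\<close> collapses the sum.\<close>

lemma ev_at_Phi:
  assumes H: "right_linear H" and x: "x \<in> grade \<Omega> 1"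
  shows "ev_at x (Phi H) = H x"
proof -
  have H': "ahom Omega1 Omega1 H" and Hm: "\<And>x a. \<lbrakk>x \<in> grade \<Omega> 1; a \<in> grade \<Omega> 0\<rbrakk> \<Longrightarrow> H (x \<otimes> a) = H x \<otimes> a"
    using H by (auto simp: right_linear_def)
  have Hc: "x \<in> grade \<Omega> 1 \<Longrightarrow> H x \<in> grade \<Omega> 1" for x using right_linear_closed[OF H] .
  have "ev_at x (Phi H) = (\<Oplus>\<^bsub>Omega1\<^esub>i\<in>{..<n}. ev_at x (OV.pt (H (\<xi> i)) (u i)))"
    unfolding Phi_def
    by (rule ahom_finsum[OF ev_at_ahom[OF x]]) (auto simp: OV.pure_closed xi_grade u_Vec Hc)
  also have "\<dots> = (\<Oplus>\<^bsub>Omega1\<^esub>i\<in>{..<n}. H (\<xi> i \<otimes> u i x))"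
    using x by (intro O1.finsum_cong')
      (auto simp: ev_at_pure Hc xi_grade u_Vec Hm vec_closed grade_closed)
  also have "\<dots> = H (\<Oplus>\<^bsub>Omega1\<^esub>i\<in>{..<n}. \<xi> i \<otimes> u i x)"
    using x by (intro ahom_finsum[OF H', symmetric]) (auto simp: grade_closed vec_closed xi_grade u_Vec)
  also have "\<dots> = H x" using dual_basis_forms[of x] x by simp
  finally show ?thesis .
qed

text \<open>For a pure tensor of y and w, the coefficient \<open>w (\<xi> i)\<close> moves across
  the tensor sign and \<open>dual_basis_Vec\<close> collapses the sum to w. An element is thus
  determined by its evaluations.\<close>

lemma Phi_ev_at:
  assumes "X \<in> carrier OV.MN"
  shows "X = Phi (\<lambda>x. ev_at x X)"
proof (rule OV.ahom_eqI[where G = OV.MN and f = "\<lambda>X. X" and g = "\<lambda>X. Phi (\<lambda>x. ev_at x X)", OF _ _ _ assms])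
  show "ahom OV.MN OV.MN (\<lambda>X. X)"
    by (rule ahomI) (simp_all add: OV.abelian_group_MN)
  show "ahom OV.MN OV.MN (\<lambda>X. Phi (\<lambda>x. ev_at x X))"
    unfolding Phi_def
    by (intro ahom_sum OV.abelian_group_MN ahom_comp[OF ev_at_ahom OV.pure_ahom_l]) (simp_all add: xi_grade u_Vec)
  fix y w assume y: "y \<in> carrier Omega1" and w: "w \<in> carrier Vec"
  have "OV.pt y w = OV.pt y (\<Oplus>\<^bsub>Vec\<^esub>i\<in>{..<n}. w (\<xi> i) \<odot>\<^sub>V u i)"
    using dual_basis_Vec[OF w] by simp
  also have "\<dots> = (\<Oplus>\<^bsub>OV.MN\<^esub>i\<in>{..<n}. OV.pt y (w (\<xi> i) \<odot>\<^sub>V u i))"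
    using w y by (intro ahom_finsum[OF OV.pure_ahom_r]) (auto simp: V.smult_closed vec_closed xi_grade u_Vec)
  also have "\<dots> = Phi (\<lambda>x. ev_at x (OV.pt y w))"
    unfolding Phi_def using w y OV.pure_balanced[of y]
    by (intro OV.MN.finsum_cong')
      (auto simp: ev_at_pure xi_grade u_Vec vec_closed OV.pure_closed grade_closed)
  finally show "OV.pt y w = Phi (\<lambda>x. ev_at x (OV.pt y w))" .
qed

lemma OV_eqI:
  assumes "X \<in> carrier OV.MN" "Y \<in> carrier OV.MN" "\<And>x. x \<in> grade \<Omega> 1 \<Longrightarrow> ev_at x X = ev_at x Y"
  shows "X = Y"
proof -
  have "Phi (\<lambda>x. ev_at x X) = Phi (\<lambda>x. ev_at x Y)"
    unfolding Phi_def using assms by (intro OV.MN.finsum_cong')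
      (auto simp: xi_grade intro!: OV.pure_closed ev_at_closed u_Vec)
  then show ?thesis using Phi_ev_at[OF assms(1)] Phi_ev_at[OF assms(2)] by simp
qed

section \<open>The dual covariant derivative on vector fields\<close>

lemma sq_ahom: "ahom Omega1 OO.MN sq"
  using sq_closed sq_add by (intro ahomI O1.abelian_group OO.abelian_group_MN) auto

lemma sinv_ahom: "ahom OO.MN OO.MN sinv"
  using sinv_closed sinv_add by (intro ahomI OO.abelian_group_MN) auto

lemma sq_mem: "x \<in> grade \<Omega> 1 \<Longrightarrow> sq x \<in> carrier OO.MN"
  using sq_closed by auto

lemma sinv_mem: "X \<in> carrier OO.MN \<Longrightarrow> sinv X \<in> carrier OO.MN"
  using sinv_closed by auto

text \<open>The defining equation of the dual derivative, solved for the evaluation of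
  \<open>sq_Vec v\<close> at \<open>x\<close>.\<close>

definition sq_dual where "sq_dual v x = der \<Omega> (v x) \<ominus> contract1 v (sq x)"

lemma sq_dual_closed: "\<lbrakk>v \<in> carrier Vec; x \<in> grade \<Omega> 1\<rbrakk> \<Longrightarrow> sq_dual v x \<in> grade \<Omega> 1"
  unfolding sq_dual_def by (intro grade_minus der_grade_zero vec_closed contract1_closed sq_mem)

lemma minus_cancel_right: "\<lbrakk>x \<in> carrier \<Omega>; y \<in> carrier \<Omega>; z \<in> carrier \<Omega>\<rbrakk> \<Longrightarrow> (x \<oplus> z) \<ominus> (y \<oplus> z) = x \<ominus> y"
proof -
  assume c: "x \<in> carrier \<Omega>" "y \<in> carrier \<Omega>" "z \<in> carrier \<Omega>"
  then have "(x \<oplus> z) \<ominus> (y \<oplus> z) = x \<oplus> (z \<oplus> (\<ominus> z \<oplus> \<ominus> y))"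
    by (simp add: a_minus_def minus_add a_assoc a_comm[of "\<ominus> y"])
  also have "\<dots> = x \<ominus> y" using c by (simp add: a_minus_def r_neg2)
  finally show ?thesis .
qed

text \<open>Both d(v(xa)) and the contraction of \<open>sq (x \<otimes> a)\<close> contain the term
  v(x) da. It cancels in the difference, which is therefore right linear and so the evaluation of a
  tensor.\<close>

lemma sq_dual_right_linear:
  assumes v: "v \<in> carrier Vec" shows "right_linear (sq_dual v)"
  unfolding right_linear_def
proof (intro conjI ballI)
  have "ahom Omega1 Omega1 (\<lambda>x. der \<Omega> (v x) \<ominus>\<^bsub>Omega1\<^esub> contract1 v (sq x))"
    using v by (intro ahom_diff ahom_comp[OF O1.dual_ahom der_ahom_A] ahom_comp[OF sq_ahom OO.contract_ahom])
  then show "ahom Omega1 Omega1 (sq_dual v)"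
    by (rule ahom_cong) (simp add: sq_dual_def forms_minus v der_grade_zero vec_closed contract1_closed sq_mem)
  fix x a assume x: "x \<in> grade \<Omega> 1" and a: "a \<in> grade \<Omega> 0"
  note cl = grade_closed vec_closed[OF v x] contract1_closed[OF v sq_mem[OF x]] x a
  have "sq_dual v (x \<otimes> a) = (der \<Omega> (v x) \<otimes> a \<oplus> v x \<otimes> der \<Omega> a) \<ominus> (contract1 v (sq x) \<otimes> a \<oplus> v x \<otimes> der \<Omega> a)"
    using x a v OO.rsmult_MN_ahom[of a] ahom_closed[OF OO.rsmult_MN_ahom[of a]]
    by (simp add: sq_dual_def vec_mult der_mult_zero[OF _ a] vec_closed sq_right contract1_add contract1_rsmult contract1_pure
      sq_mem grade_closed OO.pure_closed)
  also have "\<dots> = der \<Omega> (v x) \<otimes> a \<ominus> contract1 v (sq x) \<otimes> a"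
    by (intro minus_cancel_right) (simp_all add: grade_carrier[of _ 1] cl)
  also have "\<dots> = sq_dual v x \<otimes> a"
    unfolding sq_dual_def using cl
    by (simp add: a_minus_def l_distr l_minus grade01_carrier)
  finally show "sq_dual v (x \<otimes> a) = sq_dual v x \<otimes> a" .
qed

text \<open>The description in \<open>sq_Vec\<close> has a solution by \<open>ev_at_Phi\<close> and
  at most one by \<open>OV_eqI\<close>.\<close>

lemma sq_Vec_eq:
  assumes v: "v \<in> carrier Vec" shows "sq_Vec v = Phi (sq_dual v)"
proof -
  have split: "der \<Omega> (v x) = e \<oplus> contract1 v (sq x) \<longleftrightarrow> e = sq_dual v x" if "x \<in> grade \<Omega> 1" "e \<in> grade \<Omega> 1" for x e
  proof -
    have "contract1 v (sq x) \<in> carrier \<Omega>" "der \<Omega> (v x) \<in> carrier \<Omega>" "e \<in> carrier \<Omega>"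
      using that v by (simp_all add: grade_carrier[of _ 1] contract1_closed sq_mem der_grade_zero vec_closed)
    then show ?thesis
      unfolding sq_dual_def a_minus_def by (metis add.m_closed add.inv_closed a_assoc r_neg l_neg r_zero)
  qed
  have P: "X \<in> carrier OV.MN \<and> (\<forall>x\<in>carrier Omega1.
        der \<Omega> (v x) = induced Omega1 (\<lambda>(y, w). y \<otimes> w x) X \<oplus> contract1 v (sq x)) \<longleftrightarrow>
      X \<in> carrier OV.MN \<and> (\<forall>x\<in>grade \<Omega> 1. ev_at x X = sq_dual v x)" for X
    using split ev_at_closed by (auto simp flip: ev_at_def)
  show ?thesis
    unfolding sq_Vec_def P
  proof (rule the_equality)
    show *: "Phi (sq_dual v) \<in> carrier OV.MN \<and> (\<forall>x\<in>grade \<Omega> 1. ev_at x (Phi (sq_dual v)) = sq_dual v x)"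
      using ev_at_Phi[OF sq_dual_right_linear[OF v]] by (auto intro: Phi_closed sq_dual_closed v)
    show "X = Phi (sq_dual v)"
      if "X \<in> carrier OV.MN \<and> (\<forall>x\<in>grade \<Omega> 1. ev_at x X = sq_dual v x)" for X
      using that * by (intro OV_eqI) auto
  qed
qed

lemma sq_Vec_closed: "v \<in> carrier Vec \<Longrightarrow> sq_Vec v \<in> carrier OV.MN"
  by (simp add: sq_Vec_eq Phi_closed sq_dual_closed)

lemma ev_at_sq_Vec: "\<lbrakk>v \<in> carrier Vec; x \<in> grade \<Omega> 1\<rbrakk> \<Longrightarrow> ev_at x (sq_Vec v) = sq_dual v x"
  by (simp add: sq_Vec_eq ev_at_Phi sq_dual_right_linear)

text \<open>The sum defining \<open>sigma v x\<close> is the tensor of an endomorphism, so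
  identities for \<open>sigma\<close> can be checked by evaluation as well.\<close>

lemma sigma_Phi: "sigma v x = Phi (\<lambda>y. contract1 v (sinv (OO.pt x y)))"
  by (simp add: sigma_def Phi_def)

lemma sigma_right_linear:
  assumes v: "v \<in> carrier Vec" and x: "x \<in> grade \<Omega> 1"
  shows "right_linear (\<lambda>y. contract1 v (sinv (OO.pt x y)))"
  unfolding right_linear_def
proof (intro conjI ballI)
  show "ahom Omega1 Omega1 (\<lambda>y. contract1 v (sinv (OO.pt x y)))"
    using x v by (intro ahom_comp[OF OO.pure_ahom_r ahom_comp[OF sinv_ahom OO.contract_ahom]]) auto
  fix y a assume y: "y \<in> grade \<Omega> 1" and a: "a \<in> grade \<Omega> 0"
  have "OO.pt x (y \<otimes> a) = OO.rs (OO.pt x y) a" using OO.rsmult_pure[of a x y] x y a by simp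
  then show "contract1 v (sinv (OO.pt x (y \<otimes> a))) = contract1 v (sinv (OO.pt x y)) \<otimes> a"
    using sinv_right[of a "OO.pt x y"] x y a v
    by (simp add: OO.pure_closed contract1_rsmult sinv_mem)
qed

lemma sigma_closed: "\<lbrakk>v \<in> carrier Vec; x \<in> grade \<Omega> 1\<rbrakk> \<Longrightarrow> sigma v x \<in> carrier OV.MN"
  unfolding sigma_Phi by (rule Phi_closed) (simp add: contract1_closed sinv_mem OO.pure_closed)

lemma ev_at_sigma:
  "\<lbrakk>v \<in> carrier Vec; x \<in> grade \<Omega> 1; y \<in> grade \<Omega> 1\<rbrakk> \<Longrightarrow> ev_at y (sigma v x) = contract1 v (sinv (OO.pt x y))"
  unfolding sigma_Phi by (rule ev_at_Phi[OF sigma_right_linear])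

lemma sq_Vec_add:
  assumes "v \<in> carrier Vec" "w \<in> carrier Vec"
  shows "sq_Vec (v \<oplus>\<^sub>V w) = sq_Vec v \<oplus>\<^bsub>OV.MN\<^esub> sq_Vec w"
proof (rule OV_eqI)
  fix x assume x: "x \<in> grade \<Omega> 1"
  have cl: "der \<Omega> (v x) \<in> carrier \<Omega>" "der \<Omega> (w x) \<in> carrier \<Omega>" "contract1 v (sq x) \<in> carrier \<Omega>" "contract1 w (sq x) \<in> carrier \<Omega>"
    using assms x by (simp_all add: grade_carrier[of _ 1] der_grade_zero vec_closed contract1_closed sq_mem)
  have "contract1 (v \<oplus>\<^sub>V w) (sq x) = contract1 v (sq x) \<oplus> contract1 w (sq x)"
    using OO.contract_add[of v w "sq x"] assms x sq_mem by simp
  then show "ev_at x (sq_Vec (v \<oplus>\<^sub>V w)) = ev_at x (sq_Vec v \<oplus>\<^bsub>OV.MN\<^esub> sq_Vec w)"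
    using assms x cl by (simp add: ev_at_add ev_at_sq_Vec sq_Vec_closed sq_dual_def vec_apply der_add
      vec_closed grade_carrier[of _ 0] a_minus_def minus_add a_ac)
qed (use assms in \<open>simp_all add: sq_Vec_closed\<close>)

lemma sq_Vec_ahom: "ahom Vec OV.MN sq_Vec"
  by (rule ahomI[OF V.abelian_group OV.abelian_group_MN]) (simp_all add: sq_Vec_closed sq_Vec_add)

lemma sq_Vec_smult:
  assumes v: "v \<in> carrier Vec" and a: "a \<in> grade \<Omega> 0"
  shows "sq_Vec (a \<odot>\<^sub>V v) = OV.pt (der \<Omega> a) v \<oplus>\<^bsub>OV.MN\<^esub> a \<odot>\<^bsub>OV.MN\<^esub> sq_Vec v"
proof (rule OV_eqI)
  have s: "a \<odot>\<^bsub>OV.MN\<^esub> sq_Vec v \<in> carrier OV.MN"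
    using v a ahom_closed[OF OV.smult_MN_ahom[of a]] sq_Vec_closed by simp
  have av: "a \<odot>\<^sub>V v \<in> carrier Vec" using v a by (simp add: V.smult_closed)
  show "sq_Vec (a \<odot>\<^sub>V v) \<in> carrier OV.MN" using av by (rule sq_Vec_closed)
  show "OV.pt (der \<Omega> a) v \<oplus>\<^bsub>OV.MN\<^esub> a \<odot>\<^bsub>OV.MN\<^esub> sq_Vec v \<in> carrier OV.MN"
    using s v a by (simp add: OV.pure_closed der_grade_zero)
  fix x assume x: "x \<in> grade \<Omega> 1"
  have cl: "der \<Omega> a \<in> carrier \<Omega>" "v x \<in> carrier \<Omega>" "a \<in> carrier \<Omega>" "contract1 v (sq x) \<in> carrier \<Omega>" "der \<Omega> (v x) \<in> carrier \<Omega>"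
    using v x a by (simp_all add: grade01_carrier der_grade_zero vec_closed contract1_closed sq_mem)
  have "contract1 (a \<odot>\<^sub>V v) (sq x) = a \<otimes> contract1 v (sq x)"
    using OO.contract_smult_dual[of a v "sq x"] v x a sq_mem by simp
  then have "ev_at x (sq_Vec (a \<odot>\<^sub>V v)) = der \<Omega> a \<otimes> v x \<oplus> a \<otimes> (der \<Omega> (v x) \<ominus> contract1 v (sq x))"
    using cl x a v av der_mult_zero[OF a, of "v x" 0]
    by (simp add: ev_at_sq_Vec sq_dual_def vec_apply vec_closed a_minus_def r_distr r_minus a_assoc)
  also have "\<dots> = ev_at x (OV.pt (der \<Omega> a) v \<oplus>\<^bsub>OV.MN\<^esub> a \<odot>\<^bsub>OV.MN\<^esub> sq_Vec v)"
    using x a v s by (simp add: ev_at_add ev_at_pure ev_at_smult ev_at_sq_Vec sq_Vec_closed OV.pure_closed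
      der_grade_zero sq_dual_def)
  finally show "ev_at x (sq_Vec (a \<odot>\<^sub>V v)) = ev_at x (OV.pt (der \<Omega> a) v \<oplus>\<^bsub>OV.MN\<^esub> a \<odot>\<^bsub>OV.MN\<^esub> sq_Vec v)" .
qed

text \<open>Evaluating v.a at x means evaluating v at ax, so the left Leibniz rule of
  \<open>sq\<close> applies. Its \<open>sinv\<close> term, contracted with v, is by construction the
  evaluation of \<open>sigma v (der \<Omega> a)\<close> at x.\<close>

lemma sq_Vec_rsmult:
  assumes v: "v \<in> carrier Vec" and a: "a \<in> grade \<Omega> 0"
  shows "sq_Vec (v \<lhd>\<^sub>V a) = OV.rs (sq_Vec v) a \<oplus>\<^bsub>OV.MN\<^esub> sigma v (der \<Omega> a)"
proof (rule OV_eqI)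
  have s: "OV.rs (sq_Vec v) a \<in> carrier OV.MN"
    using v a ahom_closed[OF OV.rsmult_MN_ahom[of a]] sq_Vec_closed by simp
  have va: "v \<lhd>\<^sub>V a \<in> carrier Vec" using v a by (simp add: V.rsmult_closed)
  have sg: "sigma v (der \<Omega> a) \<in> carrier OV.MN" using v a by (simp add: sigma_closed der_grade_zero)
  show "sq_Vec (v \<lhd>\<^sub>V a) \<in> carrier OV.MN" using va by (rule sq_Vec_closed)
  show "OV.rs (sq_Vec v) a \<oplus>\<^bsub>OV.MN\<^esub> sigma v (der \<Omega> a) \<in> carrier OV.MN"
    using s sg by simp
  fix x assume x: "x \<in> grade \<Omega> 1"
  have ax: "a \<otimes> x \<in> grade \<Omega> 1" using a x by (rule grade_mult_left)
  let ?p = "OO.pt (der \<Omega> a) x" and ?s = "a \<odot>\<^bsub>OO.MN\<^esub> sq x"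
  have p: "?p \<in> carrier OO.MN" using a x by (simp add: OO.pure_closed der_grade_zero)
  have sc: "?s \<in> carrier OO.MN" using a x sq_mem ahom_closed[OF OO.smult_MN_ahom[of a]] by simp
  have cl: "der \<Omega> (v (a \<otimes> x)) \<in> carrier \<Omega>" "contract1 v ?s \<in> carrier \<Omega>" "contract1 v (sinv ?p) \<in> carrier \<Omega>"
    using v ax p sc by (simp_all add: grade_carrier[of _ 1] der_grade_zero vec_closed contract1_closed sinv_mem)
  have "contract1 v (sq (a \<otimes> x)) = contract1 v ?s \<oplus> contract1 v (sinv ?p)"
    using v a x p sc sq_left[of x a] by (simp add: contract1_add sinv_mem)
  then have "sq_dual v (a \<otimes> x) \<oplus> contract1 v (sinv ?p) = der \<Omega> (v (a \<otimes> x)) \<ominus> contract1 v ?s"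
    unfolding sq_dual_def a_minus_def using cl
    by (simp add: minus_add a_assoc l_neg)
  moreover have "contract1 (v \<lhd>\<^sub>V a) (sq x) = contract1 v ?s"
    using OO.contract_smult[of a v "sq x"] v a x sq_mem by simp
  ultimately show "ev_at x (sq_Vec (v \<lhd>\<^sub>V a)) = ev_at x (OV.rs (sq_Vec v) a \<oplus>\<^bsub>OV.MN\<^esub> sigma v (der \<Omega> a))"
    using x a v va ax s sg by (simp add: ev_at_add ev_at_rsmult ev_at_sq_Vec sq_Vec_closed ev_at_sigma der_grade_zero
      sq_dual_def[of "v \<lhd>\<^sub>V a"] vec_apply)
qed

section \<open>Linearity of the braiding \<open>sigma\<close>\<close>

lemma sigma_ahom_r: assumes v: "v \<in> carrier Vec" shows "ahom Omega1 OV.MN (sigma v)"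
proof (rule ahomI[OF O1.abelian_group OV.abelian_group_MN])
  fix x y assume "x \<in> carrier Omega1" "y \<in> carrier Omega1"
  then have xy: "x \<in> grade \<Omega> 1" "y \<in> grade \<Omega> 1" by simp_all
  show "sigma v (x \<oplus>\<^bsub>Omega1\<^esub> y) = sigma v x \<oplus>\<^bsub>OV.MN\<^esub> sigma v y"
    by (rule OV_eqI) (use xy v OO.pure_add_l[of x y] in
      \<open>simp_all add: sigma_closed grade_closed ev_at_add ev_at_sigma OO.pure_closed sinv_add contract1_add sinv_mem\<close>)
qed (use v in \<open>simp add: sigma_closed\<close>)

lemma sigma_ahom_l: assumes x: "x \<in> grade \<Omega> 1" shows "ahom Vec OV.MN (\<lambda>v. sigma v x)"
proof (rule ahomI[OF V.abelian_group OV.abelian_group_MN])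
  fix v w assume vw: "v \<in> carrier Vec" "w \<in> carrier Vec"
  show "sigma (v \<oplus>\<^sub>V w) x = sigma v x \<oplus>\<^bsub>OV.MN\<^esub> sigma w x"
    by (rule OV_eqI) (use x vw OO.contract_add[of v w] in
      \<open>simp_all add: sigma_closed ev_at_add ev_at_sigma OO.pure_closed sinv_mem\<close>)
qed (use x in \<open>simp add: sigma_closed\<close>)

lemma sigma_smult:
  assumes v: "v \<in> carrier Vec" and x: "x \<in> grade \<Omega> 1" and a: "a \<in> grade \<Omega> 0"
  shows "sigma (a \<odot>\<^sub>V v) x = a \<odot>\<^bsub>OV.MN\<^esub> sigma v x"
  by (rule OV_eqI)
    (use v x a OO.contract_smult_dual[of a v] ahom_closed[OF OV.smult_MN_ahom[of a]] V.smult_closed[of a v] in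
      \<open>simp_all add: sigma_closed ev_at_smult ev_at_sigma OO.pure_closed sinv_mem\<close>)

text \<open>Left linearity of \<open>sinv\<close> makes \<open>sigma\<close> a map on the tensor
  product of vector fields and one-forms over \<open>A\<close>.\<close>

lemma sigma_balanced:
  assumes v: "v \<in> carrier Vec" and x: "x \<in> grade \<Omega> 1" and a: "a \<in> grade \<Omega> 0"
  shows "sigma (v \<lhd>\<^sub>V a) x = sigma v (a \<otimes> x)"
proof (rule OV_eqI)
  have va: "v \<lhd>\<^sub>V a \<in> carrier Vec" using v a V.rsmult_closed[of a v] by simp
  show "sigma (v \<lhd>\<^sub>V a) x \<in> carrier OV.MN" using va x by (rule sigma_closed)
  show "sigma v (a \<otimes> x) \<in> carrier OV.MN" using v x a by (simp add: sigma_closed grade_closed)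
  fix y assume y: "y \<in> grade \<Omega> 1"
  have "contract1 (v \<lhd>\<^sub>V a) (sinv (OO.pt x y)) = contract1 v (a \<odot>\<^bsub>OO.MN\<^esub> sinv (OO.pt x y))"
    using OO.contract_smult[of a v "sinv (OO.pt x y)"] v x y a by (simp add: OO.pure_closed sinv_mem)
  also have "\<dots> = contract1 v (sinv (OO.pt (a \<otimes> x) y))"
    using sinv_left[of a "OO.pt x y"] OO.smult_pure[of a x y] x y a by (simp add: OO.pure_closed)
  finally show "ev_at y (sigma (v \<lhd>\<^sub>V a) x) = ev_at y (sigma v (a \<otimes> x))"
    using v x y a va by (simp add: ev_at_sigma grade_closed)
qed

lemma sigma_rsmult:
  assumes v: "v \<in> carrier Vec" and x: "x \<in> grade \<Omega> 1" and a: "a \<in> grade \<Omega> 0"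
  shows "sigma v (x \<otimes> a) = OV.rs (sigma v x) a"
  by (rule OV_eqI)
    (use v x a ahom_closed[OF OV.rsmult_MN_ahom[of a]] OO.pure_balanced[of x a] in
      \<open>simp_all add: sigma_closed ev_at_rsmult ev_at_sigma grade_closed\<close>)

section \<open>Extending the braiding by the identity on the tensor algebra\<close>

lemma append_balanced: "w \<in> carrier TVec \<Longrightarrow> OV.balanced OT.MN (\<lambda>x v. OT.pt x (T.cons v w))"
proof (rule OV.balancedI)
  assume w: "w \<in> carrier TVec"
  show "ahom Vec OT.MN (\<lambda>v. OT.pt x (T.cons v w))" if "x \<in> carrier Omega1" for x
    using w that by (intro ahom_comp[OF T.cons_ahom_l OT.pure_ahom_r])
  show "ahom Omega1 OT.MN (\<lambda>x. OT.pt x (T.cons v w))" if "v \<in> carrier Vec" for v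
    using w that by (intro OT.pure_ahom_l T.cons_closed)
  show "OT.pt (x \<lhd>\<^bsub>Omega1\<^esub> a) (T.cons v w) = OT.pt x (T.cons (a \<odot>\<^sub>V v) w)"
    if "x \<in> carrier Omega1" "a \<in> carrier A" "v \<in> carrier Vec" for x a v
    using w that by (simp only: OT.pure_balanced T.cons_closed T.cons_smult_l)
qed

lemma append_ahom: "w \<in> carrier TVec \<Longrightarrow> ahom OV.MN OT.MN (\<lambda>X. tensor_append X w)"
  unfolding tensor_append_def by (rule OV.induced_ahom[OF append_balanced])

lemma append_pure:
  "\<lbrakk>w \<in> carrier TVec; x \<in> grade \<Omega> 1; v \<in> carrier Vec\<rbrakk> \<Longrightarrow> tensor_append (OV.pt x v) w = OT.pt x (T.cons v w)"
  unfolding tensor_append_def by (rule OV.induced_pure[OF append_balanced]) simp_all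

lemma append_closed: "\<lbrakk>X \<in> carrier OV.MN; w \<in> carrier TVec\<rbrakk> \<Longrightarrow> tensor_append X w \<in> carrier OT.MN"
  using ahom_closed[OF append_ahom] by simp

lemma append_add_r:
  assumes "X \<in> carrier OV.MN" "w \<in> carrier TVec" "w' \<in> carrier TVec"
  shows "tensor_append X (w \<oplus>\<^sub>T w') = tensor_append X w \<oplus>\<^bsub>OT.MN\<^esub> tensor_append X w'"
  by (rule OV.ahom_eqI[where G = OT.MN and X = X])
    (use assms in \<open>simp_all add: append_ahom ahom_plus append_pure ahom_add[OF T.cons_ahom] OT.pure_add_r T.cons_closed\<close>)

lemma append_ahom_r: "X \<in> carrier OV.MN \<Longrightarrow> ahom TVec OT.MN (tensor_append X)"
  by (rule ahomI[OF T.abelian_group_TV OT.abelian_group_MN]) (simp_all add: append_closed append_add_r)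

lemma append_smult:
  assumes "X \<in> carrier OV.MN" "w \<in> carrier TVec" "a \<in> grade \<Omega> 0"
  shows "tensor_append (a \<odot>\<^bsub>OV.MN\<^esub> X) w = a \<odot>\<^bsub>OT.MN\<^esub> tensor_append X w"
  by (rule OV.ahom_eqI[where G = OT.MN and X = X])
    (use assms in \<open>simp_all add: ahom_comp[OF OV.smult_MN_ahom append_ahom] ahom_comp[OF append_ahom OT.smult_MN_ahom]
      OV.smult_pure OT.smult_pure append_pure T.cons_closed grade_closed\<close>)

lemma append_rsmult:
  assumes "X \<in> carrier OV.MN" "w \<in> carrier TVec" "a \<in> grade \<Omega> 0"
  shows "tensor_append (OV.rs X a) w = tensor_append X (a \<odot>\<^sub>T w)"
  by (rule OV.ahom_eqI[where G = OT.MN and X = X])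
    (use assms in \<open>simp_all add: ahom_comp[OF OV.rsmult_MN_ahom append_ahom] append_ahom T.TV.smult_closed
      OV.rsmult_pure append_pure T.cons_smult V.rsmult_closed\<close>)

text \<open>A coefficient passes from the one-form to the vector field produced by
  \<open>sigma\<close> (\<open>sigma_rsmult\<close>), and from there into \<open>w\<close>
  (\<open>append_rsmult\<close>).\<close>

lemma sigma_id_balanced:
  assumes v: "v \<in> carrier Vec"
  shows "OT.balanced OT.MN (\<lambda>x w. tensor_append (sigma v x) w)"
proof (rule OT.balancedI)
  show "ahom TVec OT.MN (\<lambda>w. tensor_append (sigma v x) w)" if "x \<in> carrier Omega1" for x
    using append_ahom_r[OF sigma_closed[OF v]] that by simp
  show "ahom Omega1 OT.MN (\<lambda>x. tensor_append (sigma v x) w)" if "w \<in> carrier TVec" for w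
    using ahom_comp[OF sigma_ahom_r[OF v] append_ahom[OF that]] .
  show "tensor_append (sigma v (x \<lhd>\<^bsub>Omega1\<^esub> a)) w = tensor_append (sigma v x) (a \<odot>\<^sub>T w)"
    if "x \<in> carrier Omega1" "a \<in> carrier A" "w \<in> carrier TVec" for x a w
    using that v by (simp add: sigma_rsmult append_rsmult sigma_closed)
qed

lemma sigma_id_ahom: "v \<in> carrier Vec \<Longrightarrow> ahom OT.MN OT.MN (sigma_id v)"
  unfolding sigma_id_def[abs_def] by (rule OT.induced_ahom[OF sigma_id_balanced])

lemma sigma_id_pure:
  "\<lbrakk>v \<in> carrier Vec; x \<in> grade \<Omega> 1; w \<in> carrier TVec\<rbrakk> \<Longrightarrow> sigma_id v (OT.pt x w) = tensor_append (sigma v x) w"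
  unfolding sigma_id_def by (rule OT.induced_pure[OF sigma_id_balanced]) simp_all

lemma sigma_id_closed: "\<lbrakk>v \<in> carrier Vec; X \<in> carrier OT.MN\<rbrakk> \<Longrightarrow> sigma_id v X \<in> carrier OT.MN"
  using ahom_closed[OF sigma_id_ahom] .

lemma sigma_id_add_l:
  assumes "v \<in> carrier Vec" "v' \<in> carrier Vec" "X \<in> carrier OT.MN"
  shows "sigma_id (v \<oplus>\<^sub>V v') X = sigma_id v X \<oplus>\<^bsub>OT.MN\<^esub> sigma_id v' X"
proof (rule OT.ahom_eqI[where G = OT.MN and X = X])
  fix x w assume "x \<in> carrier Omega1" "w \<in> carrier TVec"
  then show "sigma_id (v \<oplus>\<^sub>V v') (OT.pt x w) = sigma_id v (OT.pt x w) \<oplus>\<^bsub>OT.MN\<^esub> sigma_id v' (OT.pt x w)"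
    using assms ahom_add[OF sigma_ahom_l[of x], of v v'] ahom_add[OF append_ahom[of w]]
    by (simp add: sigma_id_pure sigma_closed)
qed (use assms in \<open>simp_all add: sigma_id_ahom ahom_plus\<close>)

lemma sigma_id_ahom_l: "X \<in> carrier OT.MN \<Longrightarrow> ahom Vec OT.MN (\<lambda>v. sigma_id v X)"
  by (rule ahomI[OF V.abelian_group OT.abelian_group_MN]) (simp_all add: sigma_id_closed sigma_id_add_l)

lemma sigma_id_smult_l:
  assumes "v \<in> carrier Vec" "a \<in> grade \<Omega> 0" "X \<in> carrier OT.MN"
  shows "sigma_id (a \<odot>\<^sub>V v) X = a \<odot>\<^bsub>OT.MN\<^esub> sigma_id v X"
  by (rule OT.ahom_eqI[where G = OT.MN and X = X])
    (use assms V.smult_closed[of a v] in \<open>simp_all add: sigma_id_ahom ahom_comp[OF sigma_id_ahom OT.smult_MN_ahom]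
      sigma_id_pure sigma_smult append_smult sigma_closed\<close>)

lemma sigma_id_smult:
  assumes "v \<in> carrier Vec" "a \<in> grade \<Omega> 0" "X \<in> carrier OT.MN"
  shows "sigma_id v (a \<odot>\<^bsub>OT.MN\<^esub> X) = sigma_id (v \<lhd>\<^sub>V a) X"
  by (rule OT.ahom_eqI[where G = OT.MN and X = X])
    (use assms V.rsmult_closed[of a v] in \<open>simp_all add: sigma_id_ahom ahom_comp[OF OT.smult_MN_ahom sigma_id_ahom]
      sigma_id_pure OT.smult_pure sigma_balanced grade_closed\<close>)

section \<open>The covariant derivative on the tensor algebra\<close>

lemma one_A: "\<one> \<in> carrier A"
  using one_grade by simp

lemma wd_one_closed: "vs \<in> T.Vs \<Longrightarrow> T.wd \<one> vs \<in> carrier TVec"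
  using T.word_closed[OF one_A] .

lemma sq_word_closed: "\<lbrakk>a \<in> grade \<Omega> 0; vs \<in> T.Vs\<rbrakk> \<Longrightarrow> sq_word vs a \<in> carrier OT.MN"
proof (induction vs arbitrary: a)
  case Nil
  then show ?case using wd_one_closed[of "[]"] by (simp add: OT.pure_closed der_grade_zero)
next
  case (Cons v vs)
  then show ?case using Cons.IH[of \<one>] V.smult_closed[of a v]
    by (simp add: append_closed sq_Vec_closed sigma_id_closed wd_one_closed one_grade)
qed

lemma sq_word_ahom: "vs \<in> T.Vs \<Longrightarrow> ahom A OT.MN (sq_word vs)"
proof (induction vs)
  case Nil
  show ?case
    using ahom_comp[OF der_ahom_A OT.pure_ahom_l[OF wd_one_closed[OF lists.Nil]]] by simp
next
  case (Cons v vs)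
  then have v: "v \<in> carrier Vec" and vs: "vs \<in> T.Vs" by simp_all
  have "ahom A OT.MN (\<lambda>a. tensor_append (sq_Vec (a \<odot>\<^sub>V v)) (T.wd \<one> vs))"
    by (rule ahom_comp[OF V.smult_ahom_l[OF v] ahom_comp[OF sq_Vec_ahom append_ahom[OF wd_one_closed[OF vs]]]])
  moreover have "ahom A OT.MN (\<lambda>a. sigma_id (a \<odot>\<^sub>V v) (sq_word vs \<one>))"
    by (rule ahom_comp[OF V.smult_ahom_l[OF v] sigma_id_ahom_l[OF sq_word_closed[OF one_grade vs]]])
  ultimately show ?case
    using ahom_plus by (simp, blast)
qed

text \<open>No induction is required: the coefficient meets only the first letter. There
  \<open>sq_Vec_smult\<close> produces the db term, while the \<open>sigma_id\<close> part is left
  linear.\<close>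

lemma sq_word_smult:
  assumes a: "a \<in> grade \<Omega> 0" and b: "b \<in> grade \<Omega> 0" and vs: "vs \<in> T.Vs"
  shows "sq_word vs (b \<otimes> a) = OT.pt (der \<Omega> b) (T.wd a vs) \<oplus>\<^bsub>OT.MN\<^esub> b \<odot>\<^bsub>OT.MN\<^esub> sq_word vs a"
proof (cases vs)
  case Nil
  have wd: "T.wd a [] = a \<odot>\<^sub>T T.wd \<one> []"
    using T.smult_word[of a \<one> "[]"] a one_grade by (simp add: grade_carrier[of _ 0])
  show ?thesis
    using a b wd_one_closed[of "[]"] OT.pure_balanced[of "der \<Omega> b" a "T.wd \<one> []"] OT.pure_add_l OT.smult_pure
    by (simp add: Nil wd der_mult_zero[of b a 0] grade_closed)
next
  case (Cons v ws)
  then have v: "v \<in> carrier Vec" and ws: "ws \<in> T.Vs" using vs by simp_all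
  let ?av = "a \<odot>\<^sub>V v" and ?w = "T.wd \<one> ws" and ?S = "sq_word ws \<one>"
  have av: "?av \<in> carrier Vec" using V.smult_closed[of a v] a v by simp
  have bav: "(b \<otimes> a) \<odot>\<^sub>V v = b \<odot>\<^sub>V ?av" using V.smult_assoc[of b a v] a b v by simp
  have w: "?w \<in> carrier TVec" by (rule wd_one_closed[OF ws])
  have S: "?S \<in> carrier OT.MN" by (rule sq_word_closed[OF one_grade ws])
  have wd: "T.cons ?av ?w = T.wd a vs" using T.word_Cons[of a v ws] a v ws Cons by simp
  have p: "OV.pt (der \<Omega> b) ?av \<in> carrier OV.MN" using av b by (simp add: OV.pure_closed der_grade_zero)
  have s: "b \<odot>\<^bsub>OV.MN\<^esub> sq_Vec ?av \<in> carrier OV.MN"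
    using b ahom_closed[OF OV.smult_MN_ahom[of b] sq_Vec_closed[OF av]] by simp
  let ?Y = "tensor_append (sq_Vec ?av) ?w" and ?Z = "sigma_id ?av ?S"
  have Y: "?Y \<in> carrier OT.MN" using av w by (simp add: append_closed sq_Vec_closed)
  have Z: "?Z \<in> carrier OT.MN" using av S by (rule sigma_id_closed)
  have bY: "b \<odot>\<^bsub>OT.MN\<^esub> ?Y \<in> carrier OT.MN" "b \<odot>\<^bsub>OT.MN\<^esub> ?Z \<in> carrier OT.MN"
    using b ahom_closed[OF OT.smult_MN_ahom[of b] Y] ahom_closed[OF OT.smult_MN_ahom[of b] Z] by simp_all
  have P: "OT.pt (der \<Omega> b) (T.wd a vs) \<in> carrier OT.MN"
    using a b vs T.word_closed[of a vs] by (simp add: OT.pure_closed der_grade_zero)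
  have "sq_word vs (b \<otimes> a) = tensor_append (OV.pt (der \<Omega> b) ?av \<oplus>\<^bsub>OV.MN\<^esub> b \<odot>\<^bsub>OV.MN\<^esub> sq_Vec ?av) ?w
      \<oplus>\<^bsub>OT.MN\<^esub> b \<odot>\<^bsub>OT.MN\<^esub> ?Z"
    using Cons av b S by (simp add: bav sq_Vec_smult sigma_id_smult_l)
  also have "\<dots> = (OT.pt (der \<Omega> b) (T.wd a vs) \<oplus>\<^bsub>OT.MN\<^esub> b \<odot>\<^bsub>OT.MN\<^esub> ?Y) \<oplus>\<^bsub>OT.MN\<^esub> b \<odot>\<^bsub>OT.MN\<^esub> ?Z"
    using ahom_add[OF append_ahom[OF w] p s] b av w
    by (simp add: append_pure der_grade_zero append_smult sq_Vec_closed wd)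
  also have "\<dots> = OT.pt (der \<Omega> b) (T.wd a vs) \<oplus>\<^bsub>OT.MN\<^esub> b \<odot>\<^bsub>OT.MN\<^esub> (?Y \<oplus>\<^bsub>OT.MN\<^esub> ?Z)"
    using ahom_add[OF OT.smult_MN_ahom[of b] Y Z] b P bY by (simp add: OT.MN.a_assoc)
  finally show ?thesis using Cons by simp
qed

lemma sq_word_letter:
  "\<lbrakk>a \<in> grade \<Omega> 0; xs \<in> T.Vs; ys \<in> T.Vs\<rbrakk> \<Longrightarrow> ahom Vec OT.MN (\<lambda>v. sq_word (xs @ v # ys) a)"
proof (induction xs arbitrary: a)
  case Nil
  have "ahom Vec OT.MN (\<lambda>v. tensor_append (sq_Vec (a \<odot>\<^sub>V v)) (T.wd \<one> ys))"
    using Nil by (intro ahom_comp[OF V.smult_ahom_r ahom_comp[OF sq_Vec_ahom append_ahom]] wd_one_closed) simp_all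
  moreover have "ahom Vec OT.MN (\<lambda>v. sigma_id (a \<odot>\<^sub>V v) (sq_word ys \<one>))"
    using Nil by (intro ahom_comp[OF V.smult_ahom_r sigma_id_ahom_l] sq_word_closed) (simp_all add: one_grade)
  ultimately show ?case using ahom_plus by (simp, blast)
next
  case (Cons x xs)
  then have ax: "a \<odot>\<^sub>V x \<in> carrier Vec" using V.smult_closed[of a x] by simp
  have "ahom Vec OT.MN (\<lambda>v. tensor_append (sq_Vec (a \<odot>\<^sub>V x)) (T.wd \<one> (xs @ v # ys)))"
    using Cons.prems by (intro ahom_comp[OF T.word_ahom_letter append_ahom_r] sq_Vec_closed ax one_A) simp_all
  moreover have "ahom Vec OT.MN (\<lambda>v. sigma_id (a \<odot>\<^sub>V x) (sq_word (xs @ v # ys) \<one>))"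
    using Cons.prems Cons.IH[OF one_grade] by (intro ahom_comp[OF _ sigma_id_ahom[OF ax]]) simp
  ultimately show ?case using ahom_plus by (simp, blast)
qed

lemma sq_word_coeff:
  "\<lbrakk>a \<in> grade \<Omega> 0; b \<in> grade \<Omega> 0; v \<in> carrier Vec; ys \<in> T.Vs\<rbrakk> \<Longrightarrow>
    sq_word (v # ys) (a \<otimes> b) = sq_word ((b \<odot>\<^sub>V v) # ys) a"
  using V.smult_assoc[of a b v] by simp

text \<open>At the two letters concerned, the right Leibniz rule for v.b gives \<open>sigma\<close>
  applied to v and db. The left Leibniz rule for the tail starting with b.w gives db followed by the
  tail, and \<open>sigma_id\<close> turns this into the same term.\<close>

lemma sq_word_middle:
  "\<lbrakk>a \<in> grade \<Omega> 0; b \<in> grade \<Omega> 0; v \<in> carrier Vec; w \<in> carrier Vec; xs \<in> T.Vs; ys \<in> T.Vs\<rbrakk> \<Longrightarrow>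
    sq_word (xs @ (v \<lhd>\<^sub>V b) # w # ys) a = sq_word (xs @ v # (b \<odot>\<^sub>V w) # ys) a"
proof (induction xs arbitrary: a)
  case Nil
  let ?v = "a \<odot>\<^sub>V v" and ?W = "T.wd \<one> (w # ys)" and ?S = "sq_word (w # ys) \<one>"
  have v: "?v \<in> carrier Vec" using Nil V.smult_closed[of a v] by simp
  have vb: "a \<odot>\<^sub>V (v \<lhd>\<^sub>V b) = ?v \<lhd>\<^sub>V b" using Nil V.smult_rsmult[of a b v] by simp
  have wys: "w # ys \<in> T.Vs" using Nil by simp
  have W: "?W \<in> carrier TVec" by (rule wd_one_closed[OF wys])
  have S: "?S \<in> carrier OT.MN" by (rule sq_word_closed[OF one_grade wys])
  have Wb: "T.wd \<one> ((b \<odot>\<^sub>V w) # ys) = b \<odot>\<^sub>T ?W"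
    using T.smult_word[of b \<one> "w # ys"] T.word_one[of b w ys] Nil one_A wys by (simp add: grade_carrier[of _ 0])
  have "sq_word ((b \<odot>\<^sub>V w) # ys) \<one> = sq_word (w # ys) (b \<otimes> \<one>)"
    using sq_word_coeff[of \<one> b w ys] Nil one_grade by (simp add: grade_carrier[of _ 0])
  then have Sb: "sq_word ((b \<odot>\<^sub>V w) # ys) \<one> = OT.pt (der \<Omega> b) ?W \<oplus>\<^bsub>OT.MN\<^esub> b \<odot>\<^bsub>OT.MN\<^esub> ?S"
    using sq_word_smult[OF one_grade _ wys, of b] Nil by simp
  let ?X = "tensor_append (OV.rs (sq_Vec ?v) b) ?W" and ?Y = "tensor_append (sigma ?v (der \<Omega> b)) ?W"
    and ?Z = "sigma_id (?v \<lhd>\<^sub>V b) ?S"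
  have cl: "OV.rs (sq_Vec ?v) b \<in> carrier OV.MN" "sigma ?v (der \<Omega> b) \<in> carrier OV.MN"
    using Nil v ahom_closed[OF OV.rsmult_MN_ahom[of b] sq_Vec_closed[OF v]] by (simp_all add: sigma_closed der_grade_zero)
  have XYZ: "?X \<in> carrier OT.MN" "?Y \<in> carrier OT.MN" "?Z \<in> carrier OT.MN"
    using cl W S v V.rsmult_closed[of b ?v] Nil by (simp_all add: append_closed sigma_id_closed)
  have "sq_word ((v \<lhd>\<^sub>V b) # w # ys) a = (?X \<oplus>\<^bsub>OT.MN\<^esub> ?Y) \<oplus>\<^bsub>OT.MN\<^esub> ?Z"
    using ahom_add[OF append_ahom[OF W] cl] Nil
    unfolding sq_word.simps(2)[of _ "w # ys"] vb by (simp only: sq_Vec_rsmult[OF v])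
  \<comment> \<open>The middle term changes its role here: it came from differentiating the left
    letter and is now grouped with the derivative of the tail.\<close>
  also have "\<dots> = ?X \<oplus>\<^bsub>OT.MN\<^esub> (?Y \<oplus>\<^bsub>OT.MN\<^esub> ?Z)" using XYZ by (simp add: OT.MN.a_assoc)
  also have "?X = tensor_append (sq_Vec ?v) (T.wd \<one> ((b \<odot>\<^sub>V w) # ys))"
    unfolding Wb using append_rsmult[OF sq_Vec_closed[OF v] W] Nil by simp
  also have "?Y \<oplus>\<^bsub>OT.MN\<^esub> ?Z = sigma_id ?v (sq_word ((b \<odot>\<^sub>V w) # ys) \<one>)"
    unfolding Sb
    using ahom_add[OF sigma_id_ahom[OF v], of "OT.pt (der \<Omega> b) ?W" "b \<odot>\<^bsub>OT.MN\<^esub> ?S"] Nil W S v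
      ahom_closed[OF OT.smult_MN_ahom[of b] S]
    by (simp add: sigma_id_pure sigma_id_smult der_grade_zero OT.pure_closed del: sq_word.simps)
  finally show ?case by (simp only: append_Nil sq_word.simps(2)[of _ "_ # ys"])
next
  case (Cons x xs)
  then show ?case
    using T.word_middle[of \<one> b v w xs ys] Cons.IH[OF one_grade] one_A by simp
qed

lemma sq_word_map: "T.word_map OT.MN (\<lambda>a vs. sq_word vs a)"
  by (rule T.word_mapI)
    (simp_all add: sq_word_ahom sq_word_letter sq_word_coeff sq_word_middle del: sq_word.simps)

lemma sq_T_ahom: "ahom TVec OT.MN sq_T"
  unfolding sq_T_def[abs_def] by (rule T.induced_TV_ahom[OF sq_word_map])

lemma sq_T_word: "\<lbrakk>a \<in> grade \<Omega> 0; vs \<in> T.Vs\<rbrakk> \<Longrightarrow> sq_T (T.wd a vs) = sq_word vs a"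
  unfolding sq_T_def by (rule T.induced_word[OF sq_word_map]) simp_all

lemma sq_T_closed: "w \<in> carrier TVec \<Longrightarrow> sq_T w \<in> carrier OT.MN"
  using ahom_closed[OF sq_T_ahom] .

lemma sq_T_smult:
  assumes b: "b \<in> grade \<Omega> 0" and w: "w \<in> carrier TVec"
  shows "sq_T (b \<odot>\<^sub>T w) = OT.pt (der \<Omega> b) w \<oplus>\<^bsub>OT.MN\<^esub> b \<odot>\<^bsub>OT.MN\<^esub> sq_T w"
proof (rule T.TV_ahom_eqI[where G = OT.MN and x = w])
  show "ahom TVec OT.MN (\<lambda>w. sq_T (b \<odot>\<^sub>T w))"
    using b by (intro ahom_comp[OF T.smult_TV_ahom sq_T_ahom]) simp
  show "ahom TVec OT.MN (\<lambda>w. OT.pt (der \<Omega> b) w \<oplus>\<^bsub>OT.MN\<^esub> b \<odot>\<^bsub>OT.MN\<^esub> sq_T w)"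
    using b by (intro ahom_plus OT.pure_ahom_r ahom_comp[OF sq_T_ahom OT.smult_MN_ahom]) (simp_all add: der_grade_zero)
qed (use b w in \<open>simp_all add: T.smult_word sq_T_word grade_closed sq_word_smult\<close>)

end

section \<open>The product\<close>

context right_bimodule_connection
begin

text \<open>The covariant derivative along \<open>v\<close>. It preserves the degree of
  \<open>w\<close>, whereas the other part of \<open>bullet_Vec\<close>, \<open>T.cons v\<close>,
  raises it by one.\<close>

definition nabla_Vec where "nabla_Vec v w = contract TVec v (sq_T w)"

lemma nabla_Vec_closed: "\<lbrakk>v \<in> carrier Vec; w \<in> carrier TVec\<rbrakk> \<Longrightarrow> nabla_Vec v w \<in> carrier TVec"
  unfolding nabla_Vec_def by (intro OT.contract_closed sq_T_closed)

lemma nabla_Vec_ahom_r: "v \<in> carrier Vec \<Longrightarrow> ahom TVec TVec (nabla_Vec v)"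
  unfolding nabla_Vec_def[abs_def] by (rule ahom_comp[OF sq_T_ahom OT.contract_ahom])

lemma nabla_Vec_ahom_l: "w \<in> carrier TVec \<Longrightarrow> ahom Vec TVec (\<lambda>v. nabla_Vec v w)"
  unfolding nabla_Vec_def by (intro OT.contract_dual_ahom sq_T_closed)

lemma nabla_Vec_smult_l:
  "\<lbrakk>v \<in> carrier Vec; a \<in> grade \<Omega> 0; w \<in> carrier TVec\<rbrakk> \<Longrightarrow> nabla_Vec (a \<odot>\<^sub>V v) w = a \<odot>\<^sub>T nabla_Vec v w"
  unfolding nabla_Vec_def using OT.contract_smult_dual[of a v "sq_T w"] sq_T_closed by simp

lemma nabla_Vec_smult:
  assumes v: "v \<in> carrier Vec" and a: "a \<in> grade \<Omega> 0" and w: "w \<in> carrier TVec"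
  shows "nabla_Vec v (a \<odot>\<^sub>T w) = v (der \<Omega> a) \<odot>\<^sub>T w \<oplus>\<^sub>T nabla_Vec (v \<lhd>\<^sub>V a) w"
proof -
  have s: "a \<odot>\<^bsub>OT.MN\<^esub> sq_T w \<in> carrier OT.MN"
    using a w ahom_closed[OF OT.smult_MN_ahom[of a] sq_T_closed] by simp
  have "nabla_Vec v (a \<odot>\<^sub>T w) = contract TVec v (OT.pt (der \<Omega> a) w) \<oplus>\<^sub>T contract TVec v (a \<odot>\<^bsub>OT.MN\<^esub> sq_T w)"
    unfolding nabla_Vec_def sq_T_smult[OF a w]
    using a w s by (intro ahom_add[OF OT.contract_ahom[OF v]] OT.pure_closed) (simp_all add: der_grade_zero)
  then show ?thesis
    unfolding nabla_Vec_def
    using v a w OT.contract_smult[of a v "sq_T w"] by (simp add: OT.contract_pure der_grade_zero sq_T_closed)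
qed

section \<open>The covariant derivative preserves the degree\<close>

inductive homogeneous_form for k where
  homogeneous_form_pure: "\<lbrakk>x \<in> carrier Omega1; T.homogeneous k w\<rbrakk> \<Longrightarrow> homogeneous_form k (OT.pt x w)"
| homogeneous_form_add: "\<lbrakk>homogeneous_form k X; homogeneous_form k Y\<rbrakk> \<Longrightarrow> homogeneous_form k (X \<oplus>\<^bsub>OT.MN\<^esub> Y)"

lemma homogeneous_form_closed: "homogeneous_form k X \<Longrightarrow> X \<in> carrier OT.MN"
  by (induction rule: homogeneous_form.induct) (auto intro: OT.pure_closed T.homogeneous_closed)

lemma homogeneous_contract: "\<lbrakk>homogeneous_form k X; v \<in> carrier Vec\<rbrakk> \<Longrightarrow> T.homogeneous k (contract TVec v X)"
  by (induction rule: homogeneous_form.induct)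
    (simp_all add: OT.contract_pure T.homogeneous_closed T.homogeneous_smult vec_closed
      ahom_add[OF OT.contract_ahom] homogeneous_form_closed T.homogeneous_add)

lemma homogeneous_append:
  assumes "X \<in> carrier OV.MN" "T.homogeneous k w"
  shows "homogeneous_form (Suc k) (tensor_append X w)"
  using assms(1)
  by (induction rule: OV.induct_MN)
    (use assms(2) in \<open>simp_all add: append_pure T.homogeneous_closed T.homogeneous_cons homogeneous_form_pure
      ahom_add[OF append_ahom] homogeneous_form_add\<close>)

lemma homogeneous_sigma_id:
  "\<lbrakk>homogeneous_form k X; v \<in> carrier Vec\<rbrakk> \<Longrightarrow> homogeneous_form (Suc k) (sigma_id v X)"
  by (induction rule: homogeneous_form.induct)
    (simp_all add: sigma_id_pure T.homogeneous_closed homogeneous_append sigma_closed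
      ahom_add[OF sigma_id_ahom] homogeneous_form_closed homogeneous_form_add)

lemma homogeneous_sq_word:
  "\<lbrakk>vs \<in> T.Vs; a \<in> grade \<Omega> 0\<rbrakk> \<Longrightarrow> homogeneous_form (length vs) (sq_word vs a)"
proof (induction vs arbitrary: a)
  case Nil
  then show ?case using T.homogeneous_word[OF one_A lists.Nil refl]
    by (simp add: homogeneous_form_pure der_grade_zero)
next
  case (Cons v vs)
  then show ?case
    using V.smult_closed[of a v] Cons.IH[OF _ one_grade] T.homogeneous_word[OF one_A _ refl, of vs]
    by (simp add: homogeneous_form_add homogeneous_append homogeneous_sigma_id sq_Vec_closed)
qed

text \<open>Because of this the subtracted term of the product recursion may be multiplied by
  \<open>bullet_deg k\<close>, with the same \<open>k\<close> as for the tail.\<close>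

lemma homogeneous_nabla_Vec: "\<lbrakk>T.homogeneous k w; v \<in> carrier Vec\<rbrakk> \<Longrightarrow> T.homogeneous k (nabla_Vec v w)"
proof (induction rule: T.homogeneous.induct)
  case (homogeneous_word a vs)
  then show ?case using homogeneous_sq_word[of vs a]
    by (simp add: nabla_Vec_def sq_T_word homogeneous_contract)
next
  case (homogeneous_add x y)
  then show ?case by (simp add: ahom_add[OF nabla_Vec_ahom_r] T.homogeneous_closed T.homogeneous_add)
qed

section \<open>Left multiplication by a vector field\<close>

lemma bullet_Vec_eq: "bullet_Vec v w = T.cons v w \<oplus>\<^sub>T nabla_Vec v w"
  by (simp add: bullet_Vec_def nabla_Vec_def)

lemma bullet_Vec_ahom_r: "v \<in> carrier Vec \<Longrightarrow> ahom TVec TVec (bullet_Vec v)"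
  unfolding bullet_Vec_eq[abs_def] by (intro ahom_plus T.cons_ahom nabla_Vec_ahom_r)

lemma bullet_Vec_ahom_l: "w \<in> carrier TVec \<Longrightarrow> ahom Vec TVec (\<lambda>v. bullet_Vec v w)"
  unfolding bullet_Vec_eq by (intro ahom_plus T.cons_ahom_l nabla_Vec_ahom_l)

lemma bullet_Vec_closed: "\<lbrakk>v \<in> carrier Vec; w \<in> carrier TVec\<rbrakk> \<Longrightarrow> bullet_Vec v w \<in> carrier TVec"
  using ahom_closed[OF bullet_Vec_ahom_r] .

lemma bullet_Vec_smult_l:
  "\<lbrakk>v \<in> carrier Vec; a \<in> grade \<Omega> 0; w \<in> carrier TVec\<rbrakk> \<Longrightarrow> bullet_Vec (a \<odot>\<^sub>V v) w = a \<odot>\<^sub>T bullet_Vec v w"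
  by (simp add: bullet_Vec_eq T.cons_smult_l nabla_Vec_smult_l T.TV.smult_r_distr T.cons_closed nabla_Vec_closed)

lemma bullet_Vec_smult:
  assumes v: "v \<in> carrier Vec" and a: "a \<in> grade \<Omega> 0" and w: "w \<in> carrier TVec"
  shows "bullet_Vec v (a \<odot>\<^sub>T w) = v (der \<Omega> a) \<odot>\<^sub>T w \<oplus>\<^sub>T bullet_Vec (v \<lhd>\<^sub>V a) w"
proof -
  have va: "v \<lhd>\<^sub>V a \<in> carrier Vec" using v a V.rsmult_closed[of a v] by simp
  have "v (der \<Omega> a) \<odot>\<^sub>T w \<in> carrier TVec"
    using T.TV.smult_closed[of "v (der \<Omega> a)" w] v a w by (simp add: vec_closed der_grade_zero)
  then show ?thesis
    using v a w va by (simp add: bullet_Vec_eq T.cons_smult nabla_Vec_smult T.cons_closed nabla_Vec_closed T.TV.a_lcomm)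
qed

text \<open>The right-hand side of the product recursion, with \<open>B\<close> in place of right
  multiplication by \<open>w\<close> in lower degree. What has to be checked for one step then
  depends only on left linearity of \<open>B\<close>.\<close>

definition bullet_step where
  "bullet_step B v y = bullet_Vec v (B y) \<ominus>\<^sub>T B (nabla_Vec v y)"

text \<open>The value of \<open>bullet_deg k\<close> on words, with the two cases of its recursion unified.\<close>

definition bullet_word where
  "bullet_word k w a vs = (if length vs = k then
     (case vs of [] \<Rightarrow> a \<odot>\<^sub>T w
      | v # ys \<Rightarrow> bullet_step (\<lambda>x. bullet_deg (k - 1) x w) (a \<odot>\<^sub>V v) (T.wd \<one> ys))
     else \<zero>\<^bsub>TVec\<^esub>)"

lemma bullet_deg_induced: "bullet_deg k x w = induced TVec (\<lambda>(a, vs). bullet_word k w a vs) x"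
proof (cases k)
  case 0
  have "(\<lambda>(a, vs). if vs = [] then a \<odot>\<^sub>T w else \<zero>\<^bsub>TVec\<^esub>) = (\<lambda>(a, vs). bullet_word 0 w a vs)"
    by (auto simp: bullet_word_def fun_eq_iff)
  then show ?thesis by (simp add: 0)
next
  case (Suc m)
  have "(\<lambda>(a, vs). if length vs = Suc m
        then (let v = a \<odot>\<^sub>V hd vs; y = T.wd \<one> (tl vs) in
              bullet_Vec v (bullet_deg m y w)
                \<ominus>\<^sub>T bullet_deg m (contract TVec v (sq_T y)) w)
        else \<zero>\<^bsub>TVec\<^esub>) = (\<lambda>(a, vs). bullet_word (Suc m) w a vs)"
    by (auto simp: bullet_word_def fun_eq_iff bullet_step_def nabla_Vec_def Let_def split: list.split)
  then show ?thesis by (simp add: Suc)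
qed

text \<open>The invariant of the recursion: right multiplication by a fixed element, one degree at a
  time, commutes with the left action.\<close>

definition left_linear where
  "left_linear B \<longleftrightarrow> ahom TVec TVec B \<and>
     (\<forall>a\<in>grade \<Omega> 0. \<forall>x\<in>carrier TVec. B (a \<odot>\<^sub>T x) = a \<odot>\<^sub>T B x)"

context
  fixes B assumes B: "left_linear B"
begin

lemma left_linear_ahom: "ahom TVec TVec B"
  using B by (simp add: left_linear_def)

lemma left_linear_closed: "x \<in> carrier TVec \<Longrightarrow> B x \<in> carrier TVec"
  using ahom_closed[OF left_linear_ahom] .

lemma left_linear_smult: "\<lbrakk>a \<in> grade \<Omega> 0; x \<in> carrier TVec\<rbrakk> \<Longrightarrow> B (a \<odot>\<^sub>T x) = a \<odot>\<^sub>T B x"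
  using B by (simp add: left_linear_def)

lemma bullet_step_ahom_r: "v \<in> carrier Vec \<Longrightarrow> ahom TVec TVec (bullet_step B v)"
  unfolding bullet_step_def[abs_def]
  by (intro ahom_diff ahom_comp[OF left_linear_ahom bullet_Vec_ahom_r] ahom_comp[OF nabla_Vec_ahom_r left_linear_ahom])

lemma bullet_step_ahom_l: "y \<in> carrier TVec \<Longrightarrow> ahom Vec TVec (\<lambda>v. bullet_step B v y)"
  unfolding bullet_step_def
  by (intro ahom_diff bullet_Vec_ahom_l left_linear_closed ahom_comp[OF nabla_Vec_ahom_l left_linear_ahom])

lemma bullet_step_smult_l:
  assumes "v \<in> carrier Vec" "a \<in> grade \<Omega> 0" "y \<in> carrier TVec"
  shows "bullet_step B (a \<odot>\<^sub>V v) y = a \<odot>\<^sub>T bullet_step B v y"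
proof -
  have "ahom TVec TVec (\<lambda>x. a \<odot>\<^sub>T x)" using assms T.smult_TV_ahom by simp
  from ahom_minus[OF this] show ?thesis
    using assms by (simp add: bullet_step_def bullet_Vec_smult_l nabla_Vec_smult_l left_linear_closed left_linear_smult
      nabla_Vec_closed bullet_Vec_closed)
qed

text \<open>This is where the subtraction in the recursion matters: v applied to a.(B y), and
  \<open>B\<close> applied to the derivative of a.y along v, both contribute v(da).(B y), and the
  two contributions cancel.\<close>

lemma bullet_step_balanced:
  assumes v: "v \<in> carrier Vec" and a: "a \<in> grade \<Omega> 0" and y: "y \<in> carrier TVec"
  shows "bullet_step B (v \<lhd>\<^sub>V a) y = bullet_step B v (a \<odot>\<^sub>T y)"
proof -
  let ?va = "v \<lhd>\<^sub>V a" and ?d = "v (der \<Omega> a)"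
  have va: "?va \<in> carrier Vec" using v a V.rsmult_closed[of a v] by simp
  have d: "?d \<in> grade \<Omega> 0" using v a by (simp add: vec_closed der_grade_zero)
  have dy: "?d \<odot>\<^sub>T y \<in> carrier TVec" "?d \<odot>\<^sub>T B y \<in> carrier TVec"
    using d y T.TV.smult_closed[of ?d] left_linear_closed by simp_all
  have cl: "bullet_Vec ?va (B y) \<in> carrier TVec" "B (nabla_Vec ?va y) \<in> carrier TVec"
    using va y by (simp_all add: bullet_Vec_closed left_linear_closed nabla_Vec_closed)
  have "bullet_step B v (a \<odot>\<^sub>T y) = (?d \<odot>\<^sub>T B y \<oplus>\<^sub>T bullet_Vec ?va (B y))
      \<ominus>\<^sub>T (?d \<odot>\<^sub>T B y \<oplus>\<^sub>T B (nabla_Vec ?va y))"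
    using v a y va d dy by (simp add: bullet_step_def nabla_Vec_smult left_linear_smult left_linear_closed bullet_Vec_smult
      ahom_add[OF left_linear_ahom] nabla_Vec_closed)
  also have "\<dots> = bullet_step B ?va y"
    using cl dy by (simp add: bullet_step_def a_minus_def T.TV.minus_add T.TV.a_ac T.TV.r_neg1 T.TV.r_neg2)
  finally show ?thesis ..
qed

end

section \<open>The product recursion respects the relations of the tensor algebra\<close>

lemma bullet_word_eqs:
  "bullet_word (Suc k) w a (v # ys) =
     (if length ys = k then bullet_step (\<lambda>x. bullet_deg k x w) (a \<odot>\<^sub>V v) (T.wd \<one> ys) else \<zero>\<^bsub>TVec\<^esub>)"
  "bullet_word 0 w a [] = a \<odot>\<^sub>T w" "bullet_word 0 w a (v # ys) = \<zero>\<^bsub>TVec\<^esub>"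
  "bullet_word (Suc k) w a [] = \<zero>\<^bsub>TVec\<^esub>"
  by (simp_all add: bullet_word_def)

lemma zero_ahom: "abelian_group G \<Longrightarrow> ahom G TVec (\<lambda>x. \<zero>\<^bsub>TVec\<^esub>)"
  by (rule ahom_const_zero[OF _ T.abelian_group_TV])

lemma smult_zero_TVec: "a \<in> grade \<Omega> 0 \<Longrightarrow> a \<odot>\<^sub>T \<zero>\<^bsub>TVec\<^esub> = \<zero>\<^bsub>TVec\<^esub>"
  using ahom_zero[OF T.smult_TV_ahom[of a]] by simp

lemma bullet_word_map_Suc:
  assumes B: "left_linear (\<lambda>x. bullet_deg k x w)"
  shows "T.word_map TVec (bullet_word (Suc k) w)"
proof (rule T.word_mapI)
  note r = bullet_step_ahom_r[OF B] and l = bullet_step_ahom_l[OF B]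
  show "ahom A TVec (\<lambda>a. bullet_word (Suc k) w a vs)" if "vs \<in> T.Vs" for vs
  proof (cases vs)
    case (Cons v ys)
    then show ?thesis
      using that ahom_comp[OF V.smult_ahom_l[of v] l[OF wd_one_closed[of ys]]]
      by (cases "length ys = k") (simp_all add: bullet_word_eqs zero_ahom O1.A.abelian_group_axioms)
  qed (simp add: bullet_word_eqs zero_ahom O1.A.abelian_group_axioms)
  show "ahom Vec TVec (\<lambda>v. bullet_word (Suc k) w a (xs @ v # ys))"
    if a: "a \<in> carrier A" and xs: "xs \<in> T.Vs" and ys: "ys \<in> T.Vs" for a xs ys
  proof (cases xs)
    case Nil
    then show ?thesis
      using ahom_comp[OF V.smult_ahom_r[OF a] l[OF wd_one_closed[OF ys]]]
      by (cases "length ys = k") (simp_all add: bullet_word_eqs zero_ahom V.abelian_group)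
  next
    case (Cons x zs)
    then show ?thesis
      using ahom_comp[OF T.word_ahom_letter[OF one_A, of zs ys] r[of "a \<odot>\<^sub>V x"]] V.smult_closed[of a x] a xs ys
      \<comment> \<open>The varying letter is bound, but the test in \<open>bullet_word\<close> sees
        only the length of the tail, so any placeholder serves for the case split.\<close>
      by (cases "length (zs @ undefined # ys) = k") (simp_all add: bullet_word_eqs zero_ahom V.abelian_group)
  qed
  show "bullet_word (Suc k) w (a \<otimes>\<^bsub>A\<^esub> b) (v # ys) = bullet_word (Suc k) w a ((b \<odot>\<^sub>V v) # ys)"
    if "a \<in> carrier A" "b \<in> carrier A" "v \<in> carrier Vec" "ys \<in> T.Vs" for a b v ys
    using that V.smult_assoc[of a b v] by (simp add: bullet_word_eqs)
  show "bullet_word (Suc k) w a (xs @ (v \<lhd>\<^sub>V b) # z # ys) = bullet_word (Suc k) w a (xs @ v # (b \<odot>\<^sub>V z) # ys)"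
    if a: "a \<in> carrier A" and b: "b \<in> carrier A" and v: "v \<in> carrier Vec" and z: "z \<in> carrier Vec"
      and xs: "xs \<in> T.Vs" and ys: "ys \<in> T.Vs" for a b v z xs ys
  proof (cases xs)
    \<comment> \<open>Without a prefix the relation joins the head to the tail, which calls for
      \<open>bullet_step_balanced\<close>; with a prefix it is a relation inside the tail
      word.\<close>
    case Nil
    have "T.wd \<one> ((b \<odot>\<^sub>V z) # ys) = b \<odot>\<^sub>T T.wd \<one> (z # ys)"
      using T.smult_word[of b \<one> "z # ys"] T.word_one[of b z ys] b z ys one_A by (simp add: grade_carrier[of _ 0])
    then show ?thesis
      using Nil a b v z ys V.smult_rsmult[of a b v] V.smult_closed[of a v]
        bullet_step_balanced[OF B, of "a \<odot>\<^sub>V v" b "T.wd \<one> (z # ys)"] wd_one_closed[of "z # ys"]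
      by (simp add: bullet_word_eqs)
  next
    case (Cons x zs)
    then show ?thesis
      using T.word_middle[OF one_A b v z _ ys, of zs] xs by (simp add: bullet_word_eqs)
  qed
qed

lemma bullet_word_map_zero:
  assumes w: "w \<in> carrier TVec" shows "T.word_map TVec (bullet_word 0 w)"
proof (rule T.word_mapI)
  show "ahom A TVec (\<lambda>a. bullet_word 0 w a vs)" if "vs \<in> T.Vs" for vs
    using T.TV.smult_ahom_l[OF w]
    by (cases vs) (simp_all add: bullet_word_eqs zero_ahom O1.A.abelian_group_axioms)
qed (simp_all add: bullet_word_def zero_ahom V.abelian_group)

lemma bullet_word_smult:
  assumes B: "\<And>m. k = Suc m \<Longrightarrow> left_linear (\<lambda>x. bullet_deg m x w)"
    and a: "a \<in> grade \<Omega> 0" and b: "b \<in> grade \<Omega> 0" and vs: "vs \<in> T.Vs" and w: "w \<in> carrier TVec"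
  shows "bullet_word k w (b \<otimes> a) vs = b \<odot>\<^sub>T bullet_word k w a vs"
proof (cases vs)
  case Nil
  then show ?thesis using T.TV.smult_assoc[of b a w] a b w smult_zero_TVec[OF b] by (simp add: bullet_word_def)
next
  case (Cons v ys)
  then show ?thesis
    using V.smult_assoc[of b a v] V.smult_closed[of a v] a b vs smult_zero_TVec[OF b] wd_one_closed[of ys]
      bullet_step_smult_l[OF B] by (cases k) (simp_all add: bullet_word_eqs)
qed

lemma left_linear_bullet_deg:
  assumes m: "T.word_map TVec (bullet_word k w)"
    and smult: "\<And>a b vs. \<lbrakk>a \<in> grade \<Omega> 0; b \<in> grade \<Omega> 0; vs \<in> T.Vs\<rbrakk> \<Longrightarrow>
      bullet_word k w (b \<otimes> a) vs = b \<odot>\<^sub>T bullet_word k w a vs"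
  shows "left_linear (\<lambda>x. bullet_deg k x w)"
  unfolding left_linear_def bullet_deg_induced
proof (intro conjI ballI T.induced_TV_ahom[OF m])
  fix b x assume bx: "b \<in> grade \<Omega> 0" "x \<in> carrier TVec"
  show "induced TVec (\<lambda>(a, vs). bullet_word k w a vs) (b \<odot>\<^sub>T x) =
      b \<odot>\<^sub>T induced TVec (\<lambda>(a, vs). bullet_word k w a vs) x"
    by (rule T.TV_ahom_eqI[where G = TVec and x = x])
      (use bx in \<open>simp_all add: ahom_comp[OF T.smult_TV_ahom T.induced_TV_ahom[OF m]] T.induced_word[OF m]
        ahom_comp[OF T.induced_TV_ahom[OF m] T.smult_TV_ahom] T.smult_word grade_closed smult\<close>)
qed

text \<open>The two claims need each other: the step to degree k + 1 respects the relations because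
  degree k is left linear, and left linearity is checked on words once the map is known to be well
  defined.\<close>

lemma bullet_deg_left_linear:
  assumes w: "w \<in> carrier TVec"
  shows "T.word_map TVec (bullet_word k w) \<and> left_linear (\<lambda>x. bullet_deg k x w)"
proof (induction k)
  case 0
  note m = bullet_word_map_zero[OF w]
  have "bullet_word 0 w (b \<otimes> a) vs = b \<odot>\<^sub>T bullet_word 0 w a vs"
    if "a \<in> grade \<Omega> 0" "b \<in> grade \<Omega> 0" "vs \<in> T.Vs" for a b vs
    using that w by (intro bullet_word_smult) auto
  from conjI[OF m left_linear_bullet_deg[OF m this]] show ?case .
next
  case (Suc k)
  then have B: "left_linear (\<lambda>x. bullet_deg k x w)" by blast
  note m = bullet_word_map_Suc[OF B]
  have "bullet_word (Suc k) w (b \<otimes> a) vs = b \<odot>\<^sub>T bullet_word (Suc k) w a vs"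
    if "a \<in> grade \<Omega> 0" "b \<in> grade \<Omega> 0" "vs \<in> T.Vs" for a b vs
    using that w B by (intro bullet_word_smult) auto
  from conjI[OF m left_linear_bullet_deg[OF m this]] show ?case .
qed

section \<open>The product on the whole tensor algebra, and its associativity\<close>

lemma bullet_deg_ahom: "w \<in> carrier TVec \<Longrightarrow> ahom TVec TVec (\<lambda>x. bullet_deg k x w)"
  using bullet_deg_left_linear unfolding left_linear_def by blast

lemma bullet_deg_word:
  "\<lbrakk>w \<in> carrier TVec; a \<in> grade \<Omega> 0; vs \<in> T.Vs\<rbrakk> \<Longrightarrow> bullet_deg k (T.wd a vs) w = bullet_word k w a vs"
  unfolding bullet_deg_induced using bullet_deg_left_linear[of w k] by (intro T.induced_word) simp_all

text \<open>All words in a relation have the same length, so they are multiplied by one and the same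
  \<open>bullet_deg k\<close>, which is already a map on the tensor algebra.\<close>

lemma bullet_word_map:
  assumes w: "w \<in> carrier TVec"
  shows "T.word_map TVec (\<lambda>a vs. bullet_deg (length vs) (T.wd a vs) w)"
  by (rule T.word_mapI)
    (use bullet_deg_ahom[OF w] T.word_middle T.word_coeff in
      \<open>simp_all add: ahom_comp[OF T.word_ahom_coeff bullet_deg_ahom[OF w]]
       ahom_comp[OF T.word_ahom_letter bullet_deg_ahom[OF w]] del: bullet_deg.simps\<close>)

lemma bullet_ahom_l: "w \<in> carrier TVec \<Longrightarrow> ahom TVec TVec (\<lambda>x. bullet x w)"
  unfolding bullet_def by (rule T.induced_TV_ahom[OF bullet_word_map])

lemma bullet_closed: "\<lbrakk>x \<in> carrier TVec; w \<in> carrier TVec\<rbrakk> \<Longrightarrow> bullet x w \<in> carrier TVec"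
  using ahom_closed[OF bullet_ahom_l] .

lemma bullet_word_deg:
  "\<lbrakk>w \<in> carrier TVec; a \<in> grade \<Omega> 0; vs \<in> T.Vs\<rbrakk> \<Longrightarrow> bullet (T.wd a vs) w = bullet_deg (length vs) (T.wd a vs) w"
  unfolding bullet_def by (subst T.induced_word[OF bullet_word_map]) simp_all

lemma bullet_homogeneous:
  assumes w: "w \<in> carrier TVec"
  shows "T.homogeneous k x \<Longrightarrow> bullet x w = bullet_deg k x w"
  by (induction rule: T.homogeneous.induct)
    (use w in \<open>simp_all add: bullet_word_deg ahom_add[OF bullet_ahom_l] ahom_add[OF bullet_deg_ahom]
      T.homogeneous_closed del: bullet_deg.simps\<close>)

lemma bullet_Nil: "\<lbrakk>w \<in> carrier TVec; a \<in> grade \<Omega> 0\<rbrakk> \<Longrightarrow> bullet (T.wd a []) w = a \<odot>\<^sub>T w"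
  by (simp add: bullet_word_deg bullet_deg_word bullet_word_eqs del: bullet_deg.simps)

text \<open>The recursion freed of its degree index. Both \<open>vs\<close> and its derivative are
  homogeneous of degree \<open>length vs\<close>, so \<open>bullet_homogeneous\<close> replaces
  \<open>bullet_deg\<close> by \<open>bullet\<close> in each term.\<close>

lemma bullet_Cons:
  assumes w: "w \<in> carrier TVec" and a: "a \<in> grade \<Omega> 0" and v: "v \<in> carrier Vec" and vs: "vs \<in> T.Vs"
  shows "bullet (T.wd a (v # vs)) w =
    bullet_Vec (a \<odot>\<^sub>V v) (bullet (T.wd \<one> vs) w) \<ominus>\<^sub>T bullet (nabla_Vec (a \<odot>\<^sub>V v) (T.wd \<one> vs)) w"
proof -
  have h: "T.homogeneous (length vs) (T.wd \<one> vs)" using vs T.homogeneous_word[OF one_A vs refl] by simp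
  have av: "a \<odot>\<^sub>V v \<in> carrier Vec" using V.smult_closed[of a v] a v by simp
  show ?thesis
    using bullet_homogeneous[OF w h] bullet_homogeneous[OF w homogeneous_nabla_Vec[OF h av]] w a v vs
    by (simp add: bullet_word_deg[of w a] bullet_deg_word[of w a] bullet_word_eqs bullet_step_def del: bullet_deg.simps)
qed

lemma bullet_smult_l:
  assumes w: "w \<in> carrier TVec" and b: "b \<in> grade \<Omega> 0" and x: "x \<in> carrier TVec"
  shows "bullet (b \<odot>\<^sub>T x) w = b \<odot>\<^sub>T bullet x w"
proof (rule T.TV_ahom_eqI[where G = TVec and x = x])
  fix a vs assume "a \<in> carrier A" "vs \<in> T.Vs"
  then have a: "a \<in> grade \<Omega> 0" and vs: "vs \<in> T.Vs" by simp_all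
  have "b \<odot>\<^sub>T bullet_deg (length vs) (T.wd a vs) w = bullet_deg (length vs) (b \<odot>\<^sub>T T.wd a vs) w"
    using bullet_deg_left_linear[OF w, of "length vs"] a b vs T.word_closed[of a vs] by (simp add: left_linear_def)
  then show "bullet (b \<odot>\<^sub>T T.wd a vs) w = b \<odot>\<^sub>T bullet (T.wd a vs) w"
    using a b vs w by (simp add: T.smult_word bullet_word_deg grade_closed)
qed (use w b x in \<open>simp_all add: ahom_comp[OF T.smult_TV_ahom bullet_ahom_l] ahom_comp[OF bullet_ahom_l T.smult_TV_ahom]\<close>)

text \<open>The recursion for \<open>\<bullet>\<close> lowers the degree by one, hence the inductions on the degree.\<close>

lemma homogeneous_cases [consumes 1, case_names coeff Cons add]:
  assumes "T.homogeneous k x"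
    and "\<And>a. \<lbrakk>a \<in> grade \<Omega> 0; k = 0\<rbrakk> \<Longrightarrow> Q (T.wd a [])"
    and "\<And>m a v vs. \<lbrakk>k = Suc m; length vs = m; a \<in> grade \<Omega> 0; v \<in> carrier Vec; vs \<in> T.Vs\<rbrakk> \<Longrightarrow> Q (T.wd a (v # vs))"
    and "\<And>x y. \<lbrakk>x \<in> carrier TVec; y \<in> carrier TVec; Q x; Q y\<rbrakk> \<Longrightarrow> Q (x \<oplus>\<^sub>T y)"
  shows "Q x"
  using assms(1)
proof (induction rule: T.homogeneous.induct)
  case (homogeneous_word a vs)
  then show ?case using assms(2)[of a] assms(3)[of "length (tl vs)" "tl vs" a "hd vs"] by (cases vs) simp_all
next
  case (homogeneous_add x y)
  then show ?case by (intro assms(4)) (simp_all add: T.homogeneous_closed)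
qed

text \<open>The two hypotheses in the case \<open>Cons\<close> are for the two elements that
  \<open>bullet_Cons\<close> multiplies by \<open>w\<close>. The second is not a word in general, so
  induction on the list would not provide it.\<close>

lemma TVec_degree_induct [consumes 1, case_names coeff Cons add]:
  assumes "x \<in> carrier TVec"
    and coeff: "\<And>a. a \<in> grade \<Omega> 0 \<Longrightarrow> Q (T.wd a [])"
    and Cons: "\<And>a v vs. \<lbrakk>a \<in> grade \<Omega> 0; v \<in> carrier Vec; vs \<in> T.Vs; Q (T.wd \<one> vs);
      Q (nabla_Vec (a \<odot>\<^sub>V v) (T.wd \<one> vs))\<rbrakk> \<Longrightarrow> Q (T.wd a (v # vs))"
    and add: "\<And>x y. \<lbrakk>x \<in> carrier TVec; y \<in> carrier TVec; Q x; Q y\<rbrakk> \<Longrightarrow> Q (x \<oplus>\<^sub>T y)"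
  shows "Q x"
proof -
  have hom: "T.homogeneous k x \<Longrightarrow> Q x" for k x
  proof (induction k arbitrary: x)
    case 0
    then show ?case by (induction rule: homogeneous_cases) (simp_all add: coeff add)
  next
    case (Suc k)
    from Suc.prems show ?case
    proof (induction rule: homogeneous_cases)
      case (Cons m a v vs)
      have h: "T.homogeneous k (T.wd \<one> vs)" using Cons T.homogeneous_word[OF one_A, of vs k] by simp
      have "a \<odot>\<^sub>V v \<in> carrier Vec" using V.smult_closed[of a v] Cons by simp
      then show ?case using Cons assms(3) Suc.IH[OF h] Suc.IH[OF homogeneous_nabla_Vec[OF h]] by simp
    qed (simp_all add: add)
  qed
  show ?thesis
    using assms(1) by (induction rule: T.induct_TV) (use hom[OF T.homogeneous_word] add in auto)
qed

text \<open>\<open>induced\<close> yields additivity in the left factor only; in the right factor it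
  has to be propagated through the recursion.\<close>

lemma bullet_ahom_r:
  assumes "x \<in> carrier TVec" shows "ahom TVec TVec (bullet x)"
  using assms
proof (induction rule: TVec_degree_induct)
  case (coeff a)
  then show ?case by (intro ahom_cong[OF T.smult_TV_ahom[of a]]) (simp_all add: bullet_Nil)
next
  case (Cons a v vs)
  have av: "a \<odot>\<^sub>V v \<in> carrier Vec" using V.smult_closed[of a v] Cons by simp
  have "ahom TVec TVec (\<lambda>w. bullet_Vec (a \<odot>\<^sub>V v) (bullet (T.wd \<one> vs) w)
      \<ominus>\<^sub>T bullet (nabla_Vec (a \<odot>\<^sub>V v) (T.wd \<one> vs)) w)"
    by (rule ahom_diff[OF ahom_comp[OF Cons.IH(1) bullet_Vec_ahom_r[OF av]] Cons.IH(2)])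
  then show ?case
    by (rule ahom_cong) (use Cons in \<open>simp add: bullet_Cons\<close>)
next
  case (add x y)
  show ?case
    by (rule ahom_cong[OF ahom_plus[OF add.IH]]) (use add in \<open>simp add: ahom_add[OF bullet_ahom_l]\<close>)
qed

text \<open>The recursion gives this directly when the word y has coefficient one, since the term it
  subtracts is the derivative part of v \<bullet> y. A coefficient a is first absorbed as v.a, and
  the v(da) terms this creates agree on both sides by \<open>nabla_Vec_smult\<close> and
  \<open>bullet_Vec_smult\<close>.\<close>

lemma bullet_bullet_Vec:
  assumes v: "v \<in> carrier Vec" and y: "y \<in> carrier TVec" and w: "w \<in> carrier TVec"
  shows "bullet (bullet_Vec v y) w = bullet_Vec v (bullet y w)"
proof (rule T.TV_ahom_eqI[where G = TVec and x = y])
  fix a vs assume "a \<in> carrier A" "vs \<in> T.Vs"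
  then have a: "a \<in> grade \<Omega> 0" and vs: "vs \<in> T.Vs" by simp_all
  let ?y = "T.wd \<one> vs" and ?va = "v \<lhd>\<^sub>V a" and ?d = "v (der \<Omega> a)"
  have y: "?y \<in> carrier TVec" by (rule wd_one_closed[OF vs])
  have va: "?va \<in> carrier Vec" using v a V.rsmult_closed[of a v] by simp
  have d: "?d \<in> grade \<Omega> 0" using v a by (simp add: vec_closed der_grade_zero)
  have ay: "T.wd a vs = a \<odot>\<^sub>T ?y"
    using T.smult_word[of a \<one> vs] a vs one_A by (simp add: grade_carrier[of _ 0])
  have ayc: "T.wd a vs \<in> carrier TVec" using T.word_closed[of a vs] a vs by simp
  have cl: "bullet_Vec ?va (bullet ?y w) \<in> carrier TVec" "bullet (nabla_Vec ?va ?y) w \<in> carrier TVec"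
    "?d \<odot>\<^sub>T bullet ?y w \<in> carrier TVec" "?d \<odot>\<^sub>T ?y \<in> carrier TVec" "nabla_Vec ?va ?y \<in> carrier TVec"
    using va y w d T.TV.smult_closed[of ?d] by (simp_all add: bullet_Vec_closed bullet_closed nabla_Vec_closed)
  have wc: "T.wd \<one> (?va # vs) \<in> carrier TVec" using va vs by (intro wd_one_closed) simp
  have one: "\<one> \<odot>\<^sub>V ?va = ?va" using V.smult_one[OF va] by simp
  have "bullet (bullet_Vec v (T.wd a vs)) w = bullet (T.wd \<one> (?va # vs)) w \<oplus>\<^sub>T bullet (nabla_Vec v (a \<odot>\<^sub>T ?y)) w"
    using T.cons_word[of v a vs] ahom_add[OF bullet_ahom_l[OF w] wc nabla_Vec_closed[OF v ayc]] v a vs ayc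
    by (simp add: bullet_Vec_eq T.cons_closed nabla_Vec_closed flip: ay)
  also have "bullet (nabla_Vec v (a \<odot>\<^sub>T ?y)) w = ?d \<odot>\<^sub>T bullet ?y w \<oplus>\<^sub>T bullet (nabla_Vec ?va ?y) w"
    using ahom_add[OF bullet_ahom_l[OF w]] v a y d w cl by (simp add: nabla_Vec_smult bullet_smult_l)
  also have "bullet (T.wd \<one> (?va # vs)) w = bullet_Vec ?va (bullet ?y w) \<ominus>\<^sub>T bullet (nabla_Vec ?va ?y) w"
    using bullet_Cons[OF w one_grade va vs] one by simp
  also have "(bullet_Vec ?va (bullet ?y w) \<ominus>\<^sub>T bullet (nabla_Vec ?va ?y) w) \<oplus>\<^sub>T
      (?d \<odot>\<^sub>T bullet ?y w \<oplus>\<^sub>T bullet (nabla_Vec ?va ?y) w) =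
      ?d \<odot>\<^sub>T bullet ?y w \<oplus>\<^sub>T bullet_Vec ?va (bullet ?y w)"
    using cl by (simp add: a_minus_def T.TV.a_ac T.TV.r_neg1 T.TV.r_neg2 T.TV.r_neg)
  also have "\<dots> = bullet_Vec v (bullet (T.wd a vs) w)"
    unfolding ay using v a y w by (simp add: bullet_smult_l bullet_Vec_smult bullet_closed)
  finally show "bullet (bullet_Vec v (T.wd a vs)) w = bullet_Vec v (bullet (T.wd a vs) w)" .
qed (use v y w in \<open>simp_all add: ahom_comp[OF bullet_Vec_ahom_r bullet_ahom_l] ahom_comp[OF bullet_ahom_l bullet_Vec_ahom_r]\<close>)

lemma bullet_assoc:
  assumes "x \<in> carrier TVec" and y: "y \<in> carrier TVec" and w: "w \<in> carrier TVec"
  shows "bullet (bullet x y) w = bullet x (bullet y w)"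
  using assms(1)
proof (induction rule: TVec_degree_induct)
  case (coeff a)
  then show ?case using y w by (simp add: bullet_Nil bullet_smult_l bullet_closed)
next
  case (Cons a v vs)
  have av: "a \<odot>\<^sub>V v \<in> carrier Vec" using V.smult_closed[of a v] Cons by simp
  have x: "T.wd \<one> vs \<in> carrier TVec" by (rule wd_one_closed) fact
  show ?case
    using Cons y w av x nabla_Vec_closed[OF av x]
    by (simp add: bullet_Cons bullet_closed ahom_minus[OF bullet_ahom_l] bullet_Vec_closed bullet_bullet_Vec)
next
  case (add x z)
  then show ?case using y w by (simp add: ahom_add[OF bullet_ahom_l] bullet_closed)
qed

section \<open>The unit, and the ring structure on the tensor algebra\<close>

lemma nabla_Vec_one: "v \<in> carrier Vec \<Longrightarrow> nabla_Vec v (T.wd \<one> []) = \<zero>\<^bsub>TVec\<^esub>"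
proof -
  assume v: "v \<in> carrier Vec"
  have "sq_T (T.wd \<one> []) = \<zero>\<^bsub>OT.MN\<^esub>"
    using ahom_zero[OF OT.pure_ahom_l[OF wd_one_closed[OF lists.Nil]]] by (simp add: sq_T_word one_grade der_one)
  then show ?thesis using ahom_zero[OF OT.contract_ahom[OF v]] by (simp add: nabla_Vec_def)
qed

lemma bullet_one_left: "w \<in> carrier TVec \<Longrightarrow> bullet (T.wd \<one> []) w = w"
  using T.TV.smult_one[of w] by (simp add: bullet_Nil one_grade)

text \<open>For a word with head v and tail y the recursion leaves v \<bullet> y minus the
  derivative of y along v, and this is the tensor of v and y.\<close>

lemma bullet_one_right:
  assumes "x \<in> carrier TVec" shows "bullet x (T.wd \<one> []) = x"
  using assms
proof (induction rule: TVec_degree_induct)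
  case (coeff a)
  then show ?case
    using T.smult_word[of a \<one> "[]"] wd_one_closed[of "[]"] one_A by (simp add: bullet_Nil grade_carrier[of _ 0])
next
  case (Cons a v vs)
  have av: "a \<odot>\<^sub>V v \<in> carrier Vec" using V.smult_closed[of a v] Cons by simp
  have x: "T.wd \<one> vs \<in> carrier TVec" by (rule wd_one_closed) fact
  have cl: "T.cons (a \<odot>\<^sub>V v) (T.wd \<one> vs) \<in> carrier TVec" "nabla_Vec (a \<odot>\<^sub>V v) (T.wd \<one> vs) \<in> carrier TVec"
    using av x by (simp_all add: T.cons_closed nabla_Vec_closed)
  then have "bullet_Vec (a \<odot>\<^sub>V v) (T.wd \<one> vs) \<ominus>\<^sub>T nabla_Vec (a \<odot>\<^sub>V v) (T.wd \<one> vs) =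
      T.cons (a \<odot>\<^sub>V v) (T.wd \<one> vs)"
    by (simp add: bullet_Vec_eq a_minus_def T.TV.a_assoc T.TV.r_neg)
  moreover have "bullet (T.wd a (v # vs)) (T.wd \<one> []) =
      bullet_Vec (a \<odot>\<^sub>V v) (T.wd \<one> vs) \<ominus>\<^sub>T nabla_Vec (a \<odot>\<^sub>V v) (T.wd \<one> vs)"
    using Cons wd_one_closed[of "[]"] by (simp add: bullet_Cons)
  ultimately show ?case
    using Cons T.word_Cons[of a v vs] by simp
next
  case (add x z)
  then show ?case using wd_one_closed[of "[]"] by (simp add: ahom_add[OF bullet_ahom_l])
qed

text \<open>The tail is the unit, whose derivative vanishes, so the subtracted term of the recursion
  disappears.\<close>

lemma bullet_vec:
  assumes v: "v \<in> carrier Vec" and w: "w \<in> carrier TVec"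
  shows "bullet (vec v) w = bullet_Vec v w"
proof -
  have "\<one> \<odot>\<^sub>V v = v" using V.smult_one[OF v] by simp
  moreover have "bullet \<zero>\<^bsub>TVec\<^esub> w = \<zero>\<^bsub>TVec\<^esub>" by (rule ahom_zero[OF bullet_ahom_l[OF w]])
  ultimately show ?thesis
    using v w bullet_Vec_closed[OF v w]
    by (simp add: bullet_Cons one_grade bullet_one_left nabla_Vec_one a_minus_def)
qed

lemma TVec_bullet_simps [simp]:
  "carrier TVec_bullet = carrier TVec" "mult TVec_bullet = bullet" "one TVec_bullet = T.wd \<one> []"
  "zero TVec_bullet = zero TVec" "add TVec_bullet = add TVec" "smult TVec_bullet = smult TVec"
  by (simp_all add: TVec_bullet_def)

lemma ring_TVec_bullet: "ring TVec_bullet"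
proof (rule ringI)
  show "abelian_group TVec_bullet" by (rule abelian_group_transfer[OF T.abelian_group_TV]) simp_all
  show "Group.monoid TVec_bullet"
    by (rule monoidI) (simp_all add: bullet_closed bullet_assoc bullet_one_left bullet_one_right wd_one_closed)
qed (simp_all add: ahom_add[OF bullet_ahom_l] ahom_add[OF bullet_ahom_r])

end

lemma (in abelian_group) finsum_minus:
  assumes "f \<in> I \<rightarrow> carrier G" "g \<in> I \<rightarrow> carrier G"
  shows "(\<Oplus>i\<in>I. f i \<ominus> g i) = finsum G f I \<ominus> finsum G g I"
proof -
  have id: "ahom G G (\<lambda>x. x)"
    by (rule ahomI) (simp_all add: abelian_group_axioms)
  have "(\<Oplus>i\<in>I. f i \<oplus> \<ominus> g i) = finsum G f I \<oplus> (\<Oplus>i\<in>I. \<ominus> g i)"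
    using assms by (intro finsum_addf) auto
  then show ?thesis
    using ahom_finsum[OF ahom_uminus[OF id] assms(2)] by (simp add: a_minus_def)
qed

section \<open>The quotient algebra and its curvature\<close>

context right_bimodule_connection
begin

lemma left_module_TVec_bullet: "left_module A TVec_bullet"
  by (intro left_module.intro ring_A ring.is_abelian_group[OF ring_TVec_bullet])
    (simp_all add: T.TV.smult_closed T.TV.smult_l_distr[simplified] T.TV.smult_r_distr
      T.TV.smult_assoc[simplified] T.TV.smult_one[simplified])

sublocale OB: tensor_product A Omega2 TVec_bullet
  by (intro tensor_product.intro bimod_forms left_module_TVec_bullet)

lemma vec_word_closed: "v \<in> carrier Vec \<Longrightarrow> vec v \<in> carrier TVec"
  by (rule wd_one_closed) simp

lemma curv_R_summands:
  "(\<lambda>i. OB.pt (der \<Omega> (\<xi> i)) (vec (u i))) \<in> {..<n} \<rightarrow> carrier OB.MN"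
  "i < n \<Longrightarrow> (\<lambda>j. OB.pt (\<xi> i \<otimes> \<xi> j) (bullet (vec (u j)) (vec (u i)))) \<in> {..<n} \<rightarrow> carrier OB.MN"
  by (auto simp: OB.pure_closed grade_closed xi_grade vec_word_closed u_Vec bullet_closed)

lemma curv_R_closed: "curv_R \<in> carrier OB.MN"
  unfolding curv_R_def
  by (intro OB.MN.minus_closed OB.MN.finsum_closed curv_R_summands Pi_I) simp_all

lemma R_hat_closed: "\<alpha> \<in> carrier (dual A Omega2) \<Longrightarrow> R_hat \<alpha> \<in> carrier TVec"
  using OB.contract_closed[OF _ curv_R_closed] by (simp add: R_hat_def)

sublocale B: ring TVec_bullet by (rule ring_TVec_bullet)

lemma ideal_W: "ideal W TVec_bullet"
  unfolding W_def by (rule B.genideal_ideal) (auto simp: R_hat_closed)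

sublocale W: ideal W TVec_bullet by (rule ideal_W)

lemma R_hat_W: "\<alpha> \<in> carrier (dual A Omega2) \<Longrightarrow> R_hat \<alpha> \<in> W"
  unfolding W_def using B.genideal_self[of "R_hat ` carrier (dual A Omega2)"] R_hat_closed by auto

lemma W_TVec: "h \<in> W \<Longrightarrow> h \<in> carrier TVec"
  using W.a_Hcarr by simp

lemma DA_simps:
  "carrier DA = cls ` carrier TVec" "add DA = add (TVec_bullet Quot W)" "zero DA = W"
  by (auto simp: DA_def ring.defs FactRing_def A_RCOSETS_def' cls_def)

lemma abelian_group_DA: "abelian_group DA"
  by (rule abelian_group_transfer[OF ring.is_abelian_group[OF W.quotient_is_ring]])
    (simp_all add: DA_def ring.defs FactRing_def)

lemma cls_ahom: "ahom TVec DA cls"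
  by (rule ahomI[OF T.abelian_group_TV abelian_group_DA])
    (use W.a_rcos_sum in \<open>simp_all add: DA_simps cls_def FactRing_def\<close>)

lemma cls_W: "h \<in> W \<Longrightarrow> cls h = \<zero>\<^bsub>DA\<^esub>"
  by (simp add: cls_def DA_simps W.a_rcos_const)

lemma cls_closed: "v \<in> carrier TVec \<Longrightarrow> cls v \<in> carrier DA"
  by (simp add: DA_simps)

lemma DA_cases: assumes "X \<in> carrier DA" obtains v where "v \<in> carrier TVec" "X = cls v"
  using assms by (auto simp: DA_simps)

text \<open>The left action on \<open>DA\<close> and \<open>nabla_DA\<close> are defined as the only
  element of the image of a coset. A map that vanishes on \<open>W\<close> is constant on cosets, so
  that element exists and is its value at any representative.\<close>

lemma the_elem_cls:
  assumes F: "ahom TVec G F" and zero: "\<And>h. h \<in> W \<Longrightarrow> F h = \<zero>\<^bsub>G\<^esub>" and v: "v \<in> carrier TVec"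
  shows "the_elem (F ` cls v) = F v"
proof -
  interpret F: abelian_group_hom TVec G F by fact
  have "F v' = F v" if "v' \<in> cls v" for v'
  proof -
    obtain h where "h \<in> W" "v' = h \<oplus>\<^sub>T v" using \<open>v' \<in> cls v\<close> by (auto simp: cls_def a_r_coset_def')
    then show ?thesis using v W_TVec zero by simp
  qed
  moreover have "v \<in> cls v" using W.a_rcos_self[of v] v by (simp add: cls_def)
  ultimately have "F ` cls v = {F v}" by blast
  then show ?thesis by simp
qed

text \<open>The left action is multiplication by a word of length zero, so the ideal absorbs
  it.\<close>

lemma W_smult: "\<lbrakk>a \<in> grade \<Omega> 0; h \<in> W\<rbrakk> \<Longrightarrow> a \<odot>\<^sub>T h \<in> W"
  using W.I_l_closed[of h "T.wd a []"] W_TVec[of h] T.word_closed[of a "[]"] by (simp add: bullet_Nil)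

lemma DA_smult:
  assumes a: "a \<in> grade \<Omega> 0" and v: "v \<in> carrier TVec"
  shows "a \<odot>\<^bsub>DA\<^esub> cls v = cls (a \<odot>\<^sub>T v)"
proof -
  have "a \<odot>\<^bsub>DA\<^esub> cls v = the_elem ((\<lambda>v. cls (a \<odot>\<^sub>T v)) ` cls v)"
    by (simp add: DA_def ring.defs module.defs)
  also have "\<dots> = cls (a \<odot>\<^sub>T v)"
    by (rule the_elem_cls[OF ahom_comp[OF T.smult_TV_ahom cls_ahom]]) (use a v in \<open>simp_all add: cls_W W_smult\<close>)
  finally show ?thesis .
qed

lemma left_module_DA: "left_module A DA"
proof (rule left_module.intro)
  note cls_add = ahom_add[OF cls_ahom, symmetric]
  note TV = T.TV.smult_closed T.TV.smult_l_distr[simplified] T.TV.smult_r_distr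
      T.TV.smult_assoc[simplified] T.TV.smult_one[simplified]
  fix a X assume "X \<in> carrier DA"
  then obtain v where v [simp]: "v \<in> carrier TVec" "X = cls v" by (rule DA_cases)
  show "\<one>\<^bsub>A\<^esub> \<odot>\<^bsub>DA\<^esub> X = X" by (simp add: DA_smult one_grade TV)
  assume a [simp]: "a \<in> carrier A"
  then have [simp]: "a \<in> grade \<Omega> 0" by simp
  show "a \<odot>\<^bsub>DA\<^esub> X \<in> carrier DA" by (simp add: DA_smult cls_closed TV)
  fix Y assume "Y \<in> carrier DA"
  then obtain w where [simp]: "w \<in> carrier TVec" "Y = cls w" by (rule DA_cases)
  show "a \<odot>\<^bsub>DA\<^esub> (X \<oplus>\<^bsub>DA\<^esub> Y) = a \<odot>\<^bsub>DA\<^esub> X \<oplus>\<^bsub>DA\<^esub> a \<odot>\<^bsub>DA\<^esub> Y"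
    by (simp add: DA_smult cls_add TV)
next
  note cls_add = ahom_add[OF cls_ahom, symmetric]
  note TV = T.TV.smult_closed T.TV.smult_l_distr[simplified] T.TV.smult_assoc[simplified]
  fix a b X assume "a \<in> carrier A" "b \<in> carrier A" "X \<in> carrier DA"
  moreover from this obtain v where "v \<in> carrier TVec" "X = cls v" by (auto elim: DA_cases)
  ultimately show "(a \<oplus>\<^bsub>A\<^esub> b) \<odot>\<^bsub>DA\<^esub> X = a \<odot>\<^bsub>DA\<^esub> X \<oplus>\<^bsub>DA\<^esub> b \<odot>\<^bsub>DA\<^esub> X"
    and "(a \<otimes>\<^bsub>A\<^esub> b) \<odot>\<^bsub>DA\<^esub> X = a \<odot>\<^bsub>DA\<^esub> (b \<odot>\<^bsub>DA\<^esub> X)"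
    by (simp_all add: DA_smult cls_add TV grade_closed)
qed (rule ring_A abelian_group_DA)+

sublocale D: left_module A DA by (rule left_module_DA)
sublocale D1: tensor_product A Omega1 DA by (intro tensor_product.intro bimod_forms left_module_DA)
sublocale D2: tensor_product A Omega2 DA by (intro tensor_product.intro bimod_forms left_module_DA)

section \<open>The covariant derivative on the quotient\<close>

definition nabla_cls where
  "nabla_cls v = (\<Oplus>\<^bsub>D1.MN\<^esub>i\<in>{..<n}. D1.pt (\<xi> i) (cls (bullet (vec (u i)) v)))"

lemma nabla_cls_ahom: "ahom TVec D1.MN nabla_cls"
  unfolding nabla_cls_def[abs_def]
  by (intro ahom_sum T.abelian_group_TV D1.abelian_group_MN
      ahom_comp[OF ahom_comp[OF bullet_ahom_r cls_ahom] D1.pure_ahom_r])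
    (simp_all add: vec_word_closed u_Vec xi_grade)

text \<open>The vector fields \<open>u i\<close> multiply from the left, and \<open>W\<close>
  absorbs left multiplication; hence the derivative descends to the quotient.\<close>

lemma nabla_cls_W:
  assumes h: "h \<in> W" shows "nabla_cls h = \<zero>\<^bsub>D1.MN\<^esub>"
proof -
  have "D1.pt (\<xi> i) (cls (bullet (vec (u i)) h)) = \<zero>\<^bsub>D1.MN\<^esub>" if "i < n" for i
  proof -
    have "bullet (vec (u i)) h \<in> W"
      using W.I_l_closed[OF h, of "vec (u i)"] that by (simp add: vec_word_closed u_Vec)
    then show ?thesis using ahom_zero[OF D1.pure_ahom_r[of "\<xi> i"]] xi_grade that by (simp add: cls_W)
  qed
  then have "nabla_cls h = (\<Oplus>\<^bsub>D1.MN\<^esub>i\<in>{..<n}. \<zero>\<^bsub>D1.MN\<^esub>)"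
    unfolding nabla_cls_def by (intro D1.MN.finsum_cong') auto
  then show ?thesis by (simp add: D1.MN.finsum_zero)
qed

lemma nabla_DA_cls: "v \<in> carrier TVec \<Longrightarrow> nabla_DA (cls v) = nabla_cls v"
  using the_elem_cls[OF nabla_cls_ahom nabla_cls_W] by (simp add: nabla_DA_def nabla_cls_def)

section \<open>Centrality of the coevaluation, and the Leibniz rule\<close>

definition coev where "coev = Phi (\<lambda>x. x)"

lemma id_right_linear: "right_linear (\<lambda>x. x)"
  by (auto simp: right_linear_def intro!: ahomI O1.abelian_group)

lemma coev_closed: "coev \<in> carrier OV.MN"
  unfolding coev_def by (rule Phi_closed)

text \<open>Regarded as endomorphisms of the one-forms, both sides are x \<mapsto> ax.\<close>

lemma coev_central:
  assumes a: "a \<in> grade \<Omega> 0" shows "OV.rs coev a = a \<odot>\<^bsub>OV.MN\<^esub> coev"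
proof (rule OV_eqI)
  show "OV.rs coev a \<in> carrier OV.MN" "a \<odot>\<^bsub>OV.MN\<^esub> coev \<in> carrier OV.MN"
    using a ahom_closed[OF OV.rsmult_MN_ahom[of a] coev_closed] ahom_closed[OF OV.smult_MN_ahom[of a] coev_closed]
    by simp_all
  show "ev_at x (OV.rs coev a) = ev_at x (a \<odot>\<^bsub>OV.MN\<^esub> coev)" if x: "x \<in> grade \<Omega> 1" for x
    using ev_at_rsmult[OF x coev_closed a] ev_at_smult[OF x coev_closed a] x a
    by (simp add: coev_def ev_at_Phi[OF id_right_linear] grade_mult_left)
qed

text \<open>\<open>act v\<close> is \<open>x \<otimes> w \<mapsto> x \<otimes> [w \<bullet> v]\<close> on \<open>\<Omega>\<^sup>1 \<otimes>\<^sub>A Vec A\<close>, so that \<open>\<nabla>[v] = act v coev\<close> and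
  the Leibniz rule comes from the centrality of \<open>coev\<close>.\<close>

definition act where
  "act v = induced D1.MN (\<lambda>(x, w). D1.pt x (cls (bullet_Vec w v)))"

lemma act_balanced:
  assumes v: "v \<in> carrier TVec"
  shows "OV.balanced D1.MN (\<lambda>x w. D1.pt x (cls (bullet_Vec w v)))"
proof (rule OV.balancedI)
  show "ahom Vec D1.MN (\<lambda>w. D1.pt x (cls (bullet_Vec w v)))" if "x \<in> carrier Omega1" for x
    by (rule ahom_comp[OF ahom_comp[OF bullet_Vec_ahom_l[OF v] cls_ahom] D1.pure_ahom_r[OF that]])
  show "ahom Omega1 D1.MN (\<lambda>x. D1.pt x (cls (bullet_Vec w v)))" if "w \<in> carrier Vec" for w
    using that v by (intro D1.pure_ahom_l cls_closed bullet_Vec_closed)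
  show "D1.pt (x \<lhd>\<^bsub>Omega1\<^esub> a) (cls (bullet_Vec w v)) = D1.pt x (cls (bullet_Vec (a \<odot>\<^sub>V w) v))"
    if "x \<in> carrier Omega1" "a \<in> carrier A" "w \<in> carrier Vec" for x a w
    using D1.pure_balanced[OF that(1,2) cls_closed[OF bullet_Vec_closed[OF that(3) v]]] that v
    by (simp add: bullet_Vec_smult_l DA_smult bullet_Vec_closed)
qed

lemma act_ahom: "v \<in> carrier TVec \<Longrightarrow> ahom OV.MN D1.MN (act v)"
  unfolding act_def by (rule OV.induced_ahom[OF act_balanced])

lemma act_pure:
  "\<lbrakk>v \<in> carrier TVec; x \<in> grade \<Omega> 1; w \<in> carrier Vec\<rbrakk> \<Longrightarrow> act v (OV.pt x w) = D1.pt x (cls (bullet_Vec w v))"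
  unfolding act_def by (rule OV.induced_pure[OF act_balanced]) simp_all

lemma act_smult:
  assumes "v \<in> carrier TVec" "a \<in> grade \<Omega> 0" "X \<in> carrier OV.MN"
  shows "act v (a \<odot>\<^bsub>OV.MN\<^esub> X) = a \<odot>\<^bsub>D1.MN\<^esub> act v X"
  by (rule OV.ahom_eqI[where G = D1.MN and X = X])
    (use assms in \<open>simp_all add: ahom_comp[OF OV.smult_MN_ahom act_ahom] ahom_comp[OF act_ahom D1.smult_MN_ahom]
     OV.smult_pure D1.smult_pure act_pure grade_closed cls_closed bullet_Vec_closed\<close>)

lemma coev_sums:
  assumes "a \<in> grade \<Omega> 0"
  shows "coev = (\<Oplus>\<^bsub>OV.MN\<^esub>i\<in>{..<n}. OV.pt (\<xi> i) (u i))"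
    "OV.rs coev a = (\<Oplus>\<^bsub>OV.MN\<^esub>i\<in>{..<n}. OV.pt (\<xi> i) (u i \<lhd>\<^sub>V a))"
proof -
  show *: "coev = (\<Oplus>\<^bsub>OV.MN\<^esub>i\<in>{..<n}. OV.pt (\<xi> i) (u i))" by (simp add: coev_def Phi_def)
  have "OV.rs coev a = (\<Oplus>\<^bsub>OV.MN\<^esub>i\<in>{..<n}. OV.rs (OV.pt (\<xi> i) (u i)) a)"
    unfolding * by (rule ahom_finsum[OF OV.rsmult_MN_ahom]) (use assms in \<open>auto simp: OV.pure_closed xi_grade u_Vec\<close>)
  also have "\<dots> = (\<Oplus>\<^bsub>OV.MN\<^esub>i\<in>{..<n}. OV.pt (\<xi> i) (u i \<lhd>\<^sub>V a))"
    using assms by (intro OV.MN.finsum_cong') (auto simp: OV.rsmult_pure OV.pure_closed xi_grade u_Vec V.rsmult_closed)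
  finally show "OV.rs coev a = (\<Oplus>\<^bsub>OV.MN\<^esub>i\<in>{..<n}. OV.pt (\<xi> i) (u i \<lhd>\<^sub>V a))" .
qed

lemma nabla_cls_act:
  assumes v: "v \<in> carrier TVec" shows "nabla_cls v = act v coev"
proof -
  have "act v coev = (\<Oplus>\<^bsub>D1.MN\<^esub>i\<in>{..<n}. act v (OV.pt (\<xi> i) (u i)))"
    unfolding coev_sums(1)[OF grade_zero] by (rule ahom_finsum[OF act_ahom[OF v]]) (auto simp: OV.pure_closed xi_grade u_Vec)
  also have "\<dots> = nabla_cls v"
    unfolding nabla_cls_def using v by (intro D1.MN.finsum_cong')
      (auto simp: act_pure xi_grade u_Vec bullet_vec D1.pure_closed cls_closed bullet_Vec_closed)
  finally show ?thesis ..
qed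

lemma nabla_cls_smult:
  assumes a: "a \<in> grade \<Omega> 0" and v: "v \<in> carrier TVec"
  shows "nabla_cls (a \<odot>\<^sub>T v) = D1.pt (der \<Omega> a) (cls v) \<oplus>\<^bsub>D1.MN\<^esub> a \<odot>\<^bsub>D1.MN\<^esub> nabla_cls v"
proof -
  \<comment> \<open>The two parts of \<open>bullet_Vec_smult\<close> for \<open>u i\<close>: the
    terms \<open>?f\<close> sum to da by the dual basis, and the terms \<open>?g\<close> to
    \<open>act v\<close> of the coevaluation times a, where centrality brings a to the left.\<close>
  let ?f = "\<lambda>i. D1.pt (\<xi> i \<otimes> u i (der \<Omega> a)) (cls v)" and ?g = "\<lambda>i. act v (OV.pt (\<xi> i) (u i \<lhd>\<^sub>V a))"
  have da: "der \<Omega> a \<in> grade \<Omega> 1" using a by (rule der_grade_zero)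
  have ua: "u i \<lhd>\<^sub>V a \<in> carrier Vec" if "i < n" for i using V.rsmult_closed[of a "u i"] u_Vec that a by simp
  have f: "?f \<in> {..<n} \<rightarrow> carrier D1.MN"
    using v da by (auto simp: D1.pure_closed xi_grade vec_closed u_Vec grade_closed cls_closed)
  have g: "?g \<in> {..<n} \<rightarrow> carrier D1.MN"
    using v ua by (auto simp: xi_grade act_pure D1.pure_closed cls_closed bullet_Vec_closed)
  have summand: "D1.pt (\<xi> i) (cls (bullet (vec (u i)) (a \<odot>\<^sub>T v))) = ?f i \<oplus>\<^bsub>D1.MN\<^esub> ?g i" if i: "i < n" for i
  proof -
    have d: "u i (der \<Omega> a) \<in> grade \<Omega> 0" using da i by (simp add: vec_closed u_Vec)
    have dv: "u i (der \<Omega> a) \<odot>\<^sub>T v \<in> carrier TVec" "a \<odot>\<^sub>T v \<in> carrier TVec"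
      using d v a T.TV.smult_closed by simp_all
    have "cls (bullet (vec (u i)) (a \<odot>\<^sub>T v)) =
        u i (der \<Omega> a) \<odot>\<^bsub>DA\<^esub> cls v \<oplus>\<^bsub>DA\<^esub> cls (bullet_Vec (u i \<lhd>\<^sub>V a) v)"
      using i v a dv d ua[OF i] by (simp add: bullet_vec u_Vec bullet_Vec_smult ahom_add[OF cls_ahom] bullet_Vec_closed DA_smult)
    then show ?thesis
      using i v d dv ua[OF i] D1.pure_balanced[of "\<xi> i" "u i (der \<Omega> a)" "cls v"] xi_grade
      by (simp add: D1.pure_add_r act_pure cls_closed bullet_Vec_closed D.smult_closed)
  qed
  have "nabla_cls (a \<odot>\<^sub>T v) = (\<Oplus>\<^bsub>D1.MN\<^esub>i\<in>{..<n}. ?f i \<oplus>\<^bsub>D1.MN\<^esub> ?g i)"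
    unfolding nabla_cls_def using summand f g by (intro D1.MN.finsum_cong') auto
  also have "\<dots> = finsum D1.MN ?f {..<n} \<oplus>\<^bsub>D1.MN\<^esub> finsum D1.MN ?g {..<n}"
    by (rule D1.MN.finsum_addf[OF f g])
  also have "finsum D1.MN ?f {..<n} = D1.pt (\<Oplus>\<^bsub>Omega1\<^esub>i\<in>{..<n}. \<xi> i \<otimes> u i (der \<Omega> a)) (cls v)"
    using da by (intro ahom_finsum[OF D1.pure_ahom_l[OF cls_closed[OF v]], symmetric])
      (auto simp: xi_grade vec_closed u_Vec grade_closed)
  also have "(\<Oplus>\<^bsub>Omega1\<^esub>i\<in>{..<n}. \<xi> i \<otimes> u i (der \<Omega> a)) = der \<Omega> a"
    using dual_basis_forms[of "der \<Omega> a"] da by simp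
  also have "finsum D1.MN ?g {..<n} = act v (OV.rs coev a)"
    unfolding coev_sums(2)[OF a]
    by (rule ahom_finsum[OF act_ahom[OF v], symmetric]) (auto simp: OV.pure_closed xi_grade ua)
  also have "\<dots> = a \<odot>\<^bsub>D1.MN\<^esub> nabla_cls v"
    using a v coev_closed by (simp add: coev_central act_smult nabla_cls_act)
  finally show ?thesis .
qed

lemma nabla_DA_ahom: "ahom DA D1.MN nabla_DA"
proof (rule ahomI[OF abelian_group_DA D1.abelian_group_MN])
  fix X assume "X \<in> carrier DA"
  then obtain v where v: "v \<in> carrier TVec" "X = cls v" by (rule DA_cases)
  then show "nabla_DA X \<in> carrier D1.MN" using ahom_closed[OF nabla_cls_ahom] by (simp add: nabla_DA_cls)
  fix Y assume "Y \<in> carrier DA"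
  then obtain w where w: "w \<in> carrier TVec" "Y = cls w" by (rule DA_cases)
  show "nabla_DA (X \<oplus>\<^bsub>DA\<^esub> Y) = nabla_DA X \<oplus>\<^bsub>D1.MN\<^esub> nabla_DA Y"
    using v w by (simp add: nabla_DA_cls ahom_add[OF nabla_cls_ahom] flip: ahom_add[OF cls_ahom])
qed

lemma nabla_DA_smult:
  assumes a: "a \<in> grade \<Omega> 0" and X: "X \<in> carrier DA"
  shows "nabla_DA (a \<odot>\<^bsub>DA\<^esub> X) = D1.pt (der \<Omega> a) X \<oplus>\<^bsub>D1.MN\<^esub> a \<odot>\<^bsub>D1.MN\<^esub> nabla_DA X"
proof -
  obtain v where "v \<in> carrier TVec" "X = cls v" using X by (rule DA_cases)
  then show ?thesis using a T.TV.smult_closed[of a v] by (simp add: DA_smult nabla_DA_cls nabla_cls_smult)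
qed

lemma left_covariant_derivative_nabla_DA: "left_covariant_derivative DA nabla_DA"
  unfolding left_covariant_derivative_def
  using ahom_closed[OF nabla_DA_ahom] ahom_add[OF nabla_DA_ahom] by (auto simp: nabla_DA_smult)

section \<open>Well-definedness of the curvature\<close>

lemma mult_ahom_forms:
  "x \<in> grade \<Omega> 1 \<Longrightarrow> ahom Omega1 Omega2 (\<lambda>y. x \<otimes> y)"
  "y \<in> grade \<Omega> 1 \<Longrightarrow> ahom Omega1 Omega2 (\<lambda>x. x \<otimes> y)"
  by (rule ahomI[OF O1.abelian_group O2.abelian_group];
      simp add: grade_mult_one_forms l_distr r_distr grade_carrier[of _ 1])+

lemma wedge_balanced: "x \<in> grade \<Omega> 1 \<Longrightarrow> D1.balanced D2.MN (\<lambda>y e. D2.pt (x \<otimes> y) e)"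
proof (rule D1.balancedI)
  assume x: "x \<in> grade \<Omega> 1"
  show "ahom DA D2.MN (D2.pt (x \<otimes> y))" if "y \<in> carrier Omega1" for y
    using x that by (intro D2.pure_ahom_r) (simp add: grade_mult_one_forms)
  show "ahom Omega1 D2.MN (\<lambda>y. D2.pt (x \<otimes> y) e)" if "e \<in> carrier DA" for e
    by (rule ahom_comp[OF mult_ahom_forms(1)[OF x] D2.pure_ahom_l[OF that]])
  show "D2.pt (x \<otimes> (y \<lhd>\<^bsub>Omega1\<^esub> a)) e = D2.pt (x \<otimes> y) (a \<odot>\<^bsub>DA\<^esub> e)"
    if "y \<in> carrier Omega1" "a \<in> carrier A" "e \<in> carrier DA" for y a e
    using D2.pure_balanced[of "x \<otimes> y" a e] x that
    by (simp add: grade_mult_one_forms m_assoc grade01_carrier)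
qed

lemma wedge_ahom: "x \<in> grade \<Omega> 1 \<Longrightarrow> ahom D1.MN D2.MN (wedge_tensor DA x)"
  unfolding wedge_tensor_def[abs_def] by (rule D1.induced_ahom[OF wedge_balanced])

lemma wedge_pure:
  "\<lbrakk>x \<in> grade \<Omega> 1; y \<in> grade \<Omega> 1; e \<in> carrier DA\<rbrakk> \<Longrightarrow> wedge_tensor DA x (D1.pt y e) = D2.pt (x \<otimes> y) e"
  unfolding wedge_tensor_def by (rule D1.induced_pure[OF wedge_balanced]) simp_all

lemma wedge_closed: "\<lbrakk>x \<in> grade \<Omega> 1; X \<in> carrier D1.MN\<rbrakk> \<Longrightarrow> wedge_tensor DA x X \<in> carrier D2.MN"
  using ahom_closed[OF wedge_ahom] .

lemma wedge_ahom_l: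
  assumes X: "X \<in> carrier D1.MN" shows "ahom Omega1 D2.MN (\<lambda>x. wedge_tensor DA x X)"
proof (rule ahomI[OF O1.abelian_group D2.abelian_group_MN])
  fix x y assume "x \<in> carrier Omega1" "y \<in> carrier Omega1"
  then have xy: "x \<in> grade \<Omega> 1" "y \<in> grade \<Omega> 1" by simp_all
  show "wedge_tensor DA (x \<oplus>\<^bsub>Omega1\<^esub> y) X = wedge_tensor DA x X \<oplus>\<^bsub>D2.MN\<^esub> wedge_tensor DA y X"
  proof (rule D1.ahom_eqI[where G = D2.MN and X = X])
    fix z e assume "z \<in> carrier Omega1" "e \<in> carrier DA"
    then show "wedge_tensor DA (x \<oplus>\<^bsub>Omega1\<^esub> y) (D1.pt z e) = wedge_tensor DA x (D1.pt z e) \<oplus>\<^bsub>D2.MN\<^esub> wedge_tensor DA y (D1.pt z e)"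
      using xy D2.pure_add_l[of "x \<otimes> z" "y \<otimes> z" e]
      by (simp add: wedge_pure grade_closed l_distr grade_carrier[of _ 1])
  qed (use xy X in \<open>simp_all add: wedge_ahom ahom_plus grade_closed\<close>)
qed (use X in \<open>simp add: wedge_closed\<close>)

lemma wedge_smult:
  assumes x: "x \<in> grade \<Omega> 1" and a: "a \<in> grade \<Omega> 0" and X: "X \<in> carrier D1.MN"
  shows "wedge_tensor DA x (a \<odot>\<^bsub>D1.MN\<^esub> X) = wedge_tensor DA (x \<otimes> a) X"
  by (rule D1.ahom_eqI[where G = D2.MN and X = X])
    (use x a X in \<open>simp_all add: ahom_comp[OF D1.smult_MN_ahom wedge_ahom] wedge_ahom grade_closed
      D1.smult_pure wedge_pure m_assoc grade01_carrier\<close>)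

text \<open>Moving a between x and f exchanges the sources of the term - x \<and> da \<otimes> f: on
  one side it comes from the graded Leibniz rule for d(xa), on the other from the Leibniz rule for
  the derivative of a.f.\<close>

lemma curvature_balanced:
  "D1.balanced D2.MN (\<lambda>x f. D2.pt (der \<Omega> x) f \<ominus>\<^bsub>D2.MN\<^esub> wedge_tensor DA x (nabla_DA f))"
proof (rule D1.balancedI)
  show "ahom DA D2.MN (\<lambda>f. D2.pt (der \<Omega> x) f \<ominus>\<^bsub>D2.MN\<^esub> wedge_tensor DA x (nabla_DA f))"
    if "x \<in> carrier Omega1" for x
    using that by (intro ahom_diff D2.pure_ahom_r ahom_comp[OF nabla_DA_ahom wedge_ahom]) (simp_all add: der_grade_one)
  show "ahom Omega1 D2.MN (\<lambda>x. D2.pt (der \<Omega> x) f \<ominus>\<^bsub>D2.MN\<^esub> wedge_tensor DA x (nabla_DA f))"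
    if "f \<in> carrier DA" for f
    using that der_ahom[of 1] ahom_closed[OF nabla_DA_ahom]
    by (intro ahom_diff ahom_comp[OF _ D2.pure_ahom_l] wedge_ahom_l) simp_all
  fix x a f assume "x \<in> carrier Omega1" "a \<in> carrier A" and f: "f \<in> carrier DA"
  then have x: "x \<in> grade \<Omega> 1" and a: "a \<in> grade \<Omega> 0" by simp_all
  have Nf: "nabla_DA f \<in> carrier D1.MN" using ahom_closed[OF nabla_DA_ahom f] .
  have aN: "a \<odot>\<^bsub>D1.MN\<^esub> nabla_DA f \<in> carrier D1.MN" "D1.pt (der \<Omega> a) f \<in> carrier D1.MN"
    using ahom_closed[OF D1.smult_MN_ahom[of a] Nf] a f by (simp_all add: D1.pure_closed der_grade_zero)
  let ?p = "D2.pt (der \<Omega> x \<otimes> a) f" and ?q = "D2.pt (x \<otimes> der \<Omega> a) f" and ?w = "wedge_tensor DA (x \<otimes> a) (nabla_DA f)"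
  have cl: "der \<Omega> x \<otimes> a \<in> grade \<Omega> 2" "x \<otimes> der \<Omega> a \<in> grade \<Omega> 2"
    using x a by (simp_all add: grade_closed)
  have pqw: "?p \<in> carrier D2.MN" "?q \<in> carrier D2.MN" "?w \<in> carrier D2.MN"
    using x a f Nf cl by (simp_all add: D2.pure_closed wedge_closed grade_closed)
  have "D2.pt (der \<Omega> (x \<otimes> a)) f = ?p \<ominus>\<^bsub>D2.MN\<^esub> ?q"
    using ahom_minus[OF D2.pure_ahom_l[OF f], of "der \<Omega> x \<otimes> a" "x \<otimes> der \<Omega> a"] cl
    by (simp add: der_mult_one[OF x a] forms_minus)
  moreover have "D2.pt (der \<Omega> x) (a \<odot>\<^bsub>DA\<^esub> f) = ?p"
    using D2.pure_balanced[of "der \<Omega> x" a f] x a f by (simp add: der_grade_one)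
  moreover have "wedge_tensor DA x (nabla_DA (a \<odot>\<^bsub>DA\<^esub> f)) = ?q \<oplus>\<^bsub>D2.MN\<^esub> ?w"
    using ahom_add[OF wedge_ahom[OF x] aN(2,1)] x a f Nf
    by (simp add: nabla_DA_smult wedge_pure wedge_smult der_grade_zero)
  ultimately show "D2.pt (der \<Omega> (x \<lhd>\<^bsub>Omega1\<^esub> a)) f \<ominus>\<^bsub>D2.MN\<^esub> wedge_tensor DA (x \<lhd>\<^bsub>Omega1\<^esub> a) (nabla_DA f) =
      D2.pt (der \<Omega> x) (a \<odot>\<^bsub>DA\<^esub> f) \<ominus>\<^bsub>D2.MN\<^esub> wedge_tensor DA x (nabla_DA (a \<odot>\<^bsub>DA\<^esub> f))"
    using pqw by (simp add: a_minus_def D2.MN.minus_add D2.MN.a_assoc)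
qed

text \<open>\<open>act_R v\<close> is \<open>x \<otimes> w \<mapsto> x \<otimes> [w \<bullet> v]\<close> on \<open>\<Omega>\<^sup>2 \<otimes>\<^sub>A T Vec A\<^sub>\<bullet>\<close>. It sends \<open>\<R>\<close> to the curvature
  at \<open>[v]\<close>.\<close>

definition act_R where
  "act_R v = induced D2.MN (\<lambda>(x, w). D2.pt x (cls (bullet w v)))"

lemma act_R_balanced:
  assumes v: "v \<in> carrier TVec"
  shows "OB.balanced D2.MN (\<lambda>x w. D2.pt x (cls (bullet w v)))"
proof (rule OB.balancedI)
  have b: "ahom TVec_bullet DA (\<lambda>w. cls (bullet w v))"
    by (rule ahom_transfer[OF ahom_comp[OF bullet_ahom_l[OF v] cls_ahom]]) simp_all
  show "ahom TVec_bullet D2.MN (\<lambda>w. D2.pt x (cls (bullet w v)))" if "x \<in> carrier Omega2" for x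
    by (rule ahom_comp[OF b D2.pure_ahom_r[OF that]])
  show "ahom Omega2 D2.MN (\<lambda>x. D2.pt x (cls (bullet w v)))" if "w \<in> carrier TVec_bullet" for w
    using that v by (intro D2.pure_ahom_l cls_closed bullet_closed) simp_all
  show "D2.pt (x \<lhd>\<^bsub>Omega2\<^esub> a) (cls (bullet w v)) = D2.pt x (cls (bullet (a \<odot>\<^bsub>TVec_bullet\<^esub> w) v))"
    if "x \<in> carrier Omega2" "a \<in> carrier A" "w \<in> carrier TVec_bullet" for x a w
    using D2.pure_balanced[OF that(1,2) cls_closed[OF bullet_closed[of w v]]] that v
    by (simp add: bullet_smult_l DA_smult bullet_closed)
qed

lemma act_R_ahom: "v \<in> carrier TVec \<Longrightarrow> ahom OB.MN D2.MN (act_R v)"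
  unfolding act_R_def by (rule OB.induced_ahom[OF act_R_balanced])

lemma act_R_pure:
  "\<lbrakk>v \<in> carrier TVec; x \<in> grade \<Omega> 2; w \<in> carrier TVec\<rbrakk> \<Longrightarrow> act_R v (OB.pt x w) = D2.pt x (cls (bullet w v))"
  unfolding act_R_def by (rule OB.induced_pure[OF act_R_balanced]) simp_all

text \<open>On a pure tensor of x and w both sides are the class of \<open>\<alpha> x\<close> times
  w \<bullet> v, because right multiplication by v is left linear.\<close>

lemma contract_act_R:
  assumes v: "v \<in> carrier TVec" and \<alpha>: "\<alpha> \<in> carrier (dual A Omega2)" and X: "X \<in> carrier OB.MN"
  shows "contract DA \<alpha> (act_R v X) = cls (bullet (contract TVec_bullet \<alpha> X) v)"
proof (rule OB.ahom_eqI[where G = DA and X = X])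
  show "ahom OB.MN DA (\<lambda>X. contract DA \<alpha> (act_R v X))"
    by (rule ahom_comp[OF act_R_ahom[OF v] D2.contract_ahom[OF \<alpha>]])
  have b: "ahom TVec_bullet DA (\<lambda>w. cls (bullet w v))"
    by (rule ahom_transfer[OF ahom_comp[OF bullet_ahom_l[OF v] cls_ahom]]) simp_all
  show "ahom OB.MN DA (\<lambda>X. cls (bullet (contract TVec_bullet \<alpha> X) v))"
    by (rule ahom_comp[OF OB.contract_ahom[OF \<alpha>] b])
  fix x w assume "x \<in> carrier Omega2" "w \<in> carrier TVec_bullet"
  then show "contract DA \<alpha> (act_R v (OB.pt x w)) = cls (bullet (contract TVec_bullet \<alpha> (OB.pt x w)) v)"
    using v \<alpha> O2.dual_closed[OF \<alpha>, of x]
    by (simp add: act_R_pure D2.contract_pure OB.contract_pure cls_closed bullet_closed bullet_smult_l DA_smult)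
qed (rule X)

text \<open>The first derivative supplies \<open>\<xi> i\<close> and \<open>u i\<close>; the second
  puts \<open>\<xi> j\<close> to the right of \<open>\<xi> i\<close> and \<open>u j\<close> to the
  left of \<open>u i\<close>. Associativity groups the vector fields as (u_j \<bullet> u_i)
  \<bullet> v, with the opposite index orders of \<open>curv_R\<close>.\<close>

lemma curvature_cls:
  assumes v: "v \<in> carrier TVec" shows "curvature DA nabla_DA (cls v) = act_R v curv_R"
proof -
  let ?h = "\<lambda>x f. D2.pt (der \<Omega> x) f \<ominus>\<^bsub>D2.MN\<^esub> wedge_tensor DA x (nabla_DA f)"
  let ?p = "\<lambda>i. D2.pt (der \<Omega> (\<xi> i)) (cls (bullet (vec (u i)) v))"
  let ?q = "\<lambda>i. \<Oplus>\<^bsub>D2.MN\<^esub>j\<in>{..<n}. D2.pt (\<xi> i \<otimes> \<xi> j) (cls (bullet (bullet (vec (u j)) (vec (u i))) v))"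
  note cl = xi_grade vec_word_closed u_Vec bullet_closed cls_closed v grade_closed D1.pure_closed D2.pure_closed
  have p: "?p \<in> {..<n} \<rightarrow> carrier D2.MN" by (auto simp: cl)
  have q: "?q \<in> {..<n} \<rightarrow> carrier D2.MN" by (auto intro!: D2.MN.finsum_closed simp: cl)
  have wedge: "wedge_tensor DA (\<xi> i) (nabla_DA (cls (bullet (vec (u i)) v))) = ?q i" if i: "i < n" for i
  proof -
    have nabla: "nabla_DA (cls (bullet (vec (u i)) v)) =
        (\<Oplus>\<^bsub>D1.MN\<^esub>j\<in>{..<n}. D1.pt (\<xi> j) (cls (bullet (vec (u j)) (bullet (vec (u i)) v))))"
      using i by (simp add: nabla_DA_cls nabla_cls_def cl)
    have "wedge_tensor DA (\<xi> i) (nabla_DA (cls (bullet (vec (u i)) v))) =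
        (\<Oplus>\<^bsub>D2.MN\<^esub>j\<in>{..<n}. wedge_tensor DA (\<xi> i) (D1.pt (\<xi> j) (cls (bullet (vec (u j)) (bullet (vec (u i)) v)))))"
      unfolding nabla using i by (intro ahom_finsum[OF wedge_ahom]) (auto simp: cl)
    also have "\<dots> = ?q i"
    proof (rule D2.MN.finsum_cong'[OF refl])
      show "(\<lambda>j. D2.pt (\<xi> i \<otimes> \<xi> j) (cls (bullet (bullet (vec (u j)) (vec (u i))) v))) \<in> {..<n} \<rightarrow> carrier D2.MN"
        using i by (auto simp: cl)
      fix j assume "j \<in> {..<n}"
      then have j: "j < n" by simp
      have "bullet (bullet (vec (u j)) (vec (u i))) v = bullet (vec (u j)) (bullet (vec (u i)) v)"
        using i j by (intro bullet_assoc) (simp_all add: cl)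
      then show "wedge_tensor DA (\<xi> i) (D1.pt (\<xi> j) (cls (bullet (vec (u j)) (bullet (vec (u i)) v)))) =
          D2.pt (\<xi> i \<otimes> \<xi> j) (cls (bullet (bullet (vec (u j)) (vec (u i))) v))"
        using i j by (simp only: wedge_pure xi_grade cl)
    qed
    finally show ?thesis .
  qed
  have "curvature DA nabla_DA (cls v) = induced D2.MN (\<lambda>(x, f). ?h x f) (nabla_cls v)"
    using v by (simp add: curvature_def nabla_DA_cls)
  also have "\<dots> = (\<Oplus>\<^bsub>D2.MN\<^esub>i\<in>{..<n}. induced D2.MN (\<lambda>(x, f). ?h x f) (D1.pt (\<xi> i) (cls (bullet (vec (u i)) v))))"
    unfolding nabla_cls_def by (rule ahom_finsum[OF D1.induced_ahom[OF curvature_balanced]]) (auto simp: cl)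
  also have "\<dots> = (\<Oplus>\<^bsub>D2.MN\<^esub>i\<in>{..<n}. ?p i \<ominus>\<^bsub>D2.MN\<^esub> ?q i)"
  proof (rule D2.MN.finsum_cong'[OF refl])
    show "(\<lambda>i. ?p i \<ominus>\<^bsub>D2.MN\<^esub> ?q i) \<in> {..<n} \<rightarrow> carrier D2.MN"
      using p q by (intro Pi_I D2.MN.minus_closed) blast+
    fix i assume "i \<in> {..<n}"
    then show "induced D2.MN (\<lambda>(x, f). ?h x f) (D1.pt (\<xi> i) (cls (bullet (vec (u i)) v))) = ?p i \<ominus>\<^bsub>D2.MN\<^esub> ?q i"
      by (subst D1.induced_pure[OF curvature_balanced]) (simp_all add: cl wedge)
  qed
  also have "\<dots> = finsum D2.MN ?p {..<n} \<ominus>\<^bsub>D2.MN\<^esub> finsum D2.MN ?q {..<n}"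
    by (rule D2.MN.finsum_minus[OF p q])
  also have "finsum D2.MN ?p {..<n} = act_R v (\<Oplus>\<^bsub>OB.MN\<^esub>i\<in>{..<n}. OB.pt (der \<Omega> (\<xi> i)) (vec (u i)))"
    unfolding ahom_finsum[OF act_R_ahom[OF v] curv_R_summands(1)]
    using p by (intro D2.MN.finsum_cong') (auto simp: act_R_pure cl)
  also have "finsum D2.MN ?q {..<n} = act_R v (\<Oplus>\<^bsub>OB.MN\<^esub>i\<in>{..<n}. \<Oplus>\<^bsub>OB.MN\<^esub>j\<in>{..<n}.
      OB.pt (\<xi> i \<otimes> \<xi> j) (bullet (vec (u j)) (vec (u i))))"
  proof -
    have inner: "act_R v (\<Oplus>\<^bsub>OB.MN\<^esub>j\<in>{..<n}. OB.pt (\<xi> i \<otimes> \<xi> j) (bullet (vec (u j)) (vec (u i)))) = ?q i" if "i < n" for i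
      unfolding ahom_finsum[OF act_R_ahom[OF v] curv_R_summands(2)[OF that]]
      using that by (intro D2.MN.finsum_cong') (auto simp: act_R_pure cl)
    have "(\<lambda>i. \<Oplus>\<^bsub>OB.MN\<^esub>j\<in>{..<n}. OB.pt (\<xi> i \<otimes> \<xi> j) (bullet (vec (u j)) (vec (u i)))) \<in> {..<n} \<rightarrow> carrier OB.MN"
      by (intro Pi_I OB.MN.finsum_closed curv_R_summands) simp
    from ahom_finsum[OF act_R_ahom[OF v] this] show ?thesis
      using D2.MN.finsum_cong'[OF refl q inner] by (simp only: lessThan_iff)
  qed
  also have "act_R v (\<Oplus>\<^bsub>OB.MN\<^esub>i\<in>{..<n}. OB.pt (der \<Omega> (\<xi> i)) (vec (u i))) \<ominus>\<^bsub>D2.MN\<^esub>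
      act_R v (\<Oplus>\<^bsub>OB.MN\<^esub>i\<in>{..<n}. \<Oplus>\<^bsub>OB.MN\<^esub>j\<in>{..<n}. OB.pt (\<xi> i \<otimes> \<xi> j) (bullet (vec (u j)) (vec (u i)))) =
      act_R v curv_R"
    unfolding curv_R_def
    by (rule ahom_minus[OF act_R_ahom[OF v], symmetric])
      (intro OB.MN.finsum_closed curv_R_summands Pi_I; simp)+
  finally show ?thesis .
qed

lemma curvature_zero:
  assumes "fg_projective_right A Omega2" and X: "X \<in> carrier DA"
  shows "curvature DA nabla_DA X = \<zero>\<^bsub>D2.MN\<^esub>"
proof -
  obtain v where v: "v \<in> carrier TVec" "X = cls v" using X by (rule DA_cases)
  have "act_R v curv_R = \<zero>\<^bsub>D2.MN\<^esub>"
  proof (rule D2.contract_faithful[OF assms(1) ahom_closed[OF act_R_ahom[OF v(1)] curv_R_closed]])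
    fix \<alpha> assume \<alpha>: "\<alpha> \<in> carrier (dual A Omega2)"
    have "bullet (R_hat \<alpha>) v \<in> W" using W.I_r_closed[OF R_hat_W[OF \<alpha>], of v] v by simp
    then show "contract DA \<alpha> (act_R v curv_R) = \<zero>\<^bsub>DA\<^esub>"
      using contract_act_R[OF v(1) \<alpha> curv_R_closed] by (simp add: cls_W flip: R_hat_def)
  qed
  then show ?thesis using v by (simp add: curvature_cls)
qed

end

text \<open>Since \<open>nabla_DA\<close> is defined by choosing representatives through
  \<open>the_elem\<close>, the conclusion also certifies that it is a left covariant derivative and
  that it has the intended values on classes.\<close>

theorem proposition5p2:
  fixes \<Omega> :: "'w dga" and n :: nat and \<xi> :: "nat \<Rightarrow> 'w" and u :: "nat \<Rightarrow> 'w \<Rightarrow> 'w"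
    and sq :: "'w \<Rightarrow> ('w \<times> 'w \<Rightarrow>\<^sub>0 int) set"
    and sinv :: "('w \<times> 'w \<Rightarrow>\<^sub>0 int) set \<Rightarrow> ('w \<times> 'w \<Rightarrow>\<^sub>0 int) set"
  defines "A \<equiv> base_ring \<Omega>"
    and "T \<equiv> right_bimodule_connection.TVec_bullet \<Omega> n \<xi> u sq sinv"
    and "DA \<equiv> right_bimodule_connection.DA \<Omega> n \<xi> u sq sinv"
    and "cls \<equiv> right_bimodule_connection.cls \<Omega> n \<xi> u sq sinv"
    and "nabla \<equiv> right_bimodule_connection.nabla_DA \<Omega> n \<xi> u sq sinv"
  assumes "right_bimodule_connection \<Omega> n \<xi> u sq sinv"
    and "fg_projective_right A (forms \<Omega> 2)"
  shows "dg_algebra.left_covariant_derivative \<Omega> DA nabla \<and>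
    (\<forall>v\<in>carrier T. nabla (cls v) =
       (\<Oplus>\<^bsub>tensor A (forms \<Omega> 1) DA\<^esub>i\<in>{..<n}. pure_tensor A (forms \<Omega> 1) DA (\<xi> i)
          (cls (word A (dual A (forms \<Omega> 1)) \<one>\<^bsub>A\<^esub> [u i] \<otimes>\<^bsub>T\<^esub> v)))) \<and>
    (\<forall>X\<in>carrier DA. dg_algebra.curvature \<Omega> DA nabla X = \<zero>\<^bsub>tensor A (forms \<Omega> 2) DA\<^esub>)"
proof -
  interpret C: right_bimodule_connection \<Omega> n \<xi> u sq sinv by fact
  show ?thesis
    using C.left_covariant_derivative_nabla_DA C.curvature_zero assms(7)
    by (simp add: A_def T_def DA_def cls_def nabla_def C.nabla_DA_cls C.nabla_cls_def)
qed

end
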